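(* Let $f,g:\mathbb{R}\to\mathbb{R}$ be bounded and continuous functions. Let $u$, $v$, $w:[0,T]\times\mathbb{R}\to\mathbb{R}$ be the unique solutions of the heat equation $$\partial_t z(t,x)=\tfrac12\partial_{xx}z(t,x),\quad x\in\mathbb{R},\ t\in\,]0,T],$$ with initial conditions $u(0,x)=f(x)$, $v(0,x)=g(x)$ and $w(0,x)=f(x)g(x)$, $x\in\mathbb{R}$, respectively, where uniqueness is understood among the class of functions $z$ satisfying $|z(t,x)|\le A e^{a x^2}$ for all $x\in\mathbb{R}$, $t\in[0,T]$, for some $a,A>0$. Then for each $t\in[0,T]$, $$u(t,B_t)\circ v(t,B_t)=w(t,B_t)\quad\text{almost surely},$$ where $\circ$ is the anti-Wick product.
   Context: Let $T>0$ and let $(\Omega,\mathcal{F},\mathcal{P})$ be a complete probability space carrying a one-dimensional Brownian motion $\{B_t\}_{0\le t\le T}$, with $\mathcal{F}=\mathcal{F}_T$, where $\{\mathcal{F}_t\}_{0\le t\le T}$ is the augmented Brownian filtration. Every $X\in\mathcal{L}^2(\Omega)$ has a unique Wiener–Itô chaos decomposition $X=\sum_{n\ge0}I_n(h_n)$ with $h_n\in\mathcal{L}^2([0,T]^n)$ symmetric, $I_n$ the $n$-th order multiple Itô integral, $I_0(h_0)=E[X]$, and $E[|X|^2]=\sum_{n\ge0}n!|h_n|^2_{\mathcal{L}^2([0,T]^n)}$. Let $\mathcal{G}_{\sqrt2}:=\{X=\sum_n I_n(h_n)\in\mathcal{L}^2(\Omega):\sum_{n\ge0}n!\,2^n|h_n|^2_{\mathcal{L}^2([0,T]^n)}<\infty\}$.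 For $k\ge1$ the $k$-th order Hida–Malliavin derivative of $X=\sum_n I_n(h_n)$ is $D^k_{t_1,\dots,t_k}X:=\sum_{n\ge k}n(n-1)\cdots(n-k+1)I_{n-k}(h_n(\cdot,t_1,\dots,t_k))$ (for a.e. $(t_1,\dots,t_k)\in[0,T]^k$), and $D^0X:=X$. For $X,Y\in\mathcal{G}_{\sqrt2}$ the anti-Wick product is $$X\circ Y:=\sum_{n\ge0}\frac1{n!}\int_{[0,T]^n}D^n_{t_1,\dots,t_n}X\cdot D^n_{t_1,\dots,t_n}Y\,dt_1\cdots dt_n,$$ where the series converges in $\mathcal{L}^1(\Omega)$ and the $n=0$ term is $X\cdot Y$. Since the product is defined for elements of $\mathcal{G}_{\sqrt2}$, the assertion is understood to include that $u(t,B_t),v(t,B_t)\in\mathcal{G}_{\sqrt2}$. "Solution" means classical solution: continuous on $[0,T]\times\mathbb{R}$, once continuously differentiable in $t$ and twice in $x$ on $]0,T]\times\mathbb{R}$. *)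

theory Defs
  imports "HOL-Probability.Probability"
begin

definition augmented_filtration ::
    "'a measure \<Rightarrow> (real \<Rightarrow> 'a \<Rightarrow> real) \<Rightarrow> real \<Rightarrow> 'a measure" where
  "augmented_filtration M B t =
     sigma (space M)
       ({B s -` A \<inter> space M | s A. s \<in> {0..t} \<and> A \<in> sets borel} \<union> null_sets M)"

definition increasing_times :: "real \<Rightarrow> nat \<Rightarrow> (nat \<Rightarrow> real) \<Rightarrow> bool" where
  "increasing_times T m \<tau> \<longleftrightarrow> (\<forall>i\<le>m. \<tau> i \<in> {0..T}) \<and> (\<forall>i<m. \<tau> i < \<tau> (Suc i))"

locale brownian_space = prob_space M + complete_measure M
  for M :: "'a measure" +
  fixes T :: real and B :: "real \<Rightarrow> 'a \<Rightarrow> real"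
  assumes horizon_pos: "0 < T"
    and measurable_B: "\<And>t. t \<in> {0..T} \<Longrightarrow> B t \<in> borel_measurable M"
    and start: "AE \<omega> in M. B 0 \<omega> = 0"
    and normal_increments:
      "\<And>s t. 0 \<le> s \<Longrightarrow> s < t \<Longrightarrow> t \<le> T \<Longrightarrow>
         distributed M lborel (\<lambda>\<omega>. B t \<omega> - B s \<omega>) (normal_density 0 (sqrt (t - s)))"
    and indep_increments:
      "\<And>m \<tau>. increasing_times T m \<tau> \<Longrightarrow>
         indep_vars (\<lambda>_. borel) (\<lambda>i \<omega>. B (\<tau> (Suc i)) \<omega> - B (\<tau> i) \<omega>) {..<m}"
    and continuous_paths: "AE \<omega> in M. continuous_on {0..T} (\<lambda>t. B t \<omega>)"
    and generated: "sets M = sets (augmented_filtration M B T)"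

definition square_integrable :: "'b measure \<Rightarrow> ('b \<Rightarrow> real) \<Rightarrow> bool" where
  "square_integrable N f \<longleftrightarrow> f \<in> borel_measurable N \<and> integrable N (\<lambda>x. (f x)\<^sup>2)"

definition L2_tendsto :: "'b measure \<Rightarrow> (nat \<Rightarrow> 'b \<Rightarrow> real) \<Rightarrow> ('b \<Rightarrow> real) \<Rightarrow> bool" where
  "L2_tendsto N F f \<longleftrightarrow>
     (\<forall>k. square_integrable N (F k)) \<and> square_integrable N f \<and>
     (\<lambda>k. \<integral>x. (F k x - f x)\<^sup>2 \<partial>N) \<longlonglongrightarrow> 0"

definition L1_tendsto :: "'b measure \<Rightarrow> (nat \<Rightarrow> 'b \<Rightarrow> real) \<Rightarrow> ('b \<Rightarrow> real) \<Rightarrow> bool" where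
  "L1_tendsto N F f \<longleftrightarrow>
     (\<forall>k. integrable N (F k)) \<and> integrable N f \<and>
     (\<lambda>k. \<integral>x. \<bar>F k x - f x\<bar> \<partial>N) \<longlonglongrightarrow> 0"

text \<open>
  Points of \<open>[0, T]\<^sup>n\<close> are extensional functions on \<open>{..<n}\<close>. For \<open>n = 0\<close> the cube is a
  single point of mass 1, so kernels of order 0 are constants.
\<close>

definition cube :: "real \<Rightarrow> nat \<Rightarrow> (nat \<Rightarrow> real) measure" where
  "cube T n = (\<Pi>\<^sub>M i\<in>{..<n}. restrict_space lborel {0..T})"

text \<open>
  Ito's construction: the integral of a step function on \<open>[0, T]\<^sup>n\<close> that vanishes on all
  diagonal boxes is the corresponding polynomial in the increments of \<open>B\<close>, and the integral
  of a general kernel is the \<open>L\<^sup>2\<close> limit along any approximating sequence of such step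
  functions. Integrals are random variables up to null sets, hence the relational form.
\<close>

definition off_diagonal_indices :: "nat \<Rightarrow> nat \<Rightarrow> (nat \<Rightarrow> nat) set" where
  "off_diagonal_indices n m = {i \<in> {..<n} \<rightarrow>\<^sub>E {..<m}. inj_on i {..<n}}"

definition step_kernel ::
    "nat \<Rightarrow> nat \<Rightarrow> (nat \<Rightarrow> real) \<Rightarrow> ((nat \<Rightarrow> nat) \<Rightarrow> real) \<Rightarrow> (nat \<Rightarrow> real) \<Rightarrow> real" where
  "step_kernel n m \<tau> a s =
     (\<Sum>i\<in>off_diagonal_indices n m.
        a i * (\<Prod>j<n. indicator {\<tau> (i j)<..\<tau> (Suc (i j))} (s j)))"

definition step_integral ::
    "(real \<Rightarrow> 'a \<Rightarrow> real) \<Rightarrow> nat \<Rightarrow> nat \<Rightarrow> (nat \<Rightarrow> real) \<Rightarrow> ((nat \<Rightarrow> nat) \<Rightarrow> real) \<Rightarrow> 'a \<Rightarrow> real" where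
  "step_integral B n m \<tau> a \<omega> =
     (\<Sum>i\<in>off_diagonal_indices n m.
        a i * (\<Prod>j<n. B (\<tau> (Suc (i j))) \<omega> - B (\<tau> (i j)) \<omega>))"

definition has_multiple_ito_integral ::
    "'a measure \<Rightarrow> real \<Rightarrow> (real \<Rightarrow> 'a \<Rightarrow> real) \<Rightarrow> nat \<Rightarrow>
     ((nat \<Rightarrow> real) \<Rightarrow> real) \<Rightarrow> ('a \<Rightarrow> real) \<Rightarrow> bool" where
  "has_multiple_ito_integral M T B n h J \<longleftrightarrow>
     (\<exists>m \<tau> a. (\<forall>k. increasing_times T (m k) (\<tau> k)) \<and>
        L2_tendsto (cube T n) (\<lambda>k. step_kernel n (m k) (\<tau> k) (a k)) h \<and>
        L2_tendsto M (\<lambda>k. step_integral B n (m k) (\<tau> k) (a k)) J)"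

definition symmetric_kernel :: "real \<Rightarrow> nat \<Rightarrow> ((nat \<Rightarrow> real) \<Rightarrow> real) \<Rightarrow> bool" where
  "symmetric_kernel T n h \<longleftrightarrow>
     (\<forall>p. p permutes {..<n} \<longrightarrow> (AE s in cube T n. h (s \<circ> p) = h s))"

definition has_chaos_expansion ::
    "'a measure \<Rightarrow> real \<Rightarrow> (real \<Rightarrow> 'a \<Rightarrow> real) \<Rightarrow> ('a \<Rightarrow> real) \<Rightarrow>
     (nat \<Rightarrow> (nat \<Rightarrow> real) \<Rightarrow> real) \<Rightarrow> bool" where
  "has_chaos_expansion M T B X h \<longleftrightarrow>
     (\<forall>n. square_integrable (cube T n) (h n) \<and> symmetric_kernel T n (h n)) \<and>
     (\<exists>J. (\<forall>n. has_multiple_ito_integral M T B n (h n) (J n)) \<and>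
        L2_tendsto M (\<lambda>N \<omega>. \<Sum>n\<le>N. J n \<omega>) X)"

definition G_sqrt2 ::
    "'a measure \<Rightarrow> real \<Rightarrow> (real \<Rightarrow> 'a \<Rightarrow> real) \<Rightarrow> ('a \<Rightarrow> real) set" where
  "G_sqrt2 M T B =
     {X. \<exists>h. has_chaos_expansion M T B X h \<and>
        summable (\<lambda>n. fact n * 2 ^ n * (\<integral>s. (h n s)\<^sup>2 \<partial>cube T n))}"

text \<open>The kernel \<open>h(\<cdot>, t\<^sub>1, \<dots>, t\<^sub>k)\<close> of order \<open>n - k\<close>, for \<open>k \<le> n\<close>.\<close>

definition kernel_slice ::
    "nat \<Rightarrow> nat \<Rightarrow> ((nat \<Rightarrow> real) \<Rightarrow> real) \<Rightarrow> (nat \<Rightarrow> real) \<Rightarrow> (nat \<Rightarrow> real) \<Rightarrow> real" where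
  "kernel_slice n k h t s = h (\<lambda>i\<in>{..<n}. if i < n - k then s i else t (i - (n - k)))"

text \<open>
  \<open>D\<close> is a jointly measurable version of the random field \<open>(t, \<omega>) \<mapsto> D\<^sup>k\<^sub>t X (\<omega>)\<close>; the defining
  series is taken in \<open>L\<^sup>2(\<Omega>)\<close> for almost every \<open>t\<close>. Joint measurability fixes \<open>D\<close> up to
  null sets of the product measure and makes \<open>\<integral> D\<^sup>k\<^sub>t X D\<^sup>k\<^sub>t Y dt\<close> well defined almost surely.
\<close>

definition has_hida_malliavin_derivative ::
    "'a measure \<Rightarrow> real \<Rightarrow> (real \<Rightarrow> 'a \<Rightarrow> real) \<Rightarrow> nat \<Rightarrow> ('a \<Rightarrow> real) \<Rightarrow>
     ((nat \<Rightarrow> real) \<Rightarrow> 'a \<Rightarrow> real) \<Rightarrow> bool" where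
  "has_hida_malliavin_derivative M T B k X D \<longleftrightarrow>
     (if k = 0 then D = (\<lambda>_. X)
      else (\<lambda>(t, \<omega>). D t \<omega>) \<in> borel_measurable (cube T k \<Otimes>\<^sub>M M) \<and>
        (\<exists>h. has_chaos_expansion M T B X h \<and>
          (AE t in cube T k. \<exists>J.
             (\<forall>n\<ge>k. has_multiple_ito_integral M T B (n - k) (kernel_slice n k (h n) t) (J n)) \<and>
             L2_tendsto M (\<lambda>N \<omega>. \<Sum>n=k..N. (\<Prod>i<k. real (n - i)) * J n \<omega>) (D t))))"

text \<open>
  \<open>Z = X \<circ> Y\<close> almost surely. Neither the derivatives nor the limit are determined beyond null
  sets, so the product is a relation that is invariant under almost sure equality of \<open>Z\<close>.
\<close>

definition has_anti_wick_product ::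
    "'a measure \<Rightarrow> real \<Rightarrow> (real \<Rightarrow> 'a \<Rightarrow> real) \<Rightarrow>
     ('a \<Rightarrow> real) \<Rightarrow> ('a \<Rightarrow> real) \<Rightarrow> ('a \<Rightarrow> real) \<Rightarrow> bool" where
  "has_anti_wick_product M T B X Y Z \<longleftrightarrow>
     X \<in> G_sqrt2 M T B \<and> Y \<in> G_sqrt2 M T B \<and>
     (\<exists>DX DY.
        (\<forall>n. has_hida_malliavin_derivative M T B n X (DX n)) \<and>
        (\<forall>n. has_hida_malliavin_derivative M T B n Y (DY n)) \<and>
        L1_tendsto M
          (\<lambda>N \<omega>. \<Sum>n\<le>N. 1 / fact n * (\<integral>t. DX n t \<omega> * DY n t \<omega> \<partial>cube T n)) Z)"

text \<open>
  The time derivative is taken within \<open>[0, T]\<close>, that is, one-sided at \<open>t = T\<close>. The functions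
  \<open>zt\<close>, \<open>zx\<close>, \<open>zxx\<close> are the partial derivatives; they are only constrained for \<open>0 < t \<le> T\<close>.
\<close>

definition heat_solution :: "real \<Rightarrow> (real \<Rightarrow> real) \<Rightarrow> (real \<Rightarrow> real \<Rightarrow> real) \<Rightarrow> bool" where
  "heat_solution T f z \<longleftrightarrow>
     continuous_on ({0..T} \<times> UNIV) (\<lambda>(t, x). z t x) \<and>
     (\<exists>zt zx zxx.
        continuous_on ({0<..T} \<times> UNIV) (\<lambda>(t, x). zt t x) \<and>
        continuous_on ({0<..T} \<times> UNIV) (\<lambda>(t, x). zx t x) \<and>
        continuous_on ({0<..T} \<times> UNIV) (\<lambda>(t, x). zxx t x) \<and>
        (\<forall>t\<in>{0<..T}. \<forall>x.
           ((\<lambda>s. z s x) has_real_derivative zt t x) (at t within {0..T}) \<and>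
           ((\<lambda>y. z t y) has_real_derivative zx t x) (at x) \<and>
           ((\<lambda>y. zx t y) has_real_derivative zxx t x) (at x) \<and>
           zt t x = 1 / 2 * zxx t x)) \<and>
     (\<forall>x. z 0 x = f x)"

definition gaussian_growth :: "real \<Rightarrow> (real \<Rightarrow> real \<Rightarrow> real) \<Rightarrow> bool" where
  "gaussian_growth T z \<longleftrightarrow>
     (\<exists>a>0. \<exists>A>0. \<forall>t\<in>{0..T}. \<forall>x. \<bar>z t x\<bar> \<le> A * exp (a * x\<^sup>2))"

end

(*
  Write the heat flow at time t as P f x = E[f (x + sqrt t Z)] with Z standard normal; by a
  maximum principle it is the solution u. The n-th derivative of P f at x, times sqrt t ^ n, is the
  n-th Hermite coefficient of z \<mapsto> f (x + sqrt t z). Hence the Hermite expansion of P f is the chaos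
  expansion of u (t, B_t), with kernels constant on ]0, t]^n, the Hida-Malliavin derivative of
  order n is the n-th derivative of P f at B_t times the indicator of ]0, t]^n, and the anti-Wick series at
  B_t = x is Parseval's identity for the functions f (x + sqrt t z) and g (x + sqrt t z), whose
  inner product is P (f g) x. Bessel's inequality for f (sqrt t (y + z)) in the two variables y and z
  produces the weights 2^n in the norm of the space G.
*)
theory Submission
  imports Defs "HOL-Real_Asymp.Real_Asymp"
begin

section \<open>The standard normal distribution and Hermite polynomials\<close>

text \<open>Everything is reduced to the standard normal law by the rescaling
  \<open>F s = f (sqrt t * s)\<close>. Since \<open>f\<close> is merely continuous, no derivative is
  ever put on it: derivatives of the flow are Hermite coefficients of the translates
  \<open>F (y + z)\<close>, and what ties the Malliavin derivatives to the chaos kernels is the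
  index shift \<open>hermite_coeff (hermite_smooth F n) k = smooth_coeff F (n + k)\<close>.
  Trigonometric polynomials do double duty. Their Hermite coefficients and their heat evolutions are
  explicit, so approximating by them gives both the completeness of the Hermite polynomials on
  bounded continuous functions and the Gaussian formula for an arbitrary solution. As they are not
  uniformly dense on the line, the approximation error is weighted by 1 + x^2. That box kernels
  integrate to Hermite polynomials of \<open>B t\<close> is a moment computation: with S the
  off-diagonal step integral and H the Hermite polynomial, induction over the increments gives
  E[S^2] = E[S H], hence E[(S - H)^2] = E[H^2] - E[S^2], which tends to 0.\<close>

definition exp_growth :: "(real \<Rightarrow> real) \<Rightarrow> bool" where
  "exp_growth p \<longleftrightarrow> continuous_on UNIV p \<and> (\<exists>C a. \<forall>x. \<bar>p x\<bar> \<le> C * exp (a * \<bar>x\<bar>))"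

lemma exp_growthI:
  "continuous_on UNIV p \<Longrightarrow> (\<And>x. \<bar>p x\<bar> \<le> C * exp (a * \<bar>x\<bar>)) \<Longrightarrow> exp_growth p"
  by (auto simp: exp_growth_def)

lemma exp_growth_cont: "exp_growth p \<Longrightarrow> continuous_on UNIV p"
  by (simp add: exp_growth_def)

lemma exp_growth_measurable: "exp_growth p \<Longrightarrow> p \<in> borel_measurable borel"
  by (simp add: borel_measurable_continuous_onI exp_growth_cont)

lemma exp_growthE:
  assumes "exp_growth p"
  obtains C a where "0 \<le> C" "0 \<le> a" "\<And>x. \<bar>p x\<bar> \<le> C * exp (a * \<bar>x\<bar>)"
proof -
  obtain C a where *: "\<And>x. \<bar>p x\<bar> \<le> C * exp (a * \<bar>x\<bar>)"
    using assms by (auto simp: exp_growth_def)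
  show ?thesis
  proof (rule that[of "\<bar>C\<bar>" "\<bar>a\<bar>"])
    fix x
    have "C * exp (a * \<bar>x\<bar>) \<le> \<bar>C\<bar> * exp (\<bar>a\<bar> * \<bar>x\<bar>)"
      by (intro mult_mono) (auto intro: mult_right_mono)
    then show "\<bar>p x\<bar> \<le> \<bar>C\<bar> * exp (\<bar>a\<bar> * \<bar>x\<bar>)" using *[of x] by linarith
  qed auto
qed

lemma exp_growth_bounded:
  assumes "continuous_on UNIV p" "\<And>x. \<bar>p x\<bar> \<le> K"
  shows "exp_growth p"
  by (rule exp_growthI[where C=K and a=0]) (use assms in auto)

lemma exp_growth_const: "exp_growth (\<lambda>_. c)"
  by (rule exp_growth_bounded[where K="\<bar>c\<bar>"]) auto

lemma exp_growth_ident: "exp_growth (\<lambda>x. x)"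
proof (rule exp_growthI[where C=1 and a=1])
  have "\<bar>x\<bar> \<le> exp \<bar>x\<bar>" for x :: real
    using exp_ge_add_one_self[of "\<bar>x\<bar>"] by linarith
  then show "\<bar>x\<bar> \<le> 1 * exp (1 * \<bar>x\<bar>)" for x :: real
    by simp
qed auto

text \<open>Closure under products is the reason for this growth class: bounded continuous
  functions, polynomials and all their products belong to it, every member is integrable against the
  Gaussian density, and its product with the density vanishes at infinity.\<close>

lemma exp_growth_mult:
  assumes "exp_growth p" "exp_growth q"
  shows "exp_growth (\<lambda>x. p x * q x)"
proof -
  obtain C a where 1: "0 \<le> C" "0 \<le> a" "\<And>x. \<bar>p x\<bar> \<le> C * exp (a * \<bar>x\<bar>)"
    using exp_growthE[OF assms(1)] by blast
  obtain D b where 2: "0 \<le> D" "0 \<le> b" "\<And>x. \<bar>q x\<bar> \<le> D * exp (b * \<bar>x\<bar>)"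
    using exp_growthE[OF assms(2)] by blast
  show ?thesis
  proof (rule exp_growthI[where C="C * D" and a="a + b"])
    show "continuous_on UNIV (\<lambda>x. p x * q x)"
      by (intro continuous_intros exp_growth_cont assms)
    show "\<bar>p x * q x\<bar> \<le> C * D * exp ((a + b) * \<bar>x\<bar>)" for x
    proof -
      have "\<bar>p x * q x\<bar> \<le> (C * exp (a * \<bar>x\<bar>)) * (D * exp (b * \<bar>x\<bar>))"
        unfolding abs_mult by (intro mult_mono 1 2) (use 1 in auto)
      then show ?thesis by (simp add: ring_distribs exp_add mult_ac)
    qed
  qed
qed

lemma exp_growth_add:
  assumes "exp_growth p" "exp_growth q"
  shows "exp_growth (\<lambda>x. p x + q x)"
proof -
  obtain C a where 1: "0 \<le> C" "0 \<le> a" "\<And>x. \<bar>p x\<bar> \<le> C * exp (a * \<bar>x\<bar>)"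
    using exp_growthE[OF assms(1)] by blast
  obtain D b where 2: "0 \<le> D" "0 \<le> b" "\<And>x. \<bar>q x\<bar> \<le> D * exp (b * \<bar>x\<bar>)"
    using exp_growthE[OF assms(2)] by blast
  show ?thesis
  proof (rule exp_growthI[where C="C + D" and a="a + b"])
    show "continuous_on UNIV (\<lambda>x. p x + q x)"
      by (intro continuous_intros exp_growth_cont assms)
    show "\<bar>p x + q x\<bar> \<le> (C + D) * exp ((a + b) * \<bar>x\<bar>)" for x
    proof -
      have "C * exp (a * \<bar>x\<bar>) \<le> C * exp ((a + b) * \<bar>x\<bar>)"
        by (rule mult_left_mono) (use 1 2 in \<open>auto intro: mult_right_mono\<close>)
      moreover have "D * exp (b * \<bar>x\<bar>) \<le> D * exp ((a + b) * \<bar>x\<bar>)"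
        by (rule mult_left_mono) (use 1 2 in \<open>auto intro: mult_right_mono\<close>)
      ultimately show ?thesis
        using 1(3)[of x] 2(3)[of x] abs_triangle_ineq[of "p x" "q x"]
        unfolding distrib_right[of C] by linarith
    qed
  qed
qed

lemma exp_growth_cmult: "exp_growth p \<Longrightarrow> exp_growth (\<lambda>x. c * p x)"
  using exp_growth_mult[OF exp_growth_const] by blast

lemma exp_growth_diff: "exp_growth p \<Longrightarrow> exp_growth q \<Longrightarrow> exp_growth (\<lambda>x. p x - q x)"
  using exp_growth_add[of p "\<lambda>x. - 1 * q x"] exp_growth_cmult[of q "-1"] by simp

lemma exp_growth_power2: "exp_growth p \<Longrightarrow> exp_growth (\<lambda>x. (p x)\<^sup>2)"
  by (simp add: power2_eq_square exp_growth_mult)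

section \<open>Integration and integration by parts against the standard normal law\<close>

interpretation std_normal: prob_space std_normal_distribution
  by (rule prob_space_normal_density) simp

text \<open>Completing the square turns the tilted density into a multiple of the normal density
  with mean \<open>a\<close>.\<close>

lemma integrable_std_normal_exp: "integrable lborel (\<lambda>x. std_normal_density x * exp (a * x))"
proof -
  have "std_normal_density x * exp (a * x) = exp (a\<^sup>2 / 2) * normal_density a 1 x" for x
    by (simp add: normal_density_def power2_diff field_simps flip: exp_add)
  then show ?thesis by (simp add: integrable_normal_density)
qed

lemma exp_growth_integrable_lborel:
  assumes "exp_growth p"
  shows "integrable lborel (\<lambda>x. std_normal_density x * p x)"
proof -
  obtain C a where 1: "0 \<le> C" "0 \<le> a" "\<And>x. \<bar>p x\<bar> \<le> C * exp (a * \<bar>x\<bar>)"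
    using exp_growthE[OF assms] by blast
  have [measurable]: "p \<in> borel_measurable borel" using assms by (rule exp_growth_measurable)
  show ?thesis
  proof (rule Bochner_Integration.integrable_bound)
    show "integrable lborel (\<lambda>x. C * (std_normal_density x * exp (a * x) + std_normal_density x * exp ((- a) * x)))"
      by (intro integrable_mult_right Bochner_Integration.integrable_add integrable_std_normal_exp)
    show "AE x in lborel. norm (std_normal_density x * p x)
        \<le> norm (C * (std_normal_density x * exp (a * x) + std_normal_density x * exp (- a * x)))"
    proof (intro always_eventually allI)
      fix x
      have "exp (a * \<bar>x\<bar>) \<le> exp (a * x) + exp (- a * x)"
        by (cases "x \<ge> 0") auto
      then have "\<bar>p x\<bar> \<le> C * (exp (a * x) + exp (- a * x))"
        using 1(3)[of x] mult_left_mono[OF _ 1(1)] by fastforce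
      then have "std_normal_density x * \<bar>p x\<bar> \<le> std_normal_density x * (C * (exp (a * x) + exp (- a * x)))"
        by (rule mult_left_mono) simp
      then have "std_normal_density x * \<bar>p x\<bar> \<le> C * (std_normal_density x * exp (a * x) + std_normal_density x * exp (- a * x))"
        by (simp add: algebra_simps)
      then show "norm (std_normal_density x * p x)
        \<le> norm (C * (std_normal_density x * exp (a * x) + std_normal_density x * exp (- a * x)))"
        using abs_ge_self[of "C * (std_normal_density x * exp (a * x) + std_normal_density x * exp (- a * x))"]
        unfolding real_norm_def abs_mult[of "std_normal_density x"] abs_of_nonneg[OF normal_density_nonneg]
        by (rule order_trans)
    qed
  qed auto
qed

lemma exp_growth_integrable:
  "exp_growth p \<Longrightarrow> integrable std_normal_distribution p"
  by (subst integrable_density) (auto simp: exp_growth_measurable exp_growth_integrable_lborel)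

lemma integral_std_normal:
  fixes p :: "real \<Rightarrow> real"
  shows "p \<in> borel_measurable borel \<Longrightarrow>
    (\<integral>x. p x \<partial>std_normal_distribution) = (\<integral>x. std_normal_density x * p x \<partial>lborel)"
  by (subst integral_density) auto

lemma tendsto_std_normal_exp:
  fixes a :: real
  assumes "F = at_top \<or> F = at_bot" "0 \<le> a"
  shows "((\<lambda>x. std_normal_density x * exp (a * \<bar>x\<bar>)) \<longlongrightarrow> 0) F"
proof -
  have 1: "((\<lambda>x. exp (a * x - x\<^sup>2 / 2)) \<longlongrightarrow> 0) at_top"
    by real_asymp
  have "((\<lambda>x. exp (a * \<bar>x\<bar> - x\<^sup>2 / 2)) \<longlongrightarrow> 0) at_top"
    by (rule Lim_transform_eventually[OF 1])
       (use eventually_ge_at_top[of "0::real"] in eventually_elim, simp)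
  moreover from this have "((\<lambda>x. exp (a * \<bar>x\<bar> - x\<^sup>2 / 2)) \<longlongrightarrow> 0) at_bot"
    unfolding filterlim_at_bot_mirror by simp
  ultimately have "((\<lambda>x. exp (a * \<bar>x\<bar> - x\<^sup>2 / 2)) \<longlongrightarrow> 0) F"
    using assms by auto
  then have "((\<lambda>x. 1 / sqrt (2 * pi) * exp (a * \<bar>x\<bar> - x\<^sup>2 / 2)) \<longlongrightarrow> 0) F"
    using tendsto_mult_right_zero by blast
  moreover have "1 / sqrt (2 * pi) * exp (a * \<bar>x\<bar> - x\<^sup>2 / 2) = std_normal_density x * exp (a * \<bar>x\<bar>)" for x
    by (simp add: std_normal_density_def algebra_simps flip: exp_add)
  ultimately show ?thesis by simp
qed

lemma exp_growth_tendsto: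
  assumes "exp_growth p" "F = at_top \<or> F = at_bot"
  shows "((\<lambda>x. std_normal_density x * p x) \<longlongrightarrow> 0) F"
proof -
  obtain C a where 1: "0 \<le> C" "0 \<le> a" "\<And>x. \<bar>p x\<bar> \<le> C * exp (a * \<bar>x\<bar>)"
    using exp_growthE[OF assms(1)] by blast
  show ?thesis
  proof (rule Lim_null_comparison)
    show "((\<lambda>x. C * (std_normal_density x * exp (a * \<bar>x\<bar>))) \<longlongrightarrow> 0) F"
      using tendsto_mult_right_zero[OF tendsto_std_normal_exp[OF assms(2) 1(2)]] by blast
    have "norm (std_normal_density x * p x) \<le> C * (std_normal_density x * exp (a * \<bar>x\<bar>))" for x
      using mult_left_mono[OF 1(3)[of x], of "std_normal_density x"]
      by (simp add: abs_mult mult_ac)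
    then show "\<forall>\<^sub>F x in F. norm (std_normal_density x * p x) \<le> C * (std_normal_density x * exp (a * \<bar>x\<bar>))"
      by simp
  qed
qed

lemma std_normal_density_deriv:
  "(std_normal_density has_real_derivative - x * std_normal_density x) (at x)"
proof -
  have "((\<lambda>x. 1 / sqrt (2 * pi) * exp (- x\<^sup>2 / 2)) has_real_derivative
      1 / sqrt (2 * pi) * (exp (- x\<^sup>2 / 2) * - x)) (at x)"
    by (intro DERIV_cmult) (auto intro!: derivative_eq_intros)
  then show ?thesis by (simp add: std_normal_density_def[abs_def] mult.commute)
qed

text \<open>Against the density, the integrand is the derivative of
  \<open>std_normal_density x * p x\<close>, whose boundary values at both infinities are 0.\<close>

lemma std_normal_by_parts:
  assumes p: "exp_growth p" and p': "exp_growth p'"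
    and d: "\<And>x. (p has_real_derivative p' x) (at x)"
  shows "(\<integral>x. p' x - x * p x \<partial>std_normal_distribution) = 0"
proof -
  let ?f = "\<lambda>x. std_normal_density x * (p' x - x * p x)"
  have g: "exp_growth (\<lambda>x. p' x - x * p x)"
    by (intro exp_growth_diff exp_growth_mult exp_growth_ident p p')
  have "(LBINT x=-\<infinity>..\<infinity>. ?f x) = 0 - 0"
  proof (rule interval_integral_FTC_integrable[where F="\<lambda>x. std_normal_density x * p x"])
    show "((\<lambda>x. std_normal_density x * p x) has_vector_derivative ?f x) (at x)" for x
      unfolding has_real_derivative_iff_has_vector_derivative[symmetric]
      by (auto intro!: derivative_eq_intros std_normal_density_deriv d simp: algebra_simps)
    show "isCont ?f x" for x
      using exp_growth_cont[OF g] unfolding std_normal_density_def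
      by (intro isCont_mult) (auto simp: continuous_on_eq_continuous_at intro!: continuous_intros)
    show "set_integrable lborel (einterval (- \<infinity>) \<infinity>) ?f"
      using exp_growth_integrable_lborel[OF g] by (simp add: set_integrable_def)
    show "(((\<lambda>x. std_normal_density x * p x) \<circ> real_of_ereal) \<longlongrightarrow> 0) (at_right (- \<infinity>))"
      using exp_growth_tendsto[OF p] by (simp add: ereal_tendsto_simps)
    show "(((\<lambda>x. std_normal_density x * p x) \<circ> real_of_ereal) \<longlongrightarrow> 0) (at_left \<infinity>)"
      using exp_growth_tendsto[OF p] by (simp add: ereal_tendsto_simps)
  qed simp
  then have "(\<integral>x. ?f x \<partial>lborel) = 0"
    by (simp add: interval_lebesgue_integral_def set_lebesgue_integral_def)
  then show ?thesis
    by (subst integral_std_normal) (auto intro: exp_growth_measurable[OF g])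
qed

text \<open>The monic Hermite polynomials of variance \<open>s\<close>, with generating function exp
  (l x - s l^2 / 2). The variance is a parameter because partial sums of Brownian increments have
  varying variances; \<open>s = 0\<close> gives the monomials.\<close>

fun hermite :: "real \<Rightarrow> nat \<Rightarrow> real \<Rightarrow> real" where
  "hermite s 0 x = 1"
| "hermite s (Suc 0) x = x"
| "hermite s (Suc (Suc n)) x = x * hermite s (Suc n) x - s * real (Suc n) * hermite s n x"

lemma hermite_mult_x:
  "x * hermite s n x = hermite s (Suc n) x + s * real n * hermite s (n - 1) x"
  by (cases n) auto

lemma hermite_deriv:
  "(hermite s n has_real_derivative real n * hermite s (n - 1) x) (at x)"
proof (induction s n x rule: hermite.induct)
  case (3 s n x)
  have "((\<lambda>y. y * hermite s (Suc n) y - s * real (Suc n) * hermite s n y) has_real_derivative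
      1 * hermite s (Suc n) x + x * (real (Suc n) * hermite s n x)
      - s * real (Suc n) * (real n * hermite s (n - 1) x)) (at x)"
    using 3 by (auto intro!: derivative_eq_intros)
  also have "1 * hermite s (Suc n) x + x * (real (Suc n) * hermite s n x)
      - s * real (Suc n) * (real n * hermite s (n - 1) x) = real (Suc (Suc n)) * hermite s (Suc n) x"
  proof -
    have "x * (real (Suc n) * hermite s n x) = real (Suc n) * (hermite s (Suc n) x + s * real n * hermite s (n - 1) x)"
      using hermite_mult_x[of x s n] by (simp only: mult.left_commute[of x])
    then show ?thesis by (simp add: algebra_simps)
  qed
  finally have "((\<lambda>y. hermite s (Suc (Suc n)) y) has_real_derivative real (Suc (Suc n)) * hermite s (Suc n) x) (at x)"
    unfolding hermite.simps(3) .
  then show ?case by simp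
qed auto

lemma exp_growth_hermite: "exp_growth (hermite s n)"
proof -
  have "exp_growth (hermite s n) \<and> exp_growth (hermite s (Suc n))"
  proof (induction n)
    case 0
    have *: "hermite s 0 = (\<lambda>_. 1)" "hermite s (Suc 0) = (\<lambda>x. x)" by auto
    show ?case unfolding * by (intro conjI exp_growth_const exp_growth_ident)
  next
    case (Suc n)
    have *: "hermite s (Suc (Suc n)) = (\<lambda>x. x * hermite s (Suc n) x - s * real (Suc n) * hermite s n x)"
      by auto
    show ?case
      unfolding * using Suc
      by (auto intro!: exp_growth_ident exp_growth_diff exp_growth_mult[OF exp_growth_ident] exp_growth_cmult simp del: hermite.simps)
  qed
  then show ?thesis by simp
qed

lemma measurable_hermite [measurable]: "hermite s n \<in> borel_measurable borel"
  by (rule exp_growth_measurable[OF exp_growth_hermite])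

lemma hermite_scale: "hermite (c\<^sup>2 * s) n (c * x) = c ^ n * hermite s n x"
  by (induction s n x rule: hermite.induct) (auto simp: algebra_simps power2_eq_square)

text \<open>The generating functions of independent variances multiply. The proof stays with the
  recurrence: in (x + y) times the sum of order n + 1, each factor \<open>x\<close> or
  \<open>y\<close> is absorbed by \<open>hermite_mult_x\<close>, and the two correction terms add up
  to (s + r) (n + 1) times the sum of order n.\<close>

lemma hermite_add:
  "hermite (s + r) n (x + y) = (\<Sum>k\<le>n. real (n choose k) * hermite s (n - k) x * hermite r k y)"
proof (induction n rule: induct_nat_012)
  case (ge2 n)
  let ?a = "\<lambda>n. hermite s n x" and ?b = "\<lambda>n. hermite r n y"
  have "(x + y) * hermite (s + r) (Suc n) (x + y)
      = (\<Sum>k\<le>Suc n. real (Suc n choose k) * (x * ?a (Suc n - k)) * ?b k)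
       + (\<Sum>k\<le>Suc n. real (Suc n choose k) * ?a (Suc n - k) * (y * ?b k))"
    unfolding ge2 by (simp add: sum_distrib_left algebra_simps sum.distrib del: sum.atMost_Suc)
  also have "(\<Sum>k\<le>Suc n. real (Suc n choose k) * (x * ?a (Suc n - k)) * ?b k)
     = (\<Sum>k\<le>Suc n. real (Suc n choose k) * ?a (Suc (Suc n) - k) * ?b k)
      + s * real (Suc n) * hermite (s + r) n (x + y)"
  proof -
    have "(\<Sum>k\<le>Suc n. real (Suc n choose k) * (x * ?a (Suc n - k)) * ?b k)
      = (\<Sum>k\<le>Suc n. real (Suc n choose k) * ?a (Suc (Suc n) - k) * ?b k)
       + (\<Sum>k\<le>Suc n. s * (real (Suc n - k) * real (Suc n choose k)) * ?a (n - k) * ?b k)"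
      unfolding sum.distrib[symmetric]
    proof (rule sum.cong)
      fix k assume "k \<in> {..Suc n}"
      then have e: "Suc (Suc n) - k = Suc (Suc n - k)" "Suc n - k - 1 = n - k" by auto
      show "real (Suc n choose k) * (x * ?a (Suc n - k)) * ?b k
        = real (Suc n choose k) * ?a (Suc (Suc n) - k) * ?b k
         + s * (real (Suc n - k) * real (Suc n choose k)) * ?a (n - k) * ?b k"
        unfolding hermite_mult_x[of x s "Suc n - k"] e by (simp add: algebra_simps)
    qed simp
    also have "(\<Sum>k\<le>Suc n. s * (real (Suc n - k) * real (Suc n choose k)) * ?a (n - k) * ?b k)
      = (\<Sum>k\<le>n. s * (real (Suc n - k) * real (Suc n choose k)) * ?a (n - k) * ?b k)"
      by simp
    also have "\<dots> = (\<Sum>k\<le>n. s * (real (Suc n) * real (n choose k)) * ?a (n - k) * ?b k)"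
    proof (rule sum.cong)
      fix k assume "k \<in> {..n}"
      then have "(Suc n - k) * (Suc n choose k) = Suc n * (n choose k)"
        by (metis atMost_iff binomial_absorb_comp diff_Suc_1 )
      then have "real (Suc n - k) * real (Suc n choose k) = real (Suc n) * real (n choose k)"
        by (metis of_nat_mult)
      then show "s * (real (Suc n - k) * real (Suc n choose k)) * ?a (n - k) * ?b k =
          s * (real (Suc n) * real (n choose k)) * ?a (n - k) * ?b k" by simp
    qed simp
    also have "\<dots> = s * real (Suc n) * hermite (s + r) n (x + y)"
      unfolding ge2 by (simp add: sum_distrib_left mult_ac)
    finally show ?thesis .
  qed
  also have "(\<Sum>k\<le>Suc n. real (Suc n choose k) * ?a (Suc n - k) * (y * ?b k))
     = (\<Sum>k\<le>Suc n. real (Suc n choose k) * ?a (Suc n - k) * ?b (Suc k))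
      + r * real (Suc n) * hermite (s + r) n (x + y)"
  proof -
    have "(\<Sum>k\<le>Suc n. real (Suc n choose k) * ?a (Suc n - k) * (y * ?b k))
      = (\<Sum>k\<le>Suc n. real (Suc n choose k) * ?a (Suc n - k) * ?b (Suc k))
       + (\<Sum>k\<le>Suc n. r * (real k * real (Suc n choose k)) * ?a (Suc n - k) * ?b (k - 1))"
      unfolding sum.distrib[symmetric] hermite_mult_x[of y]
      by (rule sum.cong) (simp_all add: algebra_simps)
    also have "(\<Sum>k\<le>Suc n. r * (real k * real (Suc n choose k)) * ?a (Suc n - k) * ?b (k - 1))
      = (\<Sum>k\<le>n. r * (real (Suc k) * real (Suc n choose Suc k)) * ?a (n - k) * ?b k)"
      by (subst sum.atMost_Suc_shift) simp
    also have "\<dots> = (\<Sum>k\<le>n. r * (real (Suc n) * real (n choose k)) * ?a (n - k) * ?b k)"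
    proof (rule sum.cong)
      fix k
      have "real (Suc k) * real (Suc n choose Suc k) = real (Suc n) * real (n choose k)"
        by (metis of_nat_mult Suc_times_binomial_eq mult.commute)
      then show "r * (real (Suc k) * real (Suc n choose Suc k)) * ?a (n - k) * ?b k =
          r * (real (Suc n) * real (n choose k)) * ?a (n - k) * ?b k" by simp
    qed simp
    also have "\<dots> = r * real (Suc n) * hermite (s + r) n (x + y)"
      unfolding ge2 by (simp add: sum_distrib_left mult_ac)
    finally show ?thesis .
  qed
  finally have 1: "hermite (s + r) (Suc (Suc n)) (x + y)
    = (\<Sum>k\<le>Suc n. real (Suc n choose k) * ?a (Suc (Suc n) - k) * ?b k)
     + (\<Sum>k\<le>Suc n. real (Suc n choose k) * ?a (Suc n - k) * ?b (Suc k))"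
    by (simp add: algebra_simps del: sum.atMost_Suc)
  \<comment> \<open>Pascal's rule merges the two remaining sums into the one with the binomial
    coefficients of n + 2.\<close>
  have "(\<Sum>k\<le>Suc (Suc n). real (Suc (Suc n) choose k) * ?a (Suc (Suc n) - k) * ?b k)
    = ?a (Suc (Suc n)) + (\<Sum>k\<le>Suc n. real (Suc (Suc n) choose Suc k) * ?a (Suc n - k) * ?b (Suc k))"
    by (subst sum.atMost_Suc_shift) simp
  also have "(\<Sum>k\<le>Suc n. real (Suc (Suc n) choose Suc k) * ?a (Suc n - k) * ?b (Suc k))
    = (\<Sum>k\<le>Suc n. real (Suc n choose k) * ?a (Suc n - k) * ?b (Suc k))
     + (\<Sum>k\<le>Suc n. real (Suc n choose Suc k) * ?a (Suc n - k) * ?b (Suc k))"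
    unfolding sum.distrib[symmetric]
    by (rule sum.cong) (simp_all add: algebra_simps)
  also have "(\<Sum>k\<le>Suc n. real (Suc n choose Suc k) * ?a (Suc n - k) * ?b (Suc k))
    = (\<Sum>k\<le>n. real (Suc n choose Suc k) * ?a (Suc n - k) * ?b (Suc k))"
    by (simp add: binomial_eq_0)
  also have "?a (Suc (Suc n)) + ((\<Sum>k\<le>Suc n. real (Suc n choose k) * ?a (Suc n - k) * ?b (Suc k)) + \<dots>)
    = (\<Sum>k\<le>Suc n. real (Suc n choose k) * ?a (Suc (Suc n) - k) * ?b k)
     + (\<Sum>k\<le>Suc n. real (Suc n choose k) * ?a (Suc n - k) * ?b (Suc k))"
  proof -
    have "(\<Sum>k\<le>Suc n. real (Suc n choose k) * ?a (Suc (Suc n) - k) * ?b k)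
      = ?a (Suc (Suc n)) + (\<Sum>k\<le>n. real (Suc n choose Suc k) * ?a (Suc n - k) * ?b (Suc k))"
      by (subst sum.atMost_Suc_shift) simp
    then show ?thesis by (simp only: add_ac)
  qed
  finally show ?case using 1 by simp
qed auto

text \<open>Integration by parts is applied to \<open>p x * hermite 1 n x\<close>. The term from
  differentiating the polynomial cancels the lower-order term of the recurrence for
  \<open>x * hermite 1 n x\<close>, and only the polynomial of order n + 1 is left.\<close>

lemma std_normal_stein:
  assumes p: "exp_growth p" and p': "exp_growth p'"
    and d: "\<And>x. (p has_real_derivative p' x) (at x)"
  shows "(\<integral>x. p x * hermite 1 (Suc n) x \<partial>std_normal_distribution)
       = (\<integral>x. p' x * hermite 1 n x \<partial>std_normal_distribution)"
proof -
  have "(\<integral>x. (p' x * hermite 1 n x + p x * (real n * hermite 1 (n - 1) x))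
        - x * (p x * hermite 1 n x) \<partial>std_normal_distribution) = 0"
    by (intro std_normal_by_parts)
       (auto intro!: exp_growth_add exp_growth_mult exp_growth_cmult exp_growth_hermite p p'
             derivative_eq_intros d hermite_deriv simp del: One_nat_def)
  moreover have "(p' x * hermite 1 n x + p x * (real n * hermite 1 (n - 1) x)) - x * (p x * hermite 1 n x)
      = p' x * hermite 1 n x - p x * hermite 1 (Suc n) x" for x
  proof -
    have "x * (p x * hermite 1 n x) = p x * (hermite 1 (Suc n) x + 1 * real n * hermite 1 (n - 1) x)"
      unfolding hermite_mult_x[of x 1 n, symmetric] by simp
    then show ?thesis by (simp only: algebra_simps mult_1_left)
  qed
  ultimately have "(\<integral>x. p' x * hermite 1 n x - p x * hermite 1 (Suc n) x \<partial>std_normal_distribution) = 0"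
    by (simp only:)
  then show ?thesis
    by (subst (asm) Bochner_Integration.integral_diff)
       (auto intro!: exp_growth_integrable exp_growth_mult exp_growth_hermite p p')
qed

text \<open>Each use of Stein's identity lowers both indices by one and contributes the factor
  \<open>m\<close>; when one index has reached 0, differentiating the constant 1 gives 0 unless the
  other index is 0 too.\<close>

lemma std_normal_hermite_orthogonal:
  "(\<integral>x. hermite 1 m x * hermite 1 n x \<partial>std_normal_distribution) = (if m = n then fact n else 0)"
proof (induction n arbitrary: m)
  case 0
  show ?case
  proof (cases m)
    case (Suc k)
    have "(\<integral>x. 1 * hermite 1 (Suc k) x \<partial>std_normal_distribution)
      = (\<integral>x. 0 * hermite 1 k x \<partial>std_normal_distribution)"
      by (rule std_normal_stein) (auto intro: exp_growth_const)
    then show ?thesis using Suc by simp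
  qed (use std_normal.prob_space in simp)
next
  case (Suc n)
  have "(\<integral>x. hermite 1 m x * hermite 1 (Suc n) x \<partial>std_normal_distribution)
      = (\<integral>x. (real m * hermite 1 (m - 1) x) * hermite 1 n x \<partial>std_normal_distribution)"
    by (rule std_normal_stein) (auto intro!: exp_growth_hermite exp_growth_cmult hermite_deriv simp del: One_nat_def)
  also have "\<dots> = real m * (\<integral>x. hermite 1 (m - 1) x * hermite 1 n x \<partial>std_normal_distribution)"
    by (simp add: mult.assoc)
  also have "\<dots> = (if m = Suc n then fact (Suc n) else 0)"
    unfolding Suc by (cases m) auto
  finally show ?case .
qed

section \<open>Square integrable functions\<close>

lemma square_integrable_measurable: "square_integrable N f \<Longrightarrow> f \<in> borel_measurable N"
  by (simp add: square_integrable_def)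

lemma square_integrable_mult_integrable:
  assumes "square_integrable N f" "square_integrable N g"
  shows "integrable N (\<lambda>x. f x * g x)"
proof (rule Bochner_Integration.integrable_bound)
  show "integrable N (\<lambda>x. (f x)\<^sup>2 + (g x)\<^sup>2)" and "(\<lambda>x. f x * g x) \<in> borel_measurable N"
    using assms by (auto simp: square_integrable_def)
  have "norm (a * b) \<le> norm (a\<^sup>2 + b\<^sup>2)" for a b :: real
    using sum_squares_bound[of "\<bar>a\<bar>" "\<bar>b\<bar>"] abs_ge_zero[of "a * b"]
    unfolding real_norm_def abs_mult power2_abs by linarith
  then show "AE x in N. norm (f x * g x) \<le> norm ((f x)\<^sup>2 + (g x)\<^sup>2)" by simp
qed

lemma square_integrable_add:
  assumes "square_integrable N f" "square_integrable N g"
  shows "square_integrable N (\<lambda>x. f x + g x)"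
proof -
  have "integrable N (\<lambda>x. (f x)\<^sup>2 + (g x)\<^sup>2 + 2 * (f x * g x))"
    using assms square_integrable_mult_integrable[OF assms] by (auto simp: square_integrable_def)
  then show ?thesis
    using assms by (auto simp: square_integrable_def power2_sum mult.assoc)
qed

lemma square_integrable_cmult:
  "square_integrable N f \<Longrightarrow> square_integrable N (\<lambda>x. c * f x)"
  by (auto simp: square_integrable_def power_mult_distrib)

lemma square_integrable_diff:
  "square_integrable N f \<Longrightarrow> square_integrable N g \<Longrightarrow> square_integrable N (\<lambda>x. f x - g x)"
  using square_integrable_add[of N f "\<lambda>x. -1 * g x"] square_integrable_cmult[of N g "-1"] by simp

lemma square_integrable_zero: "square_integrable N (\<lambda>_. 0)"
  by (simp add: square_integrable_def)

lemma square_integrable_sum: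
  "(\<And>i. i \<in> I \<Longrightarrow> square_integrable N (f i)) \<Longrightarrow> square_integrable N (\<lambda>x. \<Sum>i\<in>I. f i x)"
  by (induction I rule: infinite_finite_induct)
     (auto intro: square_integrable_add square_integrable_zero)

lemma square_integrable_cong_AE:
  assumes "square_integrable N f" "g \<in> borel_measurable N" "AE x in N. f x = g x"
  shows "square_integrable N g"
proof -
  have "integrable N (\<lambda>x. (f x)\<^sup>2) \<longleftrightarrow> integrable N (\<lambda>x. (g x)\<^sup>2)"
    by (rule integrable_cong_AE) (use assms in \<open>auto simp: square_integrable_def\<close>)
  then show ?thesis using assms by (auto simp: square_integrable_def)
qed

lemma integral_square_add_le:
  assumes "square_integrable N f" "square_integrable N g"
  shows "(\<integral>x. (f x + g x)\<^sup>2 \<partial>N) \<le> 2 * (\<integral>x. (f x)\<^sup>2 \<partial>N) + 2 * (\<integral>x. (g x)\<^sup>2 \<partial>N)"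
proof -
  have "(\<integral>x. (f x + g x)\<^sup>2 \<partial>N) \<le> (\<integral>x. 2 * (f x)\<^sup>2 + 2 * (g x)\<^sup>2 \<partial>N)"
  proof (rule integral_mono)
    show "integrable N (\<lambda>x. (f x + g x)\<^sup>2)"
      using square_integrable_add[OF assms] by (simp add: square_integrable_def)
    show "integrable N (\<lambda>x. 2 * (f x)\<^sup>2 + 2 * (g x)\<^sup>2)"
      using assms by (auto simp: square_integrable_def)
    show "(f x + g x)\<^sup>2 \<le> 2 * (f x)\<^sup>2 + 2 * (g x)\<^sup>2" for x
      using sum_squares_bound[of "f x" "g x"] by (simp add: power2_sum)
  qed
  then show ?thesis
    using assms by (simp add: square_integrable_def)
qed

lemma exp_growth_square_integrable: "exp_growth p \<Longrightarrow> square_integrable std_normal_distribution p"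
  by (auto simp: square_integrable_def exp_growth_measurable
      intro!: exp_growth_integrable exp_growth_power2)

section \<open>Approximation by trigonometric polynomials\<close>

text \<open>The free phase makes one generator cover sines as well, turns differentiation into a
  shift by pi / 2, and keeps the class closed under products through the product-to-sum
  formula.\<close>

inductive trig_poly :: "(real \<Rightarrow> real) \<Rightarrow> bool" where
  trig_poly_cos: "trig_poly (\<lambda>x. cos (l * x + c))"
| trig_poly_add: "trig_poly p \<Longrightarrow> trig_poly q \<Longrightarrow> trig_poly (\<lambda>x. p x + q x)"
| trig_poly_cmult: "trig_poly p \<Longrightarrow> trig_poly (\<lambda>x. a * p x)"

lemma trig_poly_const: "trig_poly (\<lambda>_. a)"
  using trig_poly_cmult[OF trig_poly_cos[of 0 0], of a] by simp

lemma trig_poly_mult_cos: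
  "trig_poly p \<Longrightarrow> trig_poly (\<lambda>x. p x * cos (m * x + d))"
proof (induction rule: trig_poly.induct)
  case (trig_poly_cos l c)
  have "cos (l * x + c) * cos (m * x + d)
     = 1/2 * cos ((l - m) * x + (c - d)) + 1/2 * cos ((l + m) * x + (c + d))" for x
  proof -
    have "l * x + c - (m * x + d) = (l - m) * x + (c - d)"
      "l * x + c + (m * x + d) = (l + m) * x + (c + d)" by (simp_all add: algebra_simps)
    then show ?thesis by (simp only: cos_times_cos) (simp add: add_divide_distrib)
  qed
  then show ?case by (simp add: trig_poly.intros del: times_divide_eq_left)
qed (auto simp: distrib_right mult.assoc intro: trig_poly.intros)

lemma trig_poly_mult:
  "trig_poly q \<Longrightarrow> trig_poly p \<Longrightarrow> trig_poly (\<lambda>x. p x * q x)"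
proof (induction rule: trig_poly.induct)
  case (trig_poly_cos l c)
  then show ?case by (rule trig_poly_mult_cos)
qed (auto simp: distrib_left mult.left_commute intro: trig_poly.intros)

lemma trig_poly_exp_growth: "trig_poly p \<Longrightarrow> exp_growth p"
proof (induction rule: trig_poly.induct)
  case (trig_poly_cos l c)
  show ?case by (rule exp_growth_bounded[where K=1]) (auto intro!: continuous_intros)
qed (auto intro: exp_growth_add exp_growth_cmult)

text \<open>Weierstrass' theorem in the variable \<open>sin (x / R)\<close>: the resulting approximation keeps the
  bound of \<open>f\<close> on the whole line because the sine never leaves \<open>[-1, 1]\<close>.\<close>

lemma trig_poly_approx_interval:
  assumes f: "continuous_on UNIV f" "\<And>x. \<bar>f x\<bar> \<le> K" and e: "0 < e" and R: "0 < R"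
  obtains p where "trig_poly p" "\<And>x. \<bar>p x\<bar> \<le> K + e" "\<And>x. \<bar>x\<bar> \<le> R \<Longrightarrow> \<bar>f x - p x\<bar> \<le> e"
proof -
  have "continuous_on {-1..1} (\<lambda>y. f (R * arcsin y))"
    by (rule continuous_on_compose2[OF f(1)]) (auto intro!: continuous_on_mult_left continuous_on_arcsin')
  then have "\<exists>q. real_polynomial_function q \<and> (\<forall>y\<in>{-1..1}. \<bar>f (R * arcsin y) - q y\<bar> < e)"
  proof (rule Stone_Weierstrass_real_polynomial_function[OF compact_Icc[of "-1::real" 1] _ e])
    fix g :: "real \<Rightarrow> real"
    assume "real_polynomial_function g" "\<And>y. y \<in> {-1..1} \<Longrightarrow> \<bar>f (R * arcsin y) - g y\<bar> < e"
    then show ?thesis by (intro exI[of _ g]) auto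
  qed
  then obtain q where q: "real_polynomial_function q"
    "\<And>y. y \<in> {-1..1} \<Longrightarrow> \<bar>f (R * arcsin y) - q y\<bar> < e"
    by metis
  define p where "p = (\<lambda>x. q (sin (x / R)))"
  \<comment> \<open>The sine is a cosine with phase - pi / 2, hence a generator; sums and products
    then give every polynomial in it.\<close>
  have s: "sin (x / R) = cos (1 / R * x + - (pi / 2))" for x
    by (simp add: cos_diff)
  have "trig_poly p"
    unfolding p_def s using q(1)
  proof (induction rule: real_polynomial_function.induct)
    case (linear f)
    then have lin: "f y = f 1 * y" for y
      using linear_cmul[OF bounded_linear.linear[OF linear], of y 1] by (simp add: mult.commute)
    have "(\<lambda>x. f (cos (1 / R * x + - (pi / 2)))) = (\<lambda>x. f 1 * cos (1 / R * x + - (pi / 2)))"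
      by (rule ext) (rule lin)
    then show ?case by (simp only: trig_poly_cmult trig_poly_cos)
  qed (auto intro: trig_poly_const trig_poly_add trig_poly_mult)
  moreover have "\<bar>p x\<bar> \<le> K + e" for x
    using q(2)[of "sin (x / R)"] f(2)[of "R * arcsin (sin (x / R))"] by (auto simp: p_def)
  moreover have "\<bar>f x - p x\<bar> \<le> e" if "\<bar>x\<bar> \<le> R" for x
  proof -
    \<comment> \<open>The arcsine undoes the sine only on [-pi / 2, pi / 2]; for |x| up to
      \<open>R\<close> the quotient \<open>x / R\<close> stays in [-1, 1], which lies
      inside.\<close>
    have "\<bar>x / R\<bar> \<le> 1" using that R by simp
    moreover have "1 < pi / 2" using pi_gt3 by simp
    ultimately have "arcsin (sin (x / R)) = x / R"
      by (intro arcsin_sin) linarith+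
    then show ?thesis using q(2)[of "sin (x / R)"] R by (auto simp: p_def)
  qed
  ultimately show ?thesis using that by blast
qed

text \<open>Outside a large interval nothing better than the sum of the two bounds is known, and a
  growing weight absorbs it. The weight 1 + x^2 has finite Gaussian moments, and it extends to the
  solution 1 + x^2 + t of the heat equation.\<close>

lemma trig_poly_approx:
  assumes f: "continuous_on UNIV f" "\<And>x. \<bar>f x\<bar> \<le> K" and e: "0 < e"
  obtains p where "trig_poly p" "\<And>x. \<bar>f x - p x\<bar> \<le> e * (1 + x\<^sup>2)"
proof -
  have K: "0 \<le> K" using f(2)[of 0] by linarith
  \<comment> \<open>This choice makes e R^2 equal to 2 K + e, the trivial bound for the difference,
    so the weight takes over exactly beyond \<open>R\<close>.\<close>
  define R where "R = sqrt ((2 * K + e) / e)"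
  have R: "0 < R" "e * R\<^sup>2 = 2 * K + e" using K e by (auto simp: R_def add_nonneg_pos)
  obtain p where p: "trig_poly p" "\<And>x. \<bar>p x\<bar> \<le> K + e" "\<And>x. \<bar>x\<bar> \<le> R \<Longrightarrow> \<bar>f x - p x\<bar> \<le> e"
    using trig_poly_approx_interval[OF f e R(1)] by blast
  have "\<bar>f x - p x\<bar> \<le> e * (1 + x\<^sup>2)" for x
  proof (cases "\<bar>x\<bar> \<le> R")
    case True
    have "e \<le> e * (1 + x\<^sup>2)" using e by simp
    then show ?thesis using p(3)[OF True] by linarith
  next
    case False
    then have "R\<^sup>2 \<le> x\<^sup>2" using R by (intro iffD1[OF abs_le_square_iff]) auto
    then have "2 * K + e \<le> e * x\<^sup>2" unfolding R(2)[symmetric] using e by (intro mult_left_mono) auto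
    then show ?thesis using p(2)[of x] f(2)[of x] e by (simp add: distrib_left)
  qed
  then show ?thesis using p(1) that by blast
qed

section \<open>Hermite expansions\<close>

definition hermite_coeff :: "(real \<Rightarrow> real) \<Rightarrow> nat \<Rightarrow> real" where
  "hermite_coeff f n = (\<integral>x. f x * hermite 1 n x \<partial>std_normal_distribution)"

definition hermite_sum :: "(real \<Rightarrow> real) \<Rightarrow> nat \<Rightarrow> real \<Rightarrow> real" where
  "hermite_sum f N x = (\<Sum>n\<le>N. hermite_coeff f n / fact n * hermite 1 n x)"

abbreviation L2_normal :: "(real \<Rightarrow> real) \<Rightarrow> bool" where
  "L2_normal \<equiv> square_integrable std_normal_distribution"

lemma L2_normal_hermite: "L2_normal (hermite 1 n)"
  by (intro exp_growth_square_integrable exp_growth_hermite)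

lemma L2_normal_hermite_sum: "L2_normal (hermite_sum f N)"
  unfolding hermite_sum_def[abs_def]
  by (intro square_integrable_sum square_integrable_cmult L2_normal_hermite)

lemma hermite_coeff_add:
  "L2_normal f \<Longrightarrow> L2_normal g \<Longrightarrow> hermite_coeff (\<lambda>x. f x + g x) n = hermite_coeff f n + hermite_coeff g n"
  unfolding hermite_coeff_def distrib_right
  by (intro Bochner_Integration.integral_add square_integrable_mult_integrable L2_normal_hermite)

lemma hermite_coeff_cmult: "hermite_coeff (\<lambda>x. c * f x) n = c * hermite_coeff f n"
  by (simp add: hermite_coeff_def mult.assoc)

lemma integral_mult_hermite_sum:
  assumes "L2_normal g"
  shows "(\<integral>x. g x * hermite_sum f N x \<partial>std_normal_distribution)
    = (\<Sum>n\<le>N. hermite_coeff f n * hermite_coeff g n / fact n)"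
proof -
  have "(\<integral>x. g x * hermite_sum f N x \<partial>std_normal_distribution)
    = (\<integral>x. (\<Sum>n\<le>N. hermite_coeff f n / fact n * (g x * hermite 1 n x)) \<partial>std_normal_distribution)"
    by (simp add: hermite_sum_def sum_distrib_left mult_ac)
  also have "\<dots> = (\<Sum>n\<le>N. hermite_coeff f n / fact n * hermite_coeff g n)"
    unfolding hermite_coeff_def[of g]
    by (subst Bochner_Integration.integral_sum)
       (auto intro!: integrable_mult_right square_integrable_mult_integrable assms L2_normal_hermite
         simp: integral_mult_right_zero)
  finally show ?thesis by simp
qed

lemma hermite_coeff_hermite_sum:
  assumes "n \<le> N"
  shows "hermite_coeff (hermite_sum f N) n = hermite_coeff f n"
proof -
  have "hermite_coeff (hermite_sum f N) n = (\<integral>x. hermite 1 n x * hermite_sum f N x \<partial>std_normal_distribution)"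
    by (simp add: hermite_coeff_def mult.commute)
  also have "\<dots> = (\<Sum>k\<le>N. hermite_coeff f k * hermite_coeff (hermite 1 n) k / fact k)"
    by (rule integral_mult_hermite_sum) (rule L2_normal_hermite)
  also have "\<dots> = (\<Sum>k\<le>N. if n = k then hermite_coeff f k else 0)"
    by (rule sum.cong) (auto simp: hermite_coeff_def[of "hermite 1 n"] std_normal_hermite_orthogonal)
  finally show ?thesis using assms by simp
qed

lemma hermite_residual:
  assumes "L2_normal f"
  shows "(\<integral>x. (f x - hermite_sum f N x)\<^sup>2 \<partial>std_normal_distribution)
    = (\<integral>x. (f x)\<^sup>2 \<partial>std_normal_distribution) - (\<Sum>n\<le>N. (hermite_coeff f n)\<^sup>2 / fact n)"
proof -
  let ?S = "hermite_sum f N"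
  have 1: "(\<integral>x. f x * ?S x \<partial>std_normal_distribution) = (\<Sum>n\<le>N. (hermite_coeff f n)\<^sup>2 / fact n)"
    by (simp add: integral_mult_hermite_sum[OF assms] power2_eq_square)
  have "(\<integral>x. ?S x * ?S x \<partial>std_normal_distribution)
    = (\<Sum>n\<le>N. hermite_coeff f n * hermite_coeff ?S n / fact n)"
    by (rule integral_mult_hermite_sum[OF L2_normal_hermite_sum])
  also have "\<dots> = (\<Sum>n\<le>N. (hermite_coeff f n)\<^sup>2 / fact n)"
    by (intro sum.cong) (auto simp: hermite_coeff_hermite_sum power2_eq_square)
  finally have 2: "(\<integral>x. ?S x * ?S x \<partial>std_normal_distribution) = (\<Sum>n\<le>N. (hermite_coeff f n)\<^sup>2 / fact n)" .
  have "(\<integral>x. (f x - ?S x)\<^sup>2 \<partial>std_normal_distribution)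
    = (\<integral>x. (f x)\<^sup>2 - 2 * (f x * ?S x) + ?S x * ?S x \<partial>std_normal_distribution)"
    by (rule Bochner_Integration.integral_cong) (auto simp: power2_eq_square algebra_simps)
  also have "\<dots> = (\<integral>x. (f x)\<^sup>2 \<partial>std_normal_distribution)
      - 2 * (\<integral>x. f x * ?S x \<partial>std_normal_distribution) + (\<integral>x. ?S x * ?S x \<partial>std_normal_distribution)"
  proof -
    have i: "integrable std_normal_distribution (\<lambda>x. (f x)\<^sup>2)"
      "integrable std_normal_distribution (\<lambda>x. 2 * (f x * ?S x))"
      "integrable std_normal_distribution (\<lambda>x. ?S x * ?S x)"
      using assms by (auto intro!: integrable_mult_right square_integrable_mult_integrable
          L2_normal_hermite_sum) (simp add: square_integrable_def)
    show ?thesis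
      by (simp only: Bochner_Integration.integral_add[OF Bochner_Integration.integrable_diff[OF i(1,2)] i(3)]
          Bochner_Integration.integral_diff[OF i(1,2)] integral_mult_right_zero)
  qed
  finally show ?thesis using 1 2 by simp
qed

lemma hermite_bessel:
  assumes "L2_normal f"
  shows "(\<Sum>n\<le>N. (hermite_coeff f n)\<^sup>2 / fact n) \<le> (\<integral>x. (f x)\<^sup>2 \<partial>std_normal_distribution)"
proof -
  have "0 \<le> (\<integral>x. (f x - hermite_sum f N x)\<^sup>2 \<partial>std_normal_distribution)" by simp
  then show ?thesis using hermite_residual[OF assms, of N] by simp
qed

lemma hermite_residual_le:
  assumes "L2_normal f"
  shows "(\<integral>x. (f x - hermite_sum f N x)\<^sup>2 \<partial>std_normal_distribution)
    \<le> (\<integral>x. (f x)\<^sup>2 \<partial>std_normal_distribution)"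
  unfolding hermite_residual[OF assms] by (simp add: sum_nonneg)

section \<open>Completeness of the Hermite polynomials and Parseval's identity\<close>

definition hermite_complete :: "(real \<Rightarrow> real) \<Rightarrow> bool" where
  "hermite_complete f \<longleftrightarrow>
    (\<lambda>N. \<integral>x. (f x - hermite_sum f N x)\<^sup>2 \<partial>std_normal_distribution) \<longlonglongrightarrow> 0"

lemma hermite_residual_add_le:
  assumes "L2_normal f" "L2_normal g"
  shows "(\<integral>x. ((f x + g x) - hermite_sum (\<lambda>x. f x + g x) N x)\<^sup>2 \<partial>std_normal_distribution)
    \<le> 2 * (\<integral>x. (f x - hermite_sum f N x)\<^sup>2 \<partial>std_normal_distribution)
     + 2 * (\<integral>x. (g x - hermite_sum g N x)\<^sup>2 \<partial>std_normal_distribution)"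
proof -
  have "hermite_sum (\<lambda>x. f x + g x) N x = hermite_sum f N x + hermite_sum g N x" for x
    unfolding hermite_sum_def sum.distrib[symmetric] hermite_coeff_add[OF assms]
    by (simp add: add_divide_distrib distrib_right)
  then have "(\<lambda>x. ((f x + g x) - hermite_sum (\<lambda>x. f x + g x) N x)\<^sup>2)
    = (\<lambda>x. ((f x - hermite_sum f N x) + (g x - hermite_sum g N x))\<^sup>2)"
    by (intro ext) (simp add: algebra_simps)
  then show ?thesis
    using integral_square_add_le[OF square_integrable_diff[OF assms(1) L2_normal_hermite_sum[of f N]]
      square_integrable_diff[OF assms(2) L2_normal_hermite_sum[of g N]]]
    by simp
qed

lemma hermite_complete_add:
  assumes "L2_normal f" "L2_normal g" "hermite_complete f" "hermite_complete g"
  shows "hermite_complete (\<lambda>x. f x + g x)"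
proof -
  have "(\<lambda>N. 2 * (\<integral>x. (f x - hermite_sum f N x)\<^sup>2 \<partial>std_normal_distribution)
     + 2 * (\<integral>x. (g x - hermite_sum g N x)\<^sup>2 \<partial>std_normal_distribution)) \<longlonglongrightarrow> 2 * 0 + 2 * 0"
    using assms(3,4) unfolding hermite_complete_def by (intro tendsto_intros)
  then have "(\<lambda>N. 2 * (\<integral>x. (f x - hermite_sum f N x)\<^sup>2 \<partial>std_normal_distribution)
     + 2 * (\<integral>x. (g x - hermite_sum g N x)\<^sup>2 \<partial>std_normal_distribution)) \<longlonglongrightarrow> 0"
    by simp
  then show ?thesis
    unfolding hermite_complete_def
    by (rule Lim_null_comparison[rotated])
       (simp add: hermite_residual_add_le[OF assms(1,2)])
qed

lemma hermite_complete_cmult: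
  assumes "hermite_complete f"
  shows "hermite_complete (\<lambda>x. c * f x)"
proof -
  have "hermite_sum (\<lambda>x. c * f x) N x = c * hermite_sum f N x" for N x
    by (simp add: hermite_sum_def hermite_coeff_cmult sum_distrib_left mult.assoc)
  then have "(c * f x - hermite_sum (\<lambda>x. c * f x) N x)\<^sup>2 = c\<^sup>2 * (f x - hermite_sum f N x)\<^sup>2" for N x
    by (simp add: power_mult_distrib flip: right_diff_distrib)
  then show ?thesis
    using tendsto_mult_right_zero[OF assms[unfolded hermite_complete_def], of "c\<^sup>2"]
    by (simp add: hermite_complete_def)
qed

lemma integral_cos_std_normal:
  "(\<integral>x. cos (l * x + c) \<partial>std_normal_distribution) = exp (- l\<^sup>2 / 2) * cos c"
proof -
  interpret d: real_distribution std_normal_distribution by (rule real_dist_normal_dist)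
  have i: "integrable std_normal_distribution (\<lambda>x. cis c * iexp (l * x))"
    by (intro integrable_mult_right std_normal.integrable_const_bound[where B=1]) auto
  have "(\<integral>x. cos (l * x + c) \<partial>std_normal_distribution)
      = (\<integral>x. Re (cis c * iexp (l * x)) \<partial>std_normal_distribution)"
    by (rule Bochner_Integration.integral_cong) (auto simp: cos_add Re_exp Im_exp mult.commute)
  also have "\<dots> = Re (\<integral>x. cis c * iexp (l * x) \<partial>std_normal_distribution)"
    using i by (rule integral_Re)
  also have "(\<integral>x. cis c * iexp (l * x) \<partial>std_normal_distribution) = cis c * char std_normal_distribution l"
    unfolding char_def by simp
  also have "\<dots> = cis c * complex_of_real (exp (- (l\<^sup>2) / 2))"
    by (simp only: char_std_normal_distribution)
  finally show ?thesis by (simp add: mult.commute)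
qed

lemma cos_shift_quarter: "cos (x + pi / 2) = - sin (x::real)"
  by (simp add: cos_add)

text \<open>Every application of Stein's identity differentiates the cosine, which yields a factor
  \<open>l\<close> and a quarter-period shift; the remaining integral of order 0 is the
  characteristic function.\<close>

lemma hermite_coeff_cos:
  "hermite_coeff (\<lambda>x. cos (l * x + c)) n = l ^ n * exp (- l\<^sup>2 / 2) * cos (c + real n * (pi / 2))"
proof (induction n arbitrary: c)
  case 0
  then show ?case by (simp add: hermite_coeff_def integral_cos_std_normal)
next
  case (Suc n)
  have "hermite_coeff (\<lambda>x. cos (l * x + c)) (Suc n)
    = (\<integral>x. (l * cos (l * x + (c + pi / 2))) * hermite 1 n x \<partial>std_normal_distribution)"
    unfolding hermite_coeff_def
  proof (rule std_normal_stein)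
    show "exp_growth (\<lambda>x. cos (l * x + c))" "exp_growth (\<lambda>x. l * cos (l * x + (c + pi / 2)))"
      by (intro trig_poly_exp_growth trig_poly.intros)+
    show "((\<lambda>x. cos (l * x + c)) has_real_derivative l * cos (l * x + (c + pi / 2))) (at x)" for x
      using cos_shift_quarter[of "l * x + c"]
      by (auto intro!: derivative_eq_intros simp: add.assoc)
  qed
  also have "\<dots> = l * hermite_coeff (\<lambda>x. cos (l * x + (c + pi / 2))) n"
    by (simp add: hermite_coeff_def mult.assoc)
  moreover have "c + pi / 2 + real n * (pi / 2) = c + real (Suc n) * (pi / 2)"
    by (simp add: field_simps)
  ultimately show ?case by (simp only: Suc power_Suc mult.assoc)
qed

text \<open>The residuals of \<open>cos (l x + c)\<close> and of its quarter-period shift add up to the tail of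
  the exponential series of \<open>exp (l\<^sup>2)\<close>.\<close>

lemma hermite_complete_cos: "hermite_complete (\<lambda>x. cos (l * x + c))"
proof -
  let ?p = "\<lambda>x. cos (l * x + c)" and ?q = "\<lambda>x. cos (l * x + (c + pi / 2))"
  have L: "L2_normal ?p" "L2_normal ?q"
    by (intro exp_growth_square_integrable trig_poly_exp_growth trig_poly.intros)+
  define r where "r N = exp (- l\<^sup>2) * (exp (l\<^sup>2) - (\<Sum>n\<le>N. (l\<^sup>2) ^ n / fact n))" for N
  have "(\<lambda>N. \<Sum>n\<le>N. (l\<^sup>2) ^ n / fact n) \<longlonglongrightarrow> exp (l\<^sup>2)"
    using exp_converges[of "l\<^sup>2"] by (simp add: sums_def_le divide_inverse mult.commute)
  then have "r \<longlonglongrightarrow> exp (- l\<^sup>2) * (exp (l\<^sup>2) - exp (l\<^sup>2))"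
    unfolding r_def by (intro tendsto_intros)
  then have r: "r \<longlonglongrightarrow> 0" by simp
  have "(\<integral>x. (?p x - hermite_sum ?p N x)\<^sup>2 \<partial>std_normal_distribution) \<le> r N" for N
  proof -
    have c1: "(cos y)\<^sup>2 + (cos (y + pi / 2))\<^sup>2 = 1" for y :: real
      by (simp add: cos_shift_quarter)
    have "(\<integral>x. (?p x)\<^sup>2 \<partial>std_normal_distribution) + (\<integral>x. (?q x)\<^sup>2 \<partial>std_normal_distribution)
      = (\<integral>x. (?p x)\<^sup>2 + (?q x)\<^sup>2 \<partial>std_normal_distribution)"
      using L by (intro Bochner_Integration.integral_add[symmetric]) (auto simp: square_integrable_def)
    also have "\<dots> = 1"
      using std_normal.prob_space by (simp add: c1 flip: add.assoc)
    finally have s1: "(\<integral>x. (?p x)\<^sup>2 \<partial>std_normal_distribution) + (\<integral>x. (?q x)\<^sup>2 \<partial>std_normal_distribution) = 1" .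
    have e: "(exp (- l\<^sup>2 / 2))\<^sup>2 = exp (- l\<^sup>2)"
      by (simp add: power2_eq_square flip: exp_add)
    have "(hermite_coeff ?p n)\<^sup>2 + (hermite_coeff ?q n)\<^sup>2 = (l\<^sup>2) ^ n * exp (- l\<^sup>2)" for n
    proof -
      have "(hermite_coeff ?p n)\<^sup>2 + (hermite_coeff ?q n)\<^sup>2
        = (l ^ n)\<^sup>2 * (exp (- l\<^sup>2 / 2))\<^sup>2 * ((cos (c + real n * (pi / 2)))\<^sup>2 + (cos (c + real n * (pi / 2) + pi / 2))\<^sup>2)"
        unfolding hermite_coeff_cos power_mult_distrib distrib_left
        by (simp only: add_ac)
      then show ?thesis unfolding c1 e by (simp add: power2_eq_square power_mult_distrib)
    qed
    then have s2: "(\<Sum>n\<le>N. (hermite_coeff ?p n)\<^sup>2 / fact n) + (\<Sum>n\<le>N. (hermite_coeff ?q n)\<^sup>2 / fact n)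
      = exp (- l\<^sup>2) * (\<Sum>n\<le>N. (l\<^sup>2) ^ n / fact n)"
      unfolding sum.distrib[symmetric] add_divide_distrib[symmetric]
      by (simp add: sum_distrib_left mult.commute)
    \<comment> \<open>The two residuals together equal \<open>r N\<close>; the one of the shifted
      cosine is nonnegative and is dropped.\<close>
    have "0 \<le> (\<integral>x. (?q x - hermite_sum ?q N x)\<^sup>2 \<partial>std_normal_distribution)" by simp
    then show ?thesis
      unfolding hermite_residual[OF L(1)] hermite_residual[OF L(2)] r_def right_diff_distrib s2[symmetric]
      using s1 by (simp flip: exp_add)
  qed
  then show ?thesis
    unfolding hermite_complete_def
    by (intro Lim_null_comparison[OF always_eventually r]) auto
qed

lemma hermite_complete_trig_poly: "trig_poly p \<Longrightarrow> hermite_complete p"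
proof (induction rule: trig_poly.induct)
  case (trig_poly_add p q)
  then show ?case
    by (intro hermite_complete_add exp_growth_square_integrable trig_poly_exp_growth)
qed (auto intro: hermite_complete_cos hermite_complete_cmult)

text \<open>Split \<open>f\<close> into \<open>f - p\<close> and a trigonometric polynomial
  \<open>p\<close>. The residual of \<open>f - p\<close> never exceeds its norm, uniformly in N, and
  the residual of \<open>p\<close> tends to 0.\<close>

theorem hermite_complete_bounded_continuous:
  assumes f: "continuous_on UNIV f" "\<And>x. \<bar>f x\<bar> \<le> K"
  shows "hermite_complete f"
  unfolding hermite_complete_def
proof (rule LIMSEQ_I)
  let ?E = "\<lambda>g. \<integral>x. g x \<partial>std_normal_distribution"
  fix r :: real assume r: "0 < r"
  have Lf: "L2_normal f" by (intro exp_growth_square_integrable exp_growth_bounded[OF f])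
  define C where "C = ?E (\<lambda>x. (1 + x\<^sup>2)\<^sup>2)"
  have C: "0 \<le> C" by (simp add: C_def)
  have gC: "exp_growth (\<lambda>x. 1 + x\<^sup>2)"
    by (intro exp_growth_add exp_growth_const exp_growth_power2 exp_growth_ident)
  \<comment> \<open>Both parts enter with a factor 2. The constant keeps 2 e^2 C below r / 2, and
    the residual of \<open>p\<close>, eventually below r / 4, takes the other half; C + 1 keeps the
    quotient meaningful.\<close>
  define e where "e = sqrt (r / (8 * (C + 1)))"
  have e: "0 < e" "2 * (e\<^sup>2 * C) < r / 2" proof -
    show "0 < e" using r C by (simp add: e_def add_nonneg_pos)
    have "2 * (e\<^sup>2 * C) = r * (C / (4 * (C + 1)))"
      using r C by (simp add: e_def field_simps)
    also have "\<dots> < r * (1 / 2)" using r C by (intro mult_strict_left_mono) (simp_all add: field_simps)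
    finally show "2 * (e\<^sup>2 * C) < r / 2" by simp
  qed
  obtain p where p: "trig_poly p" "\<And>x. \<bar>f x - p x\<bar> \<le> e * (1 + x\<^sup>2)"
    using trig_poly_approx[OF f e(1)] by blast
  have Lp: "L2_normal p" by (intro exp_growth_square_integrable trig_poly_exp_growth p)
  have Lfp: "L2_normal (\<lambda>x. f x - p x)" by (intro square_integrable_diff Lf Lp)
  have "?E (\<lambda>x. (f x - p x)\<^sup>2) \<le> ?E (\<lambda>x. e\<^sup>2 * (1 + x\<^sup>2)\<^sup>2)"
  proof (rule integral_mono)
    show "(f x - p x)\<^sup>2 \<le> e\<^sup>2 * (1 + x\<^sup>2)\<^sup>2" for x
      unfolding power_mult_distrib[symmetric]
      using p(2)[of x] by (intro iffD1[OF abs_le_square_iff]) (use e in \<open>simp add: abs_mult add_nonneg_nonneg\<close>)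
  qed (use Lfp in \<open>auto simp: square_integrable_def intro!: exp_growth_integrable exp_growth_power2 gC\<close>)
  also have "\<dots> = e\<^sup>2 * C" by (simp add: C_def)
  finally have fp: "?E (\<lambda>x. (f x - p x)\<^sup>2) \<le> e\<^sup>2 * C" .
  have "(\<lambda>N. ?E (\<lambda>x. (p x - hermite_sum p N x)\<^sup>2)) \<longlonglongrightarrow> 0"
    using hermite_complete_trig_poly[OF p(1)] by (simp add: hermite_complete_def)
  then obtain N0 where N0: "\<And>N. N \<ge> N0 \<Longrightarrow> \<bar>?E (\<lambda>x. (p x - hermite_sum p N x)\<^sup>2)\<bar> < r / 4"
    using LIMSEQ_D[of _ 0 "r / 4"] r by fastforce
  have "norm (?E (\<lambda>x. (f x - hermite_sum f N x)\<^sup>2) - 0) < r" if "N \<ge> N0" for N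
  proof -
    have "?E (\<lambda>x. (f x - hermite_sum f N x)\<^sup>2)
      \<le> 2 * ?E (\<lambda>x. ((f x - p x) - hermite_sum (\<lambda>x. f x - p x) N x)\<^sup>2)
       + 2 * ?E (\<lambda>x. (p x - hermite_sum p N x)\<^sup>2)"
      using hermite_residual_add_le[OF Lfp Lp, of N] by simp
    also have "\<dots> < r"
      using hermite_residual_le[OF Lfp, of N] fp e(2) N0[OF that] by linarith
    finally show ?thesis by simp
  qed
  then show "\<exists>N0. \<forall>N\<ge>N0. norm (?E (\<lambda>x. (f x - hermite_sum f N x)\<^sup>2) - 0) < r" by blast
qed

lemma hermite_parseval:
  assumes f: "continuous_on UNIV f" "\<And>x. \<bar>f x\<bar> \<le> K"
  shows "(\<lambda>n. (hermite_coeff f n)\<^sup>2 / fact n) sums (\<integral>x. (f x)\<^sup>2 \<partial>std_normal_distribution)"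
proof -
  have L: "L2_normal f" by (intro exp_growth_square_integrable exp_growth_bounded[OF f])
  have "(\<lambda>N. (\<integral>x. (f x)\<^sup>2 \<partial>std_normal_distribution)
      - (\<integral>x. (f x - hermite_sum f N x)\<^sup>2 \<partial>std_normal_distribution))
      \<longlonglongrightarrow> (\<integral>x. (f x)\<^sup>2 \<partial>std_normal_distribution) - 0"
    using hermite_complete_bounded_continuous[OF f] unfolding hermite_complete_def
    by (intro tendsto_intros)
  then show ?thesis by (simp add: sums_def_le hermite_residual[OF L])
qed

text \<open>Polarization: \<open>f + g\<close> is bounded and continuous as well, so the identity
  for squares applies to it.\<close>

lemma hermite_parseval_mult:
  assumes f: "continuous_on UNIV f" "\<And>x. \<bar>f x\<bar> \<le> K"
    and g: "continuous_on UNIV g" "\<And>x. \<bar>g x\<bar> \<le> K'"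
  shows "(\<lambda>n. hermite_coeff f n * hermite_coeff g n / fact n)
    sums (\<integral>x. f x * g x \<partial>std_normal_distribution)"
proof -
  let ?E = "\<lambda>g. \<integral>x. g x \<partial>std_normal_distribution"
  have L: "L2_normal f" "L2_normal g"
    by (intro exp_growth_square_integrable exp_growth_bounded[OF f] exp_growth_bounded[OF g])+
  have fg: "continuous_on UNIV (\<lambda>x. f x + g x)" "\<And>x. \<bar>f x + g x\<bar> \<le> K + K'"
    using f g by (auto intro!: continuous_intros abs_triangle_ineq[THEN order_trans] add_mono)
  have 1: "(\<lambda>n. 1/2 * ((hermite_coeff (\<lambda>x. f x + g x) n)\<^sup>2 / fact n - (hermite_coeff f n)\<^sup>2 / fact n
      - (hermite_coeff g n)\<^sup>2 / fact n)) sums (1/2 * (?E (\<lambda>x. (f x + g x)\<^sup>2) - ?E (\<lambda>x. (f x)\<^sup>2) - ?E (\<lambda>x. (g x)\<^sup>2)))"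
    by (intro sums_mult sums_diff hermite_parseval[OF f] hermite_parseval[OF g] hermite_parseval[OF fg])
  have "?E (\<lambda>x. (f x + g x)\<^sup>2) = ?E (\<lambda>x. (f x)\<^sup>2 + (g x)\<^sup>2 + 2 * (f x * g x))"
    by (simp add: power2_sum mult.assoc)
  also have "\<dots> = ?E (\<lambda>x. (f x)\<^sup>2) + ?E (\<lambda>x. (g x)\<^sup>2) + 2 * ?E (\<lambda>x. f x * g x)"
  proof -
    have i: "integrable std_normal_distribution (\<lambda>x. (f x)\<^sup>2)" "integrable std_normal_distribution (\<lambda>x. (g x)\<^sup>2)"
      "integrable std_normal_distribution (\<lambda>x. 2 * (f x * g x))"
      using L by (auto simp: square_integrable_def intro!: integrable_mult_right square_integrable_mult_integrable)
    show ?thesis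
      by (simp only: Bochner_Integration.integral_add[OF Bochner_Integration.integrable_add[OF i(1,2)] i(3)]
          Bochner_Integration.integral_add[OF i(1,2)] integral_mult_right_zero)
  qed
  finally have 2: "1/2 * (?E (\<lambda>x. (f x + g x)\<^sup>2) - ?E (\<lambda>x. (f x)\<^sup>2) - ?E (\<lambda>x. (g x)\<^sup>2)) = ?E (\<lambda>x. f x * g x)"
    by simp
  have "1/2 * ((hermite_coeff (\<lambda>x. f x + g x) n)\<^sup>2 / fact n - (hermite_coeff f n)\<^sup>2 / fact n
      - (hermite_coeff g n)\<^sup>2 / fact n) = hermite_coeff f n * hermite_coeff g n / fact n" for n
    unfolding hermite_coeff_add[OF L] by (simp add: power2_sum field_simps)
  then show ?thesis using 1 unfolding 2 by simp
qed

section \<open>The heat equation\<close>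

text \<open>If \<open>l\<close> were positive, \<open>f'\<close> would vanish at the maximum and be
  positive just to its right, so by the mean value theorem \<open>f\<close> would exceed its maximum
  there.\<close>

lemma second_derivative_at_max:
  fixes f :: "real \<Rightarrow> real"
  assumes f': "\<And>y. (f has_real_derivative f' y) (at y)"
    and l: "(f' has_real_derivative l) (at x)"
    and d: "0 < d" and max: "\<And>y. \<bar>x - y\<bar> < d \<Longrightarrow> f y \<le> f x"
  shows "l \<le> 0"
proof (rule ccontr)
  assume "\<not> l \<le> 0"
  then have "0 < l" by simp
  from DERIV_pos_inc_right[OF l this]
  obtain d' where d': "0 < d'" "\<And>h. 0 < h \<Longrightarrow> h < d' \<Longrightarrow> f' x < f' (x + h)"
    by blast
  have 0: "f' x = 0"
    using DERIV_local_max[OF f' d] max by blast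
  define h where "h = min d d' / 2"
  have h: "0 < h" "h < d" "h < d'" using d d'(1) by (auto simp: h_def)
  have "x < x + h" using h by simp
  from MVT2[OF this, of f f'] f'
  obtain y where y: "x < y" "y < x + h" "f (x + h) - f x = (x + h - x) * f' y"
    by blast
  have "0 < f' y" using d'(2)[of "y - x"] y h 0 by simp
  then have "0 < h * f' y" using h(1) by simp
  then have "f x < f (x + h)" using y(3) by simp
  moreover have "f (x + h) \<le> f x" using max[of "x + h"] h by simp
  ultimately show False by simp
qed

text \<open>Only earlier times are compared, because the maximum over a time interval may sit at its
  right end, where the derivative within the interval is one-sided.\<close>

lemma left_derivative_at_max:
  fixes f :: "real \<Rightarrow> real"
  assumes l: "(f has_real_derivative l) (at t within {0..T})"
    and t: "0 \<le> r" "r < t" "t \<le> T" and max: "\<And>s. s \<in> {r..t} \<Longrightarrow> f s \<le> f t"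
  shows "0 \<le> l"
proof (rule ccontr)
  assume "\<not> 0 \<le> l"
  then obtain d where d: "0 < d" "\<And>h. 0 < h \<Longrightarrow> t - h \<in> {0..T} \<Longrightarrow> h < d \<Longrightarrow> f t < f (t - h)"
    using has_real_derivative_neg_dec_left[OF l] by auto
  define h where "h = min d (t - r) / 2"
  have h: "0 < h" "h < d" "h < t - r" using d(1) t by (auto simp: h_def)
  then have "f t < f (t - h)" using d(2)[of h] t by auto
  then show False using max[of "t - h"] h t by auto
qed

text \<open>The linear part of the notion of solution, without the initial datum: differences of
  solutions, approximations and error terms can be formed inside it before the comparison is
  applied.\<close>

definition heat_eq :: "real \<Rightarrow> (real \<Rightarrow> real \<Rightarrow> real) \<Rightarrow> bool" where
  "heat_eq T z \<longleftrightarrow> continuous_on ({0..T} \<times> UNIV) (\<lambda>(t, x). z t x) \<and>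
     (\<exists>zx zxx. \<forall>t\<in>{0<..T}. \<forall>x.
        ((\<lambda>s. z s x) has_real_derivative zxx t x / 2) (at t within {0..T}) \<and>
        (z t has_real_derivative zx t x) (at x) \<and>
        (zx t has_real_derivative zxx t x) (at x))"

lemma heat_eqI:
  assumes "continuous_on ({0..T} \<times> UNIV) (\<lambda>(t, x). z t x)"
    and "\<And>t x. t \<in> {0<..T} \<Longrightarrow> ((\<lambda>s. z s x) has_real_derivative zxx t x / 2) (at t within {0..T})"
    and "\<And>t x. t \<in> {0<..T} \<Longrightarrow> (z t has_real_derivative zx t x) (at x)"
    and "\<And>t x. t \<in> {0<..T} \<Longrightarrow> (zx t has_real_derivative zxx t x) (at x)"
  shows "heat_eq T z"
  using assms unfolding heat_eq_def by blast

lemma heat_solution_heat_eq: "heat_solution T f u \<Longrightarrow> heat_eq T u"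
proof -
  assume "heat_solution T f u"
  then obtain ut ux uxx where c: "continuous_on ({0..T} \<times> UNIV) (\<lambda>(t, x). u t x)"
    and d: "\<And>t x. t \<in> {0<..T} \<Longrightarrow>
           ((\<lambda>s. u s x) has_real_derivative ut t x) (at t within {0..T}) \<and>
           ((\<lambda>y. u t y) has_real_derivative ux t x) (at x) \<and>
           ((\<lambda>y. ux t y) has_real_derivative uxx t x) (at x) \<and>
           ut t x = 1 / 2 * uxx t x"
    unfolding heat_solution_def by blast
  show "heat_eq T u"
  proof (rule heat_eqI[of _ _ uxx ux])
    fix t x assume t: "t \<in> {0<..T}"
    have "ut t x = uxx t x / 2" using d[OF t, of x] by simp
    then show "((\<lambda>s. u s x) has_real_derivative uxx t x / 2) (at t within {0..T})"
      using d[OF t, of x] by metis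
  qed (use c d in auto)
qed

lemma heat_eq_lincomb:
  assumes "heat_eq T y" "heat_eq T z"
  shows "heat_eq T (\<lambda>t x. a * y t x + b * z t x)"
proof -
  obtain yx yxx zx zxx where *: "\<forall>t\<in>{0<..T}. \<forall>x.
        ((\<lambda>s. y s x) has_real_derivative yxx t x / 2) (at t within {0..T}) \<and>
        (y t has_real_derivative yx t x) (at x) \<and>
        (yx t has_real_derivative yxx t x) (at x)"
      "\<forall>t\<in>{0<..T}. \<forall>x.
        ((\<lambda>s. z s x) has_real_derivative zxx t x / 2) (at t within {0..T}) \<and>
        (z t has_real_derivative zx t x) (at x) \<and>
        (zx t has_real_derivative zxx t x) (at x)"
    using assms unfolding heat_eq_def by blast
  have "continuous_on ({0..T} \<times> UNIV) (\<lambda>p. a * (case p of (t, x) \<Rightarrow> y t x) + b * (case p of (t, x) \<Rightarrow> z t x))"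
    using assms unfolding heat_eq_def by (intro continuous_intros) auto
  moreover have "(\<lambda>p. a * (case p of (t, x) \<Rightarrow> y t x) + b * (case p of (t, x) \<Rightarrow> z t x))
    = (\<lambda>(t, x). a * y t x + b * z t x)" by auto
  ultimately have c: "continuous_on ({0..T} \<times> UNIV) (\<lambda>(t, x). a * y t x + b * z t x)"
    by (simp only:)
  show ?thesis
    by (rule heat_eqI[of _ _ "\<lambda>t x. a * yxx t x + b * zxx t x" "\<lambda>t x. a * yx t x + b * zx t x", OF c])
       (use * in \<open>auto simp: add_divide_distrib simp flip: times_divide_eq_right
          intro!: DERIV_add DERIV_cmult\<close>)
qed

lemma heat_eq_cos: "heat_eq T (\<lambda>t x. exp (- l\<^sup>2 * t / 2) * cos (l * x + c))"
proof (rule heat_eqI[of _ _ "\<lambda>t x. exp (- l\<^sup>2 * t / 2) * (- l\<^sup>2 * cos (l * x + c))"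
    "\<lambda>t x. exp (- l\<^sup>2 * t / 2) * (- l * sin (l * x + c))"])
  show "continuous_on ({0..T} \<times> UNIV) (\<lambda>(t, x). exp (- l\<^sup>2 * t / 2) * cos (l * x + c))"
    by (auto simp: case_prod_beta intro!: continuous_intros)
qed (auto intro!: derivative_eq_intros simp: power2_eq_square)

lemma heat_eq_quadratic: "heat_eq T (\<lambda>t x. 1 + x\<^sup>2 + t)"
proof (rule heat_eqI[of _ _ "\<lambda>t x. 2" "\<lambda>t x. 2 * x"])
  show "continuous_on ({0..T} \<times> UNIV) (\<lambda>(t, x::real). 1 + x\<^sup>2 + t)"
    by (auto simp: case_prod_beta intro!: continuous_intros)
qed (auto intro!: derivative_eq_intros)

text \<open>The barrier \<open>exp (b t x\<^sup>2 + c t)\<close> with \<open>b t\<close> growing from \<open>a + 1\<close> to at most \<open>2 (a + 1)\<close>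
  dominates \<open>exp (a x\<^sup>2)\<close> at infinity and is a strict supersolution, but only on a time interval of
  length \<open>1 / (8 (a + 1))\<close>; longer intervals are covered by iteration.\<close>

lemma heat_comparison_step:
  assumes z: "heat_eq T z" and a: "0 < a" "0 < A"
    and growth: "\<And>t x. t \<in> {0..T} \<Longrightarrow> z t x \<le> A * exp (a * x\<^sup>2)"
    and r: "0 \<le> r" "r \<le> r'" "r' \<le> T" "8 * (a + 1) * (r' - r) \<le> 1"
    and init: "\<And>x. z r x \<le> 0" and t: "t \<in> {r..r'}"
  shows "z t x \<le> 0"
proof (rule ccontr)
  assume pos: "\<not> z t x \<le> 0"
  define k where "k = a + 1"
  \<comment> \<open>Applying d/ds - 1/2 d^2/dy^2 to the barrier gives the barrier times b' y^2 + c -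
    b - 2 b^2 y^2. The slope b' = 8 k^2 beats 2 b^2 as long as b is at most 2 k, and c = 2 k + 1
    beats b.\<close>
  define b where "b s = k * (1 + 8 * k * (s - r))" for s
  define c where "c = 2 * k + 1"
  define \<psi> where "\<psi> s y = exp (b s * y\<^sup>2 + c * s)" for s y
  have k: "0 < k" "a < k" "0 < c" using a by (auto simp: k_def c_def)
  have b: "k \<le> b s" "b s \<le> 2 * k" if "s \<in> {r..r'}" for s
  proof -
    have "0 \<le> 8 * k * (s - r)" using that k by simp
    then show "k \<le> b s" unfolding b_def using k mult_left_mono[of 1 "1 + 8 * k * (s - r)" k] by simp
    have "8 * k * (s - r) \<le> 8 * k * (r' - r)" using that k by (intro mult_left_mono) auto
    then have "1 + 8 * k * (s - r) \<le> 2" using r(4) by (simp add: k_def)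
    then show "b s \<le> 2 * k" unfolding b_def using k mult_left_mono[of "1 + 8 * k * (s - r)" 2 k] by simp
  qed
  obtain zx zxx where d: "\<And>s y. s \<in> {0<..T} \<Longrightarrow> ((\<lambda>s. z s y) has_real_derivative zxx s y / 2) (at s within {0..T})"
      "\<And>s y. s \<in> {0<..T} \<Longrightarrow> (z s has_real_derivative zx s y) (at y)"
      "\<And>s y. s \<in> {0<..T} \<Longrightarrow> (zx s has_real_derivative zxx s y) (at y)"
    using z unfolding heat_eq_def by blast
  \<comment> \<open>Half of the ratio at the offending point, so that \<open>w t x\<close> equals
    \<open>z t x / 2\<close> and is still positive.\<close>
  define e where "e = z t x / (2 * \<psi> t x)"
  define w where "w s y = z s y - e * \<psi> s y" for s y
  have e: "0 < e" using pos by (simp add: e_def \<psi>_def)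
  have wpos: "0 < w t x" using pos by (simp add: w_def e_def \<psi>_def)
  \<comment> \<open>The radius contains \<open>x\<close>, is at least 1 so that y^2 dominates |y|
    outside, and is at least A / e. Since \<open>k\<close> exceeds \<open>a\<close> by 1, the
    barrier has a spare factor exp (y^2), which exceeds A / e for |y| beyond
    \<open>R\<close>.\<close>
  define R where "R = \<bar>x\<bar> + 1 + A / e"
  have R: "1 \<le> R" "\<bar>x\<bar> \<le> R" "A / e \<le> R" using a e by (auto simp: R_def)
  have far: "w s y < 0" if s: "s \<in> {r..r'}" and y: "R \<le> \<bar>y\<bar>" for s y
  proof -
    have "\<bar>y\<bar> * 1 \<le> \<bar>y\<bar> * \<bar>y\<bar>" using y R by (intro mult_left_mono) auto
    then have "A / e < 1 + y\<^sup>2" using y R by (simp add: power2_eq_square)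
    also have "\<dots> \<le> exp (y\<^sup>2)" by (rule exp_ge_add_one_self)
    finally have "A < e * exp (y\<^sup>2)" using e by (simp add: field_simps)
    then have "A * exp (a * y\<^sup>2) < e * exp (y\<^sup>2) * exp (a * y\<^sup>2)" by simp
    also have "\<dots> = e * exp (k * y\<^sup>2)" by (simp add: k_def distrib_right exp_add)
    also have "\<dots> \<le> e * \<psi> s y"
      unfolding \<psi>_def using e b(1)[OF s] s r k
      by (intro mult_left_mono iffD2[OF exp_le_cancel_iff]) (auto intro!: add_increasing2 mult_right_mono)
    finally have "A * exp (a * y\<^sup>2) < e * \<psi> s y" .
    moreover have "z s y \<le> A * exp (a * y\<^sup>2)" using growth[of s y] s r by auto
    ultimately show ?thesis by (simp add: w_def)
  qed
  have "continuous_on ({r..r'} \<times> {-R..R}) (\<lambda>p. (\<lambda>(t, x). z t x) p - e * \<psi> (fst p) (snd p))"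
    unfolding \<psi>_def b_def
  proof (intro continuous_intros)
    show "continuous_on ({r..r'} \<times> {-R..R}) (\<lambda>(t, x). z t x)"
      by (rule continuous_on_subset[OF conjunct1[OF z[unfolded heat_eq_def]]]) (use r in auto)
  qed
  moreover have "(t, x) \<in> {r..r'} \<times> {-R..R}" using t R by auto
  then have ne: "{r..r'} \<times> {-R..R} \<noteq> {}" by blast
  have wp: "(\<lambda>(t, x). z t x) p - e * \<psi> (fst p) (snd p) = w (fst p) (snd p)" for p
    by (simp add: w_def case_prod_beta)
  ultimately obtain q where q: "q \<in> {r..r'} \<times> {-R..R}"
    "\<And>p. p \<in> {r..r'} \<times> {-R..R} \<Longrightarrow> w (fst p) (snd p) \<le> w (fst q) (snd q)"
    using continuous_attains_sup[OF compact_Times[OF compact_Icc compact_Icc] ne]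
    unfolding wp by blast
  obtain s y where sy: "q = (s, y)" by fastforce
  have s: "s \<in> {r..r'}" and y: "\<bar>y\<bar> \<le> R" using q(1) sy by auto
  have max: "w s' y' \<le> w s y" if "s' \<in> {r..r'}" "\<bar>y'\<bar> \<le> R" for s' y'
    using q(2)[of "(s', y')"] that sy by (auto simp: abs_le_iff)
  have wsy: "0 < w s y" using max[OF t R(2)] wpos by simp
  \<comment> \<open>As \<open>w\<close> is negative far out and at time \<open>r\<close>, its
    positive maximum is interior in space and later than \<open>r\<close>. It may lie at
    \<open>r'\<close>, so only the left time derivative is used.\<close>
  have yR: "\<bar>y\<bar> < R" using far[OF s, of y] wsy by fastforce
  have "0 < e * \<psi> r y" using e by (simp add: \<psi>_def)
  then have "w r y < 0" using init[of y] by (simp add: w_def)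
  then have rs: "r < s" using wsy s by (cases "s = r") auto
  then have sT: "s \<in> {0<..T}" using s r by auto
  define P where "P = \<psi> s y"
  have "0 \<le> zxx s y / 2 - e * ((8 * k\<^sup>2 * y\<^sup>2 + c) * P)"
  proof (rule left_derivative_at_max)
    show "((\<lambda>s. w s y) has_real_derivative zxx s y / 2 - e * ((8 * k\<^sup>2 * y\<^sup>2 + c) * P)) (at s within {0..T})"
      unfolding w_def P_def \<psi>_def b_def
      by (auto intro!: derivative_eq_intros d(1)[OF sT] simp: power2_eq_square algebra_simps)
    show "w s' y \<le> w s y" if "s' \<in> {r..s}" for s' using max[of s' y] that s y by auto
  qed (use r s rs in auto)
  moreover have "zxx s y - e * ((2 * b s + 4 * (b s)\<^sup>2 * y\<^sup>2) * P) \<le> 0"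
  proof (rule second_derivative_at_max)
    show "(w s has_real_derivative zx s y' - e * (2 * b s * y' * \<psi> s y')) (at y')" for y'
      unfolding w_def[abs_def] \<psi>_def
      by (auto intro!: derivative_eq_intros d(2)[OF sT] simp: algebra_simps)
    show "((\<lambda>y'. zx s y' - e * (2 * b s * y' * \<psi> s y')) has_real_derivative
        zxx s y - e * ((2 * b s + 4 * (b s)\<^sup>2 * y\<^sup>2) * P)) (at y)"
      unfolding \<psi>_def P_def
      by (auto intro!: derivative_eq_intros d(3)[OF sT] simp: algebra_simps power2_eq_square)
    show "0 < R - \<bar>y\<bar>" using yR by simp
    show "w s y' \<le> w s y" if "\<bar>y - y'\<bar> < R - \<bar>y\<bar>" for y'
      using max[OF s, of y'] that by linarith
  qed
  \<comment> \<open>Half of the second inequality combined with the first eliminates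
    \<open>zxx s y\<close>, that is, the heat equation for \<open>z\<close> has been used at the
    maximum.\<close>
  ultimately have "e * (8 * k\<^sup>2 * y\<^sup>2 + c) * P \<le> e * (b s + 2 * (b s)\<^sup>2 * y\<^sup>2) * P"
    by (simp add: algebra_simps)
  moreover have "0 < e * P" using e by (simp add: P_def \<psi>_def)
  ultimately have "8 * k\<^sup>2 * y\<^sup>2 + c \<le> b s + 2 * (b s)\<^sup>2 * y\<^sup>2"
    using mult_le_cancel_left_pos[of "e * P" "8 * k\<^sup>2 * y\<^sup>2 + c" "b s + 2 * (b s)\<^sup>2 * y\<^sup>2"]
    by (simp only: mult_ac)
  moreover have "(b s)\<^sup>2 \<le> (2 * k)\<^sup>2"
    using b[OF s] k by (intro power_mono) auto
  then have "2 * (b s)\<^sup>2 * y\<^sup>2 \<le> 8 * k\<^sup>2 * y\<^sup>2"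
    by (intro mult_right_mono) (auto simp: power_mult_distrib)
  ultimately show False using b(2)[OF s] by (simp add: c_def)
qed

text \<open>The admissible step length depends on \<open>a\<close> alone, and the growth bound holds
  with the same \<open>a\<close> on the whole of [0, T], so the step can be restarted at each
  multiple of \<open>h\<close> with the nonpositive values just obtained.\<close>

lemma heat_comparison:
  assumes z: "heat_eq T z" and a: "0 < a" "0 < A"
    and growth: "\<And>t x. t \<in> {0..T} \<Longrightarrow> z t x \<le> A * exp (a * x\<^sup>2)"
    and init: "\<And>x. z 0 x \<le> 0" and t: "t \<in> {0..T}"
  shows "z t x \<le> 0"
proof -
  define h where "h = 1 / (8 * (a + 1))"
  have h: "0 < h" "8 * (a + 1) * h = 1" using a by (auto simp: h_def)
  have *: "\<forall>s\<in>{0..T}. s \<le> real n * h \<longrightarrow> (\<forall>x. z s x \<le> 0)" for n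
  proof (induction n)
    case (Suc n)
    show ?case
    proof (intro ballI impI allI)
      fix s x assume s: "s \<in> {0..T}" "s \<le> real (Suc n) * h"
      show "z s x \<le> 0"
      proof (cases "s \<le> real n * h")
        case False
        have nh: "real n * h \<in> {0..T}" using False s h by auto
        have "8 * (a + 1) * (s - real n * h) \<le> 8 * (a + 1) * h"
          using s a by (intro mult_left_mono) (auto simp: algebra_simps)
        then have 1: "8 * (a + 1) * (s - real n * h) \<le> 1" using h by linarith
        have 2: "z (real n * h) y \<le> 0" for y using Suc nh by blast
        show ?thesis
          by (rule heat_comparison_step[OF z a growth _ _ _ 1 2]) (use nh False s in auto)
      qed (use Suc s in auto)
    qed
  qed (use init in force)
  obtain n where "t / h \<le> real n" using real_arch_simple by blast
  then show ?thesis using *[of n] t h by (simp add: field_simps)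
qed

section \<open>The Gaussian heat flow and its identification with every solution\<close>

definition heat_flow :: "real \<Rightarrow> (real \<Rightarrow> real) \<Rightarrow> real \<Rightarrow> real" where
  "heat_flow t f x = (\<integral>y. f (x + sqrt t * y) \<partial>std_normal_distribution)"

lemma exp_growth_affine:
  assumes "exp_growth p"
  shows "exp_growth (\<lambda>y. p (x + r * y))"
proof -
  obtain C a where 1: "0 \<le> C" "0 \<le> a" "\<And>x. \<bar>p x\<bar> \<le> C * exp (a * \<bar>x\<bar>)"
    using exp_growthE[OF assms] by blast
  show ?thesis
  proof (rule exp_growthI[where C="C * exp (a * \<bar>x\<bar>)" and a="a * \<bar>r\<bar>"])
    show "continuous_on UNIV (\<lambda>y. p (x + r * y))"
      by (intro continuous_on_compose2[OF exp_growth_cont[OF assms]] continuous_intros) auto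
    fix y
    have "\<bar>x + r * y\<bar> \<le> \<bar>x\<bar> + \<bar>r\<bar> * \<bar>y\<bar>" using abs_triangle_ineq[of x "r * y"] by (simp add: abs_mult)
    then have "a * \<bar>x + r * y\<bar> \<le> a * \<bar>x\<bar> + a * \<bar>r\<bar> * \<bar>y\<bar>"
      using mult_left_mono[OF _ 1(2)] by (simp add: mult.assoc flip: distrib_left)
    then have "C * exp (a * \<bar>x + r * y\<bar>) \<le> C * exp (a * \<bar>x\<bar> + a * \<bar>r\<bar> * \<bar>y\<bar>)"
      using 1(1) by (intro mult_left_mono) auto
    then show "\<bar>p (x + r * y)\<bar> \<le> C * exp (a * \<bar>x\<bar>) * exp (a * \<bar>r\<bar> * \<bar>y\<bar>)"
      using 1(3)[of "x + r * y"] by (simp add: exp_add mult.assoc)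
  qed
qed

text \<open>The damping factor exp (- l^2 t / 2) of a cosine is at once what the equation requires
  and what averaging over a normal variable of variance t produces; both sides are linear. The bound
  \<open>K\<close> later provides the growth hypothesis of the comparison.\<close>

lemma trig_poly_heat:
  assumes "trig_poly p"
  obtains P K where "heat_eq T P" "\<And>x. P 0 x = p x" "0 < K" "\<And>t x. 0 \<le> t \<Longrightarrow> \<bar>P t x\<bar> \<le> K"
    "\<And>t x. 0 \<le> t \<Longrightarrow> P t x = heat_flow t p x"
proof -
  have "\<exists>P K. heat_eq T P \<and> (\<forall>x. P 0 x = p x) \<and> 0 < K \<and> (\<forall>t\<ge>0. \<forall>x. \<bar>P t x\<bar> \<le> K) \<and>
    (\<forall>t\<ge>0. \<forall>x. P t x = heat_flow t p x)"
    using assms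
  proof (induction rule: trig_poly.induct)
    case (trig_poly_cos l c)
    let ?P = "\<lambda>t x. exp (- l\<^sup>2 * t / 2) * cos (l * x + c)"
    have "\<bar>?P t x\<bar> \<le> 1" if "0 \<le> t" for t x
      using that unfolding abs_mult by (intro mult_le_one) auto
    moreover have "?P t x = heat_flow t (\<lambda>x. cos (l * x + c)) x" if "0 \<le> t" for t x
    proof -
      have "heat_flow t (\<lambda>x. cos (l * x + c)) x = (\<integral>y. cos (l * sqrt t * y + (l * x + c)) \<partial>std_normal_distribution)"
        by (simp add: heat_flow_def algebra_simps)
      then show ?thesis
        using that unfolding integral_cos_std_normal by (simp add: power_mult_distrib)
    qed
    ultimately show ?case
      by (intro exI[of _ ?P] exI[of _ 1]) (auto intro!: heat_eq_cos[simplified])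
  next
    case (trig_poly_add p q)
    then obtain P K Q L where *: "heat_eq T P" "heat_eq T Q" "\<forall>x. P 0 x = p x" "\<forall>x. Q 0 x = q x"
      "0 < K" "0 < L" "\<forall>t\<ge>0. \<forall>x. \<bar>P t x\<bar> \<le> K" "\<forall>t\<ge>0. \<forall>x. \<bar>Q t x\<bar> \<le> L"
      "\<forall>t\<ge>0. \<forall>x. P t x = heat_flow t p x" "\<forall>t\<ge>0. \<forall>x. Q t x = heat_flow t q x" by metis
    have "heat_flow t (\<lambda>x. p x + q x) x = heat_flow t p x + heat_flow t q x" for t x
      unfolding heat_flow_def
      by (intro Bochner_Integration.integral_add exp_growth_integrable exp_growth_affine
          trig_poly_exp_growth trig_poly_add.hyps)
    moreover have "\<bar>P t x + Q t x\<bar> \<le> K + L" if "0 \<le> t" for t x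
      using *(7,8) that abs_triangle_ineq[of "P t x" "Q t x"]
      by (meson add_mono order_trans)
    moreover have "heat_eq T (\<lambda>t x. P t x + Q t x)"
      using heat_eq_lincomb[OF *(1,2), of 1 1] by simp
    ultimately show ?case
      using *(3-6,9,10)
      by (intro exI[of _ "\<lambda>t x. P t x + Q t x"] exI[of _ "K + L"] conjI) simp_all
  next
    case (trig_poly_cmult p a)
    then obtain P K where *: "heat_eq T P" "\<forall>x. P 0 x = p x"
      "0 < K" "\<forall>t\<ge>0. \<forall>x. \<bar>P t x\<bar> \<le> K" "\<forall>t\<ge>0. \<forall>x. P t x = heat_flow t p x" by metis
    have "heat_flow t (\<lambda>x. a * p x) x = a * heat_flow t p x" for t x
      by (simp add: heat_flow_def)
    \<comment> \<open>Adding 1 to the factor keeps the bound positive when \<open>a\<close> is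
      0.\<close>
    moreover have "\<bar>a * P t x\<bar> \<le> (\<bar>a\<bar> + 1) * K" if "0 \<le> t" for t x
      unfolding abs_mult using *(3,4) that by (intro mult_mono) auto
    moreover have "heat_eq T (\<lambda>t x. a * P t x)"
      using heat_eq_lincomb[OF *(1,1), of a 0] by simp
    moreover have "0 < (\<bar>a\<bar> + 1) * K" using *(3) by (simp add: add_nonneg_pos)
    ultimately show ?case
      using *(2,5)
      by (intro exI[of _ "\<lambda>t x. a * P t x"] exI[of _ "(\<bar>a\<bar> + 1) * K"] conjI) simp_all
  qed
  then show ?thesis using that by blast
qed

text \<open>Approximating the initial datum by trigonometric polynomials within \<open>e (1 + x\<^sup>2)\<close> keeps the
  solutions within \<open>e (1 + x\<^sup>2 + t)\<close>, because the latter solves the heat equation.\<close>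

theorem heat_solution_unique:
  assumes u: "heat_solution T f u" "gaussian_growth T u"
    and f: "continuous_on UNIV f" "\<And>x. \<bar>f x\<bar> \<le> K" and t: "t \<in> {0..T}"
  shows "u t x = heat_flow t f x"
proof -
  \<comment> \<open>The first summand measures \<open>u\<close> against the solution with datum
    \<open>p\<close>, the second the flow of \<open>f\<close> against the flow of
    \<open>p\<close>.\<close>
  define C where "C = (1 + x\<^sup>2 + t) + (\<integral>y. 1 + (x + sqrt t * y)\<^sup>2 \<partial>std_normal_distribution)"
  have gx: "exp_growth (\<lambda>y. 1 + (x + sqrt t * y)\<^sup>2)"
    by (intro exp_growth_add exp_growth_const exp_growth_power2 exp_growth_cmult exp_growth_ident)
  obtain a A where growth: "0 < a" "0 < A" "\<And>t x. t \<in> {0..T} \<Longrightarrow> \<bar>u t x\<bar> \<le> A * exp (a * x\<^sup>2)"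
    using u(2) unfolding gaussian_growth_def by blast
  have u0: "u 0 x = f x" for x using u(1) by (simp add: heat_solution_def)
  have approx: "\<bar>u t x - heat_flow t f x\<bar> \<le> e * C" if e: "0 < e" for e
  proof -
    obtain p where p: "trig_poly p" "\<And>x. \<bar>f x - p x\<bar> \<le> e * (1 + x\<^sup>2)"
      using trig_poly_approx[OF f e] by blast
    obtain P L where P: "heat_eq T P" "\<And>x. P 0 x = p x" "0 < L" "\<And>t x. 0 \<le> t \<Longrightarrow> \<bar>P t x\<bar> \<le> L"
      "\<And>t x. 0 \<le> t \<Longrightarrow> P t x = heat_flow t p x"
      by (rule trig_poly_heat[OF p(1), where T=T]) blast
    \<comment> \<open>The signs 1 and -1 give the upper and the lower estimate from a single
      comparison.\<close>
    have *: "\<sigma> * (u t x - P t x) - e * (1 + x\<^sup>2 + t) \<le> 0" if \<sigma>: "\<bar>\<sigma>\<bar> = 1" for \<sigma>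
    proof (rule heat_comparison[where z="\<lambda>t x. \<sigma> * (u t x - P t x) - e * (1 + x\<^sup>2 + t)",
          OF _ growth(1) _ _ _ t, where A="A + L"])
      have "heat_eq T (\<lambda>t x. 1 * (\<sigma> * u t x + (- \<sigma>) * P t x) + (- e) * (1 + x\<^sup>2 + t))"
        by (intro heat_eq_lincomb heat_solution_heat_eq[OF u(1)] P(1) heat_eq_quadratic)
      then show "heat_eq T (\<lambda>t x. \<sigma> * (u t x - P t x) - e * (1 + x\<^sup>2 + t))"
        by (simp add: right_diff_distrib)
      show "0 < A + L" using growth P by simp
      show "\<sigma> * (u s y - P s y) - e * (1 + y\<^sup>2 + s) \<le> (A + L) * exp (a * y\<^sup>2)" if s: "s \<in> {0..T}" for s y
      proof -
        have "\<sigma> * (u s y - P s y) \<le> \<bar>\<sigma>\<bar> * \<bar>u s y - P s y\<bar>" unfolding abs_mult[symmetric] by simp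
        also have "\<dots> \<le> \<bar>u s y\<bar> + \<bar>P s y\<bar>" using \<sigma> by simp
        also have "\<dots> \<le> A * exp (a * y\<^sup>2) + L * exp (a * y\<^sup>2)"
        proof (rule add_mono)
          have "L * 1 \<le> L * exp (a * y\<^sup>2)" using P(3) growth(1) by (intro mult_left_mono) auto
          then show "\<bar>P s y\<bar> \<le> L * exp (a * y\<^sup>2)" using P(4)[of s y] s by auto
        qed (rule growth(3)[OF s])
        finally have "\<sigma> * (u s y - P s y) \<le> (A + L) * exp (a * y\<^sup>2)" by (simp add: distrib_right)
        moreover have "0 \<le> e * (1 + y\<^sup>2 + s)" using e s by simp
        ultimately show ?thesis by linarith
      qed
      show "\<sigma> * (u 0 y - P 0 y) - e * (1 + y\<^sup>2 + 0) \<le> 0" for y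
      proof -
        have "\<sigma> * (f y - p y) \<le> \<bar>\<sigma>\<bar> * \<bar>f y - p y\<bar>" unfolding abs_mult[symmetric] by simp
        then show ?thesis using p(2)[of y] \<sigma> u0 P(2) by simp
      qed
    qed
    have 1: "\<bar>u t x - P t x\<bar> \<le> e * (1 + x\<^sup>2 + t)"
      using *[of 1] *[of "-1"] by (simp add: abs_le_iff)
    have fx: "exp_growth (\<lambda>y. f (x + sqrt t * y))" "exp_growth (\<lambda>y. p (x + sqrt t * y))"
      by (intro exp_growth_affine exp_growth_bounded[OF f] trig_poly_exp_growth p)+
    have "\<bar>heat_flow t f x - heat_flow t p x\<bar>
        = \<bar>\<integral>y. f (x + sqrt t * y) - p (x + sqrt t * y) \<partial>std_normal_distribution\<bar>"
      unfolding heat_flow_def using fx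
      by (subst Bochner_Integration.integral_diff) (auto intro: exp_growth_integrable)
    also have "\<dots> \<le> (\<integral>y. \<bar>f (x + sqrt t * y) - p (x + sqrt t * y)\<bar> \<partial>std_normal_distribution)"
      by (rule integral_abs_bound)
    also have "\<dots> \<le> (\<integral>y. e * (1 + (x + sqrt t * y)\<^sup>2) \<partial>std_normal_distribution)"
      using p(2) by (intro integral_mono integrable_abs integrable_mult_right exp_growth_integrable
          exp_growth_diff fx gx)
    finally have 2: "\<bar>heat_flow t f x - heat_flow t p x\<bar> \<le> e * (\<integral>y. 1 + (x + sqrt t * y)\<^sup>2 \<partial>std_normal_distribution)"
      by simp
    have "P t x = heat_flow t p x" using P(5) t by auto
    then show ?thesis using 1 2 unfolding C_def distrib_left by linarith
  qed
  have C: "0 \<le> C" using approx[of 1] by linarith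
  have "\<bar>u t x - heat_flow t f x\<bar> \<le> 0 + e" if "0 < e" for e
  proof -
    have "e / (C + 1) * C \<le> e * 1" using that C by (simp add: field_simps)
    then show ?thesis using approx[of "e / (C + 1)"] that C by simp
  qed
  then have "\<bar>u t x - heat_flow t f x\<bar> \<le> 0" by (rule field_le_epsilon)
  then show ?thesis by simp
qed

section \<open>Sums over injective multi-indices\<close>

text \<open>For finite \<open>K\<close> this is \<open>fact n\<close> times the n-th elementary
  symmetric polynomial of the values \<open>d l\<close>, written over ordered indices to match
  \<open>step_integral\<close>.\<close>

definition inj_sum :: "nat \<Rightarrow> nat set \<Rightarrow> (nat \<Rightarrow> real) \<Rightarrow> real" where
  "inj_sum n K d = (\<Sum>i\<in>{i. i \<in> {..<n} \<rightarrow>\<^sub>E K \<and> inj_on i {..<n}}. \<Prod>j<n. d (i j))"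

lemma inj_sum_0 [simp]: "inj_sum 0 K d = 1"
  by (simp add: inj_sum_def)

lemma inj_sum_Suc:
  assumes "finite K"
  shows "inj_sum (Suc n) K d = (\<Sum>l\<in>K. d l * inj_sum n (K - {l}) d)"
proof -
  let ?I = "\<lambda>K. {i. i \<in> {..<n} \<rightarrow>\<^sub>E K \<and> inj_on i {..<n}}"
  let ?P = "{(l, i). l \<in> K \<and> i \<in> {..<n} \<rightarrow>\<^sub>E (K - {l}) \<and> inj_on i {..<n}}"
  have P: "?P = Sigma K (\<lambda>l. ?I (K - {l}))" by auto
  have fin: "finite (?I K')" if "finite K'" for K'
    by (rule finite_subset[OF _ finite_PiE[of "{..<n}" "\<lambda>_. K'"]]) (use that in auto)
  have "inj_sum (Suc n) K d = (\<Sum>i\<in>(\<lambda>(l, i). i(n := l)) ` ?P. \<Prod>j<Suc n. d (i j))"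
    unfolding inj_sum_def lessThan_Suc
    by (subst extensional_funcset_extend_domain_inj_on_eq) auto
  also have "\<dots> = (\<Sum>(l, i)\<in>?P. \<Prod>j<Suc n. d ((i(n := l)) j))"
    by (subst sum.reindex[OF extensional_funcset_extend_domain_inj_onI]) (auto simp: case_prod_beta)
  also have "\<dots> = (\<Sum>(l, i)\<in>?P. d l * (\<Prod>j<n. d (i j)))"
    by (rule sum.cong) (auto simp: mult.commute intro!: prod.cong)
  also have "\<dots> = (\<Sum>l\<in>K. \<Sum>i\<in>?I (K - {l}). d l * (\<Prod>j<n. d (i j)))"
    unfolding P using assms by (subst sum.Sigma) (auto intro: fin)
  finally show ?thesis by (simp add: inj_sum_def sum_distrib_left)
qed

text \<open>An injective index takes the new value \<open>m\<close> either nowhere or at exactly one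
  of its n + 1 places. This is the recursion by which increments are added one at a time.\<close>

lemma inj_sum_insert:
  assumes "finite K" "m \<notin> K"
  shows "inj_sum (Suc n) (insert m K) d = inj_sum (Suc n) K d + real (Suc n) * d m * inj_sum n K d"
  using assms
proof (induction n arbitrary: K)
  case 0
  then show ?case by (simp add: inj_sum_Suc)
next
  case (Suc n)
  have "inj_sum (Suc (Suc n)) (insert m K) d
    = d m * inj_sum (Suc n) K d + (\<Sum>l\<in>K. d l * inj_sum (Suc n) (insert m (K - {l})) d)"
    using Suc.prems by (simp add: inj_sum_Suc[of "insert m K" "Suc n"])
      (intro sum.cong refl arg_cong2[where f="(*)"] arg_cong[where f="\<lambda>K. inj_sum (Suc n) K d"], auto)
  also have "(\<Sum>l\<in>K. d l * inj_sum (Suc n) (insert m (K - {l})) d)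
    = (\<Sum>l\<in>K. d l * inj_sum (Suc n) (K - {l}) d) + real (Suc n) * d m * (\<Sum>l\<in>K. d l * inj_sum n (K - {l}) d)"
    unfolding sum_distrib_left sum.distrib[symmetric]
    by (rule sum.cong) (use Suc in \<open>auto simp: algebra_simps\<close>)
  also have "\<dots> = inj_sum (Suc (Suc n)) K d + real (Suc n) * d m * inj_sum (Suc n) K d"
    using Suc.prems by (simp only: inj_sum_Suc[symmetric])
  finally show ?case by (simp add: algebra_simps)
qed

lemma inj_sum_Suc_lessThan_Suc:
  "inj_sum (Suc n) {..<Suc m} d = inj_sum (Suc n) {..<m} d + real (Suc n) * d m * inj_sum n {..<m} d"
  unfolding lessThan_Suc by (rule inj_sum_insert) auto

lemma inj_sum_Suc_empty: "inj_sum (Suc n) {} d = 0"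
  by (simp add: inj_sum_Suc)

lemma inj_sum_const: "inj_sum n {..<m} (\<lambda>_. r) = fact n * real (m choose n) * r ^ n"
proof (induction m arbitrary: n)
  case 0
  show ?case by (cases n) (auto simp: inj_sum_Suc_empty)
next
  case (Suc m)
  show ?case
  proof (cases n)
    case (Suc k)
    show ?thesis
      unfolding Suc inj_sum_Suc_lessThan_Suc Suc.IH
      by (simp add: algebra_simps)
  qed simp
qed

lemma inj_sum_cong: "(\<And>k. k \<in> K \<Longrightarrow> d k = d' k) \<Longrightarrow> inj_sum n K d = inj_sum n K d'"
  unfolding inj_sum_def by (intro sum.cong prod.cong refl) (auto simp: PiE_iff)

lemma inj_sum_measurable:
  "inj_sum n {..<m} \<in> borel_measurable (PiM {..<m} (\<lambda>_. borel))"
  unfolding inj_sum_def[abs_def]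
  by (intro borel_measurable_sum borel_measurable_prod measurable_component_singleton) auto

lemma step_integral_const:
  "step_integral B n m \<tau> (\<lambda>_. c) \<omega> = c * inj_sum n {..<m} (\<lambda>k. B (\<tau> (Suc k)) \<omega> - B (\<tau> k) \<omega>)"
  by (simp add: step_integral_def inj_sum_def off_diagonal_indices_def sum_distrib_left Collect_conj_eq)

text \<open>The left side is the total volume of the off-diagonal boxes of a mesh with
  \<open>Suc k\<close> cells per axis; the diagonal boxes have a vanishing share, since the falling
  factorial of \<open>Suc k\<close> is asymptotic to its n-th power.\<close>

lemma tendsto_inj_count:
  "(\<lambda>k. fact n * real (Suc k choose n) * (t / real (Suc k)) ^ n) \<longlonglongrightarrow> t ^ n"
proof -
  have "(\<lambda>k. \<Prod>i<n. (real (Suc k) - real i) / real (Suc k) * t) \<longlonglongrightarrow> (\<Prod>i<n. 1 * t)"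
  proof (intro tendsto_prod tendsto_mult tendsto_const)
    fix i
    show "(\<lambda>k. (real (Suc k) - real i) / real (Suc k)) \<longlonglongrightarrow> 1"
      by real_asymp
  qed
  moreover have "(\<Prod>i<n. (real (Suc k) - real i) / real (Suc k) * t)
      = fact n * real (Suc k choose n) * (t / real (Suc k)) ^ n" for k
  proof -
    have "fact n * real (Suc k choose n) = (\<Prod>i<n. real (Suc k) - real i)"
      unfolding binomial_gbinomial gbinomial_prod_rev by (simp add: atLeast0LessThan)
    then show ?thesis
      by (simp add: prod.distrib prod_dividef power_divide)
  qed
  ultimately show ?thesis by simp
qed

section \<open>Step kernels on the cube\<close>

abbreviation lebesgue_T :: "real \<Rightarrow> real measure" where
  "lebesgue_T T \<equiv> restrict_space lborel {0..T}"

lemma finite_lebesgue_T: "finite_measure (lebesgue_T T)"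
proof (rule finite_measureI)
  have "emeasure lborel {0..T} \<noteq> \<infinity>" by (cases "0 \<le> T") auto
  then show "emeasure (lebesgue_T T) (space (lebesgue_T T)) \<noteq> \<infinity>"
    by (simp add: emeasure_restrict_space space_restrict_space)
qed

lemma product_sigma_finite_lebesgue_T: "product_sigma_finite (\<lambda>_. lebesgue_T T)"
proof -
  interpret finite_measure "lebesgue_T T" by (rule finite_lebesgue_T)
  show ?thesis by unfold_locales
qed

lemma sets_lebesgue_T: "A \<in> sets borel \<Longrightarrow> A \<subseteq> {0..T} \<Longrightarrow> A \<in> sets (lebesgue_T T)"
  by (auto simp: sets_restrict_space image_iff intro!: bexI[of _ A])

lemma indicator_measurable_cube:
  assumes "A \<in> sets borel" "j < n"
  shows "(\<lambda>s. indicator A (s j) :: real) \<in> borel_measurable (cube T n)"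
proof -
  have "(\<lambda>s. s j) \<in> measurable (cube T n) (lebesgue_T T)"
    unfolding cube_def using assms(2) by (intro measurable_component_singleton) auto
  moreover have "(indicator A :: real \<Rightarrow> real) \<in> borel_measurable (lebesgue_T T)"
    using assms(1) by (intro measurable_restrict_space1) auto
  ultimately show ?thesis by (rule measurable_compose)
qed

lemma box_integral:
  assumes "\<And>j. j < n \<Longrightarrow> A j \<in> sets borel \<and> A j \<subseteq> {0..T}"
  shows "has_bochner_integral (cube T n) (\<lambda>s. \<Prod>j<n. indicator (A j) (s j)) (\<Prod>j<n. measure lborel (A j))"
proof -
  interpret product_sigma_finite "\<lambda>_. lebesgue_T T" by (rule product_sigma_finite_lebesgue_T)
  interpret L: finite_measure "lebesgue_T T" by (rule finite_lebesgue_T)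
  have i: "integrable (lebesgue_T T) (indicator (A j) :: real \<Rightarrow> real)" if "j < n" for j
    using assms[OF that] by (intro L.integrable_const_bound[where B=1])
      (auto intro!: borel_measurable_indicator sets_lebesgue_T simp: indicator_def)
  have "(\<integral>x. indicator (A j) x \<partial>lebesgue_T T) = measure lborel (A j)" if "j < n" for j
  proof -
    have "(\<integral>x. indicator (A j) x \<partial>lebesgue_T T) = measure (lebesgue_T T) (A j)"
      using assms[OF that] by (simp add: space_restrict_space Int_absorb2)
    also have "\<dots> = measure lborel (A j)"
      using assms[OF that] by (intro measure_restrict_space) auto
    finally show ?thesis .
  qed
  then have "(\<Prod>j<n. \<integral>x. indicator (A j) x \<partial>lebesgue_T T) = (\<Prod>j<n. measure lborel (A j))"
    by (intro prod.cong) auto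
  moreover have "(\<integral>s. (\<Prod>j<n. indicator (A j) (s j)) \<partial>PiM {..<n} (\<lambda>_. lebesgue_T T))
      = (\<Prod>j<n. \<integral>x. indicator (A j) x \<partial>lebesgue_T T :: real)"
    by (rule product_integral_prod) (use i in auto)
  moreover have "integrable (PiM {..<n} (\<lambda>_. lebesgue_T T)) (\<lambda>s. \<Prod>j<n. indicator (A j) (s j) :: real)"
    by (rule product_integrable_prod) (use i in auto)
  ultimately show ?thesis
    unfolding cube_def has_bochner_integral_iff by (simp only:)
qed

text \<open>The indicator of ]0, t]^n, half open so that the cells of a partition of ]0, t] tile it
  exactly; of order 0 it is the constant 1.\<close>

definition box_kernel :: "nat \<Rightarrow> real \<Rightarrow> (nat \<Rightarrow> real) \<Rightarrow> real" where
  "box_kernel n t s = (\<Prod>j<n. indicator {0<..t} (s j))"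

lemma box_kernel_cases: "box_kernel n t s = 0 \<or> box_kernel n t s = 1"
  unfolding box_kernel_def by (induction n) (auto simp: indicator_def)

lemma box_kernel_idem: "(box_kernel n t s)\<^sup>2 = box_kernel n t s"
  using box_kernel_cases[of n t s] by auto

lemma box_kernel_measurable: "box_kernel n t \<in> borel_measurable (cube T n)"
  unfolding box_kernel_def[abs_def] by (intro borel_measurable_prod indicator_measurable_cube) auto

lemma box_kernel_integral:
  assumes "0 \<le> t" "t \<le> T"
  shows "has_bochner_integral (cube T n) (box_kernel n t) (t ^ n)"
proof -
  have "{0<..t} \<subseteq> {0..T}" using assms by auto
  then show ?thesis
    using box_integral[of n "\<lambda>_. {0<..t}" T] assms by (auto simp: box_kernel_def[abs_def])
qed

lemma box_kernel_square_integrable: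
  assumes "0 \<le> t" "t \<le> T"
  shows "square_integrable (cube T n) (box_kernel n t)"
  using box_kernel_integral[OF assms, of n] box_kernel_measurable[of n t T]
  by (simp add: square_integrable_def box_kernel_idem has_bochner_integral_iff)

lemma monotone_steps_disjoint:
  fixes \<tau> :: "nat \<Rightarrow> real"
  assumes mono: "\<And>i j. i \<le> j \<Longrightarrow> j \<le> m \<Longrightarrow> \<tau> i \<le> \<tau> j"
    and ij: "i < m" "j < m" "x \<in> {\<tau> i<..\<tau> (Suc i)}" "x \<in> {\<tau> j<..\<tau> (Suc j)}"
  shows "i = j"
proof (rule ccontr)
  assume "i \<noteq> j"
  then consider "Suc i \<le> j" | "Suc j \<le> i" by linarith
  then show False
  proof cases
    case 1
    then show False using mono[of "Suc i" j] ij by auto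
  next
    case 2
    then show False using mono[of "Suc j" i] ij by auto
  qed
qed

text \<open>The uniform step kernel is the indicator of \<open>]0, t]\<^sup>n\<close> minus the diagonal boxes.\<close>

lemma step_kernel_uniform:
  fixes m n :: nat
  assumes t: "0 < t" "t \<le> T" and m: "0 < m"
  defines "\<tau> \<equiv> \<lambda>i. t * real i / real m"
  shows "step_kernel n m \<tau> (\<lambda>_. 1) \<in> borel_measurable (cube T n)"
    and "has_bochner_integral (cube T n) (step_kernel n m \<tau> (\<lambda>_. 1))
          (fact n * real (m choose n) * (t / real m) ^ n)"
    and "(step_kernel n m \<tau> (\<lambda>_. 1) s)\<^sup>2 = step_kernel n m \<tau> (\<lambda>_. 1) s"
    and "(step_kernel n m \<tau> (\<lambda>_. 1) s - box_kernel n t s)\<^sup>2 = box_kernel n t s - step_kernel n m \<tau> (\<lambda>_. 1) s"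
proof -
  let ?I = "\<lambda>i. {\<tau> i<..\<tau> (Suc i)}"
  let ?O = "off_diagonal_indices n m"
  have mono: "\<tau> i \<le> \<tau> j" if "i \<le> j" for i j
    using that t m by (auto simp: \<tau>_def intro!: divide_right_mono mult_left_mono)
  have sub: "?I i \<subseteq> {0<..t}" if "i < m" for i
  proof -
    have "0 \<le> \<tau> i" using t by (simp add: \<tau>_def)
    moreover have "\<tau> (Suc i) \<le> \<tau> m" using that by (intro mono) auto
    moreover have "\<tau> m = t" using m by (simp add: \<tau>_def)
    ultimately show ?thesis by auto
  qed
  have len: "measure lborel (?I i) = t / real m" for i
    using mono[of i "Suc i"] m by (simp add: \<tau>_def field_simps)
  have O: "i j < m" if "i \<in> ?O" "j < n" for i j
    using that by (auto simp: off_diagonal_indices_def PiE_iff)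
  have finO: "finite ?O"
    unfolding off_diagonal_indices_def by (intro finite_Collect_conjI disjI1) (auto intro: finite_PiE)
  show "step_kernel n m \<tau> (\<lambda>_. 1) \<in> borel_measurable (cube T n)"
    unfolding step_kernel_def[abs_def]
    by (intro borel_measurable_sum borel_measurable_times borel_measurable_prod
        indicator_measurable_cube borel_measurable_const) auto
  have "has_bochner_integral (cube T n) (\<lambda>s. \<Sum>i\<in>?O. \<Prod>j<n. indicator (?I (i j)) (s j))
     (\<Sum>i\<in>?O. \<Prod>j<n. measure lborel (?I (i j)))"
  proof (intro has_bochner_integral_sum box_integral conjI)
    fix i j assume "i \<in> ?O" "j < n"
    then show "?I (i j) \<subseteq> {0..T}" using sub[OF O] t by force
  qed simp
  moreover have "(\<Sum>i\<in>?O. \<Prod>j<n. measure lborel (?I (i j))) = inj_sum n {..<m} (\<lambda>_. t / real m)"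
    unfolding len by (simp add: inj_sum_def off_diagonal_indices_def Collect_conj_eq)
  ultimately show "has_bochner_integral (cube T n) (step_kernel n m \<tau> (\<lambda>_. 1))
          (fact n * real (m choose n) * (t / real m) ^ n)"
    by (simp add: step_kernel_def[abs_def] inj_sum_const)
  \<comment> \<open>The multi-indices whose box contains \<open>s\<close>. The cells are disjoint,
    so there is at most one, and the step kernel takes only the values 0 and 1.\<close>
  let ?D = "{i \<in> ?O. \<forall>j<n. s j \<in> ?I (i j)}"
  have prod: "(\<Prod>j<n. indicator (?I (i j)) (s j)) = (if \<forall>j<n. s j \<in> ?I (i j) then 1 else 0 :: real)" for i
    by (auto simp: indicator_def intro!: prod.neutral prod_zero)
  have card: "step_kernel n m \<tau> (\<lambda>_. 1) s = real (card ?D)"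
    unfolding step_kernel_def prod using finO by (simp add: sum.If_cases Int_def)
  have D1: "i = i'" if "i \<in> ?D" "i' \<in> ?D" for i i'
  proof (rule PiE_ext)
    show "i \<in> {..<n} \<rightarrow>\<^sub>E {..<m}" "i' \<in> {..<n} \<rightarrow>\<^sub>E {..<m}"
      using that by (auto simp: off_diagonal_indices_def)
    fix j assume j: "j \<in> {..<n}"
    show "i j = i' j"
    proof (rule monotone_steps_disjoint[where \<tau>=\<tau> and m=m and x="s j"])
      show "\<tau> k \<le> \<tau> l" if "k \<le> l" "l \<le> m" for k l using that mono by blast
      show "i j < m" "i' j < m" using that j O by auto
      show "s j \<in> ?I (i j)" "s j \<in> ?I (i' j)" using that j by auto
    qed
  qed
  have D2: "box_kernel n t s = 1" if "i \<in> ?D" for i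
    unfolding box_kernel_def
  proof (rule prod.neutral, rule ballI)
    fix j assume "j \<in> {..<n}"
    then have "s j \<in> ?I (i j)" "i j < m" using that O by auto
    then have "s j \<in> {0<..t}" using sub by blast
    then show "indicator {0<..t} (s j) = (1::real)" by simp
  qed
  have "(step_kernel n m \<tau> (\<lambda>_. 1) s = 0) \<or> (step_kernel n m \<tau> (\<lambda>_. 1) s = 1 \<and> box_kernel n t s = 1)"
  proof (cases "?D = {}")
    case False
    then obtain i where i: "i \<in> ?D" by blast
    then have "?D = {i}" using D1 by blast
    then have "card ?D = 1" by simp
    then show ?thesis using D2[OF i] card by simp
  next
    case True
    then show ?thesis unfolding card by (simp only: card.empty) simp
  qed
  then show "(step_kernel n m \<tau> (\<lambda>_. 1) s)\<^sup>2 = step_kernel n m \<tau> (\<lambda>_. 1) s"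
    and "(step_kernel n m \<tau> (\<lambda>_. 1) s - box_kernel n t s)\<^sup>2 = box_kernel n t s - step_kernel n m \<tau> (\<lambda>_. 1) s"
    using box_kernel_cases[of n t s] by (auto simp: power2_eq_square)
qed

lemma step_kernel_cmult: "step_kernel n m \<tau> (\<lambda>_. c) s = c * step_kernel n m \<tau> (\<lambda>_. 1) s"
  by (simp add: step_kernel_def sum_distrib_left)

lemma L2_tendsto_cmult:
  assumes "L2_tendsto N F f"
  shows "L2_tendsto N (\<lambda>k x. c * F k x) (\<lambda>x. c * f x)"
proof -
  have "(c * a - c * b)\<^sup>2 = c\<^sup>2 * (a - b)\<^sup>2" for a b :: real
    by (simp add: power_mult_distrib flip: right_diff_distrib)
  then show ?thesis
    using assms tendsto_mult_right_zero[of "\<lambda>k. \<integral>x. (F k x - f x)\<^sup>2 \<partial>N" sequentially "c\<^sup>2"]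
    by (auto simp: L2_tendsto_def square_integrable_cmult)
qed

lemma L2_tendsto_cong_AE:
  assumes "L2_tendsto N F f" "g \<in> borel_measurable N" "AE x in N. f x = g x"
  shows "L2_tendsto N F g"
proof -
  have g: "square_integrable N g"
    using square_integrable_cong_AE[of N f g] assms by (auto simp: L2_tendsto_def)
  have "(\<integral>x. (F k x - f x)\<^sup>2 \<partial>N) = (\<integral>x. (F k x - g x)\<^sup>2 \<partial>N)" for k
  proof (intro integral_cong_AE borel_measurable_power borel_measurable_diff)
    show "AE x in N. (F k x - f x)\<^sup>2 = (F k x - g x)\<^sup>2" using assms(3) by auto
  qed (use assms(1) g in \<open>auto simp: L2_tendsto_def square_integrable_def\<close>)
  then show ?thesis using assms(1) g by (simp add: L2_tendsto_def)
qed

text \<open>The difference of the two indicators is its own square up to sign, so the squared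
  distance is just the volume missed by the off-diagonal boxes.\<close>

lemma step_kernel_tendsto:
  assumes t: "0 < t" "t \<le> T"
  shows "L2_tendsto (cube T n)
    (\<lambda>k. step_kernel n (Suc k) (\<lambda>i. t * real i / real (Suc k)) (\<lambda>_. 1)) (box_kernel n t)"
  unfolding L2_tendsto_def
proof (intro conjI allI)
  note S = step_kernel_uniform[OF t zero_less_Suc, of n]
  have b: "has_bochner_integral (cube T n) (box_kernel n t) (t ^ n)"
    using t by (intro box_kernel_integral) auto
  show "square_integrable (cube T n) (box_kernel n t)"
    using t by (intro box_kernel_square_integrable) auto
  show "square_integrable (cube T n) (step_kernel n (Suc k) (\<lambda>i. t * real i / real (Suc k)) (\<lambda>_. 1))" for k
    unfolding square_integrable_def using S(1,2)[of k]
    by (simp only: S(3)) (auto simp: has_bochner_integral_iff)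
  have "(\<integral>s. (step_kernel n (Suc k) (\<lambda>i. t * real i / real (Suc k)) (\<lambda>_. 1) s - box_kernel n t s)\<^sup>2 \<partial>cube T n)
     = t ^ n - fact n * real (Suc k choose n) * (t / real (Suc k)) ^ n" for k
    unfolding S(4)
    by (rule has_bochner_integral_integral_eq) (rule has_bochner_integral_diff[OF b S(2)])
  then show "(\<lambda>k. \<integral>s. (step_kernel n (Suc k) (\<lambda>i. t * real i / real (Suc k)) (\<lambda>_. 1) s - box_kernel n t s)\<^sup>2 \<partial>cube T n)
      \<longlonglongrightarrow> 0"
    using tendsto_diff[OF tendsto_const[of "t ^ n"] tendsto_inj_count[of n t]]
    by (simp only: diff_self)
qed

section \<open>Multiple integrals of box kernels\<close>

lemma (in prob_space) normal_has_expectation: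
  fixes p :: "real \<Rightarrow> real"
  assumes X: "distributed M lborel X (normal_density 0 \<sigma>)" "0 < \<sigma>"
    and p: "p \<in> borel_measurable borel"
    and i: "has_bochner_integral std_normal_distribution (\<lambda>x. p (\<sigma> * x)) c"
  shows "has_bochner_integral M (\<lambda>\<omega>. p (X \<omega>)) c"
proof -
  have Y: "distributed M lborel (\<lambda>\<omega>. (X \<omega> - 0) / \<sigma>) std_normal_density"
    using X normal_standard_normal_convert[OF X(2), of X 0] by simp
  then have d: "distr M lborel (\<lambda>\<omega>. X \<omega> / \<sigma>) = std_normal_distribution"
    using distributed_distr_eq_density[OF Y] by simp
  have m: "(\<lambda>\<omega>. X \<omega> / \<sigma>) \<in> measurable M lborel"
    using distributed_measurable[OF Y] by simp
  have q: "(\<lambda>x. p (\<sigma> * x)) \<in> borel_measurable lborel" using p by measurable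
  have "has_bochner_integral M (\<lambda>\<omega>. p (\<sigma> * (X \<omega> / \<sigma>))) c"
    using i unfolding d[symmetric] has_bochner_integral_iff
    by (simp add: integrable_distr_eq[OF m q] integral_distr[OF m q])
  then show ?thesis using X(2) by simp
qed

lemma hermite_scale_sqrt: "0 \<le> v \<Longrightarrow> hermite v n (sqrt v * x) = sqrt v ^ n * hermite 1 n x"
  using hermite_scale[of "sqrt v" 1 n x] by simp

lemma (in prob_space) normal_hermite_orthogonal:
  assumes X: "distributed M lborel X (normal_density 0 (sqrt v))" "0 < v"
  shows "has_bochner_integral M (\<lambda>\<omega>. hermite v j (X \<omega>) * hermite v k (X \<omega>)) (if j = k then fact k * v ^ k else 0)"
proof (rule normal_has_expectation[OF X(1)])
  have "has_bochner_integral std_normal_distribution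
      (\<lambda>x. (sqrt v ^ j * sqrt v ^ k) * (hermite 1 j x * hermite 1 k x))
      ((sqrt v ^ j * sqrt v ^ k) * (if j = k then fact k else 0))"
  proof (rule has_bochner_integral_mult_right)
    show "has_bochner_integral std_normal_distribution (\<lambda>x. hermite 1 j x * hermite 1 k x) (if j = k then fact k else 0)"
      unfolding has_bochner_integral_iff
      by (auto intro!: exp_growth_integrable exp_growth_mult exp_growth_hermite
          simp: std_normal_hermite_orthogonal)
  qed
  note i = this
  have vk: "sqrt v ^ k * sqrt v ^ k = v ^ k" using X(2) by (simp flip: power_mult_distrib)
  show "has_bochner_integral std_normal_distribution
      (\<lambda>x. hermite v j (sqrt v * x) * hermite v k (sqrt v * x)) (if j = k then fact k * v ^ k else 0)"
  proof -
    have "hermite v j (sqrt v * x) * hermite v k (sqrt v * x)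
        = (sqrt v ^ j * sqrt v ^ k) * (hermite 1 j x * hermite 1 k x)" for x
      using X(2) by (simp add: hermite_scale_sqrt)
    then show ?thesis
      using i vk by (cases "j = k") (simp_all add: mult.commute)
  qed
qed (use X(2) in auto)

text \<open>Writing \<open>F\<close> as a function of the tuple of the first m variables makes it
  independent of \<open>X m\<close>, so the expectation factors.\<close>

lemma (in prob_space) indep_past_has_expectation:
  fixes X :: "nat \<Rightarrow> 'a \<Rightarrow> real"
  assumes ind: "indep_vars (\<lambda>_. borel) X {..<Suc m}"
    and \<Phi>: "\<Phi> \<in> borel_measurable (PiM {..<m} (\<lambda>_. borel))" and g: "g \<in> borel_measurable borel"
    and F: "\<And>\<omega>. F \<omega> = \<Phi> (\<lambda>i\<in>{..<m}. X i \<omega>)"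
    and a: "has_bochner_integral M F a" and b: "has_bochner_integral M (\<lambda>\<omega>. g (X m \<omega>)) b"
  shows "has_bochner_integral M (\<lambda>\<omega>. F \<omega> * g (X m \<omega>)) (a * (b :: real))"
proof -
  have "indep_var (PiM {..<m} (\<lambda>_. borel)) (\<lambda>\<omega>. \<lambda>i\<in>{..<m}. X i \<omega>) (PiM {m} (\<lambda>_. borel)) (\<lambda>\<omega>. \<lambda>i\<in>{m}. X i \<omega>)"
    by (rule indep_var_restrict[OF ind]) auto
  moreover have "(\<lambda>x. g (x m)) \<in> borel_measurable (PiM {m} (\<lambda>_. borel))"
    using g by measurable
  ultimately have "indep_var borel (\<Phi> \<circ> (\<lambda>\<omega>. \<lambda>i\<in>{..<m}. X i \<omega>)) borel ((\<lambda>x. g (x m)) \<circ> (\<lambda>\<omega>. \<lambda>i\<in>{m}. X i \<omega>))"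
    using \<Phi> by (intro indep_var_compose)
  moreover have "\<Phi> \<circ> (\<lambda>\<omega>. \<lambda>i\<in>{..<m}. X i \<omega>) = F" by (simp add: fun_eq_iff F)
  moreover have "(\<lambda>x. g (x m)) \<circ> (\<lambda>\<omega>. \<lambda>i\<in>{m}. X i \<omega>) = (\<lambda>\<omega>. g (X m \<omega>))" by (simp add: fun_eq_iff)
  ultimately have *: "indep_var borel F borel (\<lambda>\<omega>. g (X m \<omega>))" by simp
  show ?thesis
    using indep_var_lebesgue_integral[OF *] indep_var_integrable[OF *] a b
    by (simp add: has_bochner_integral_iff)
qed

text \<open>Let one more increment x of variance r arrive. The off-diagonal sum of order n gains n x
  times the sum of order n - 1, and the Hermite polynomial expands by \<open>hermite_add\<close> in
  the Hermite polynomials of x. Orthogonality in x leaves only the orders 0 and 1, so E[S^2] and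
  E[S H] obey the same recursion with the same start.\<close>

lemma (in prob_space) inj_sum_hermite_expectation:
  fixes X :: "nat \<Rightarrow> 'a \<Rightarrow> real"
  assumes ind: "indep_vars (\<lambda>_. borel) X {..<m}" and r: "0 < r"
    and X: "\<And>i. i < m \<Longrightarrow> distributed M lborel (X i) (normal_density 0 (sqrt r))"
  defines "S \<equiv> \<lambda>n m \<omega>. inj_sum n {..<m} (\<lambda>i. X i \<omega>)"
    and "H \<equiv> \<lambda>n m \<omega>. hermite (real m * r) n (\<Sum>i<m. X i \<omega>)"
    and "c \<equiv> \<lambda>n m. fact n * (fact n * real (m choose n) * r ^ n)"
  shows "square_integrable M (S n m)" "square_integrable M (H n m)"
    "has_bochner_integral M (\<lambda>\<omega>. (S n m \<omega>)\<^sup>2) (c n m)"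
    "has_bochner_integral M (\<lambda>\<omega>. S n m \<omega> * H n m \<omega>) (c n m)"
    "has_bochner_integral M (\<lambda>\<omega>. (H n m \<omega>)\<^sup>2) (fact n * (real m * r) ^ n)"
proof -
  have rv: "X i \<in> borel_measurable M" if "i < m" for i
    using distributed_measurable[OF X[OF that]] by simp
  have Hmeas: "H n j \<in> borel_measurable M" if "j \<le> m" for n j
    unfolding H_def by (intro measurable_compose[OF _ measurable_hermite] borel_measurable_sum rv) (use that in auto)
  have HH: "has_bochner_integral M (\<lambda>\<omega>. (H n j \<omega>)\<^sup>2) (fact n * (real j * r) ^ n)" if j: "j \<le> m" for n j
  proof (cases "j = 0")
    case True
    \<comment> \<open>The empty sum has variance 0 and no density, so its moment comes directly from
      the monomials \<open>hermite 0 n\<close>.\<close>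
    have h0: "(hermite 0 n 0)\<^sup>2 = fact n * (0::real) ^ n"
      by (induction "0::real" n "0::real" rule: hermite.induct) auto
    show ?thesis unfolding H_def True
      using h0 by (simp add: has_bochner_integral_iff prob_space)
  next
    case False
    have "distributed M lborel (\<lambda>\<omega>. \<Sum>i<j. X i \<omega>) (normal_density (\<Sum>i<j. 0) (sqrt (\<Sum>i<j. (sqrt r)\<^sup>2)))"
      by (rule sum_indep_normal) (use False r X j in \<open>auto intro: indep_vars_subset[OF ind]\<close>)
    then have "distributed M lborel (\<lambda>\<omega>. \<Sum>i<j. X i \<omega>) (normal_density 0 (sqrt (real j * r)))"
      using r by simp
    then show ?thesis
      using normal_hermite_orthogonal[of _ "real j * r" n n] False r
      by (simp add: H_def power2_eq_square)
  qed
  have Hsq: "square_integrable M (H n j)" if "j \<le> m" for n j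
    using HH[OF that] Hmeas[OF that] by (auto simp: square_integrable_def has_bochner_integral_iff)
  have S: "square_integrable M (S n j) \<and> has_bochner_integral M (\<lambda>\<omega>. (S n j \<omega>)\<^sup>2) (c n j)
      \<and> has_bochner_integral M (\<lambda>\<omega>. S n j \<omega> * H n j \<omega>) (c n j)" if "j \<le> m" for n j
    using that
  proof (induction j arbitrary: n)
    case 0
    show ?case
    proof (cases n)
      case 0
      then show ?thesis
        by (simp add: S_def H_def c_def square_integrable_def has_bochner_integral_iff prob_space)
    next
      case (Suc k)
      then show ?thesis
        by (simp add: S_def H_def c_def inj_sum_Suc_empty square_integrable_def has_bochner_integral_zero)
    qed
  next
    case (Suc j)
    show ?case
    proof (cases n)
      case 0
      have "has_bochner_integral M (\<lambda>\<omega>. H 0 (Suc j) \<omega>) 1"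
        by (simp add: H_def has_bochner_integral_iff prob_space)
      then show ?thesis
        unfolding 0
        by (simp add: S_def H_def c_def square_integrable_def has_bochner_integral_iff prob_space)
    next
      case (Suc k)
      have j: "j \<le> m" "j < m" using \<open>Suc j \<le> m\<close> by auto
      note IH = Suc.IH[OF j(1)]
      have ind_j: "indep_vars (\<lambda>_. borel) X {..<Suc j}"
        by (rule indep_vars_subset[OF ind]) (use j in auto)
      define h where "h l \<omega> = hermite r l (X j \<omega>)" for l \<omega>
      have rec: "S n (Suc j) \<omega> = S n j \<omega> + real n * h 1 \<omega> * S k j \<omega>" for \<omega>
        unfolding Suc S_def inj_sum_Suc_lessThan_Suc by (simp add: h_def)
      have restr: "inj_sum n {..<j} (\<lambda>i\<in>{..<j}. X i \<omega>) = S n j \<omega>"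
        "hermite (real j * r) n (\<Sum>i<j. (\<lambda>i\<in>{..<j}. X i \<omega>) i) = H n j \<omega>" for n \<omega>
        by (auto simp: S_def H_def intro!: inj_sum_cong)
      have hmeas: "(\<lambda>x. hermite (real j * r) n (\<Sum>i<j. x i)) \<in> borel_measurable (PiM {..<j} (\<lambda>_. borel))" for n
        by (intro measurable_compose[OF _ measurable_hermite] borel_measurable_sum measurable_component_singleton) auto
      have norm: "has_bochner_integral M (\<lambda>\<omega>. h p \<omega> * h q \<omega>) (if p = q then fact q * r ^ q else 0)" for p q
        unfolding h_def by (rule normal_hermite_orthogonal[OF X[OF j(2)] r])
      \<comment> \<open>Pairs of Hermite factors, with \<open>h 0\<close> equal to 1, let one
        statement serve all three terms of the expanded square. The mixed expectation may stay
        unknown because it is multiplied by 0.\<close>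
      have SS: "has_bochner_integral M (\<lambda>\<omega>. (S p j \<omega> * S q j \<omega>) * (h p' \<omega> * h q' \<omega>))
          (expectation (\<lambda>\<omega>. S p j \<omega> * S q j \<omega>) * (if p' = q' then fact q' * r ^ q' else 0))" for p q p' q'
        unfolding h_def
      proof (rule indep_past_has_expectation[OF ind_j _ _ _ _ norm[unfolded h_def]])
        show "(\<lambda>x. inj_sum p {..<j} x * inj_sum q {..<j} x) \<in> borel_measurable (PiM {..<j} (\<lambda>_. borel))"
          by (intro borel_measurable_times inj_sum_measurable)
        show "S p j \<omega> * S q j \<omega> = inj_sum p {..<j} (\<lambda>i\<in>{..<j}. X i \<omega>) * inj_sum q {..<j} (\<lambda>i\<in>{..<j}. X i \<omega>)" for \<omega>
          by (simp add: restr)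
        show "has_bochner_integral M (\<lambda>\<omega>. S p j \<omega> * S q j \<omega>) (expectation (\<lambda>\<omega>. S p j \<omega> * S q j \<omega>))"
          using IH by (simp add: has_bochner_integral_iff square_integrable_mult_integrable)
      qed measurable
      have SH: "has_bochner_integral M (\<lambda>\<omega>. (S p j \<omega> * H q j \<omega>) * (h p' \<omega> * h q' \<omega>))
          (expectation (\<lambda>\<omega>. S p j \<omega> * H q j \<omega>) * (if p' = q' then fact q' * r ^ q' else 0))" for p q p' q'
        unfolding h_def
      proof (rule indep_past_has_expectation[OF ind_j _ _ _ _ norm[unfolded h_def]])
        show "(\<lambda>x. inj_sum p {..<j} x * hermite (real j * r) q (\<Sum>i<j. x i)) \<in> borel_measurable (PiM {..<j} (\<lambda>_. borel))"
          by (intro borel_measurable_times inj_sum_measurable hmeas)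
        show "S p j \<omega> * H q j \<omega> = inj_sum p {..<j} (\<lambda>i\<in>{..<j}. X i \<omega>) *
            hermite (real j * r) q (\<Sum>i<j. (\<lambda>i\<in>{..<j}. X i \<omega>) i)" for \<omega>
          unfolding restr ..
        show "has_bochner_integral M (\<lambda>\<omega>. S p j \<omega> * H q j \<omega>) (expectation (\<lambda>\<omega>. S p j \<omega> * H q j \<omega>))"
          using IH Hsq[OF j(1)] by (simp add: has_bochner_integral_iff square_integrable_mult_integrable)
      qed measurable
      have diag: "expectation (\<lambda>\<omega>. S p j \<omega> * S p j \<omega>) = c p j" "expectation (\<lambda>\<omega>. S p j \<omega> * H p j \<omega>) = c p j" for p
        using IH[of p] by (auto simp: has_bochner_integral_iff power2_eq_square)
      \<comment> \<open>Pascal's rule for the binomial coefficient in \<open>c\<close>.\<close>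
      have c_rec: "c n (Suc j) = c n j + (real n)\<^sup>2 * (c k j * r)"
        unfolding Suc c_def by (simp add: algebra_simps power2_eq_square)
      have "has_bochner_integral M (\<lambda>\<omega>. (S n j \<omega> * S n j \<omega>) * (h 0 \<omega> * h 0 \<omega>)
          + 2 * real n * ((S n j \<omega> * S k j \<omega>) * (h 1 \<omega> * h 0 \<omega>))
          + (real n)\<^sup>2 * ((S k j \<omega> * S k j \<omega>) * (h 1 \<omega> * h 1 \<omega>)))
        (c n j * (fact 0 * r ^ 0) + 2 * real n * (expectation (\<lambda>\<omega>. S n j \<omega> * S k j \<omega>) * 0)
          + (real n)\<^sup>2 * (c k j * (fact 1 * r ^ 1)))"
        using SS[of n n 0 0] SS[of n k 1 0] SS[of k k 1 1] unfolding diag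
        by (intro has_bochner_integral_add has_bochner_integral_mult_right) simp_all
      then have sq: "has_bochner_integral M (\<lambda>\<omega>. (S n (Suc j) \<omega>)\<^sup>2) (c n (Suc j))"
        unfolding c_rec rec by (simp add: h_def power2_eq_square algebra_simps)
      have "S n (Suc j) \<in> borel_measurable M"
      proof -
        have "(\<lambda>\<omega>. S n j \<omega> + real n * h 1 \<omega> * S k j \<omega>) \<in> borel_measurable M"
          using IH[THEN conjunct1, THEN square_integrable_measurable] rv[OF j(2)] unfolding h_def
          by (intro borel_measurable_add borel_measurable_times borel_measurable_const
              measurable_compose[OF _ measurable_hermite])
        then show ?thesis by (simp add: rec[abs_def])
      qed
      then have sqi: "square_integrable M (S n (Suc j))"
        using sq by (auto simp: square_integrable_def has_bochner_integral_iff)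
      have Hrec: "H n (Suc j) \<omega> = (\<Sum>l\<le>n. real (n choose l) * H (n - l) j \<omega> * h l \<omega>)" for \<omega>
        unfolding H_def h_def hermite_add[symmetric] by (simp add: algebra_simps)
      have "has_bochner_integral M (\<lambda>\<omega>. \<Sum>l\<le>n. real (n choose l) *
            ((S n j \<omega> * H (n - l) j \<omega>) * (h 0 \<omega> * h l \<omega>) + real n * ((S k j \<omega> * H (n - l) j \<omega>) * (h 1 \<omega> * h l \<omega>))))
         (\<Sum>l\<le>n. real (n choose l) *
            (expectation (\<lambda>\<omega>. S n j \<omega> * H (n - l) j \<omega>) * (if 0 = l then fact l * r ^ l else 0)
             + real n * (expectation (\<lambda>\<omega>. S k j \<omega> * H (n - l) j \<omega>) * (if 1 = l then fact l * r ^ l else 0))))"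
        by (intro has_bochner_integral_sum has_bochner_integral_mult_right has_bochner_integral_add SH)
      moreover have "(\<Sum>l\<le>n. real (n choose l) *
            (expectation (\<lambda>\<omega>. S n j \<omega> * H (n - l) j \<omega>) * (if 0 = l then fact l * r ^ l else 0)
             + real n * (expectation (\<lambda>\<omega>. S k j \<omega> * H (n - l) j \<omega>) * (if 1 = l then fact l * r ^ l else 0))))
         = (\<Sum>l\<le>n. (if l = 0 then c n j else 0) + (if l = 1 then (real n)\<^sup>2 * (c k j * r) else 0))"
        using Suc diag[of n] diag[of k] by (intro sum.cong) (auto simp: power2_eq_square)
      moreover have "\<dots> = c n (Suc j)"
        unfolding c_rec sum.distrib using Suc by simp
      moreover have "(\<Sum>l\<le>n. real (n choose l) *
            ((S n j \<omega> * H (n - l) j \<omega>) * (h 0 \<omega> * h l \<omega>) + real n * ((S k j \<omega> * H (n - l) j \<omega>) * (h 1 \<omega> * h l \<omega>))))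
          = S n (Suc j) \<omega> * H n (Suc j) \<omega>" for \<omega>
        unfolding rec Hrec sum_distrib_left
        by (rule sum.cong) (simp_all add: h_def algebra_simps)
      ultimately have "has_bochner_integral M (\<lambda>\<omega>. S n (Suc j) \<omega> * H n (Suc j) \<omega>) (c n (Suc j))"
        by simp
      then show ?thesis using sq sqi by simp
    qed
  qed
  show "square_integrable M (S n m)" "square_integrable M (H n m)"
    "has_bochner_integral M (\<lambda>\<omega>. (S n m \<omega>)\<^sup>2) (c n m)"
    "has_bochner_integral M (\<lambda>\<omega>. S n m \<omega> * H n m \<omega>) (c n m)"
    "has_bochner_integral M (\<lambda>\<omega>. (H n m \<omega>)\<^sup>2) (fact n * (real m * r) ^ n)"
    using S[of m n] Hsq[of m n] HH[of m n] by auto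
qed

section \<open>The law of the Brownian motion at a fixed time, and the multiple integrals of box
  kernels\<close>

context brownian_space
begin

lemma increment_distributed:
  "0 < t \<Longrightarrow> t \<le> T \<Longrightarrow> distributed M lborel (\<lambda>\<omega>. B t \<omega> - B 0 \<omega>) (normal_density 0 (sqrt t))"
  using normal_increments[of 0 t] by simp

text \<open>Normality is a property of increments and \<open>B 0\<close> vanishes only almost
  surely, so the law of \<open>B t\<close> is read off from \<open>B t - B 0\<close> outside a null
  set.\<close>

lemma expectation_B:
  fixes p :: "real \<Rightarrow> real"
  assumes t: "0 < t" "t \<le> T" and p: "p \<in> borel_measurable borel"
    and i: "has_bochner_integral std_normal_distribution (\<lambda>x. p (sqrt t * x)) c"
  shows "has_bochner_integral M (\<lambda>\<omega>. p (B t \<omega>)) c"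
proof -
  have "has_bochner_integral M (\<lambda>\<omega>. p (B t \<omega> - B 0 \<omega>)) c"
    by (rule normal_has_expectation[OF increment_distributed[OF t] _ p i]) (use t in simp)
  moreover have "AE \<omega> in M. p (B t \<omega> - B 0 \<omega>) = p (B t \<omega>)"
    using start by eventually_elim simp
  moreover have [measurable]: "B t \<in> borel_measurable M" "B 0 \<in> borel_measurable M"
    using t horizon_pos by (auto intro: measurable_B)
  ultimately show ?thesis
    using p by (subst has_bochner_integral_cong_AE[symmetric]) auto
qed

lemma multiple_integral_box_kernel:
  assumes t: "0 < t" "t \<le> T"
  shows "has_multiple_ito_integral M T B n (\<lambda>s. c * box_kernel n t s) (\<lambda>\<omega>. c * hermite t n (B t \<omega>))"
proof -
  define \<tau> where "\<tau> k i = t * real i / real (Suc k)" for k i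
  have inc: "increasing_times T (Suc k) (\<tau> k)" for k
  proof -
    have "\<tau> k i \<le> t" if "i \<le> Suc k" for i
      using that t by (simp add: \<tau>_def divide_le_eq mult_left_mono)
    then show ?thesis
      unfolding increasing_times_def using t
      by (auto simp: \<tau>_def intro!: divide_strict_right_mono mult_strict_left_mono order_trans[OF _ t(2)])
  qed
  define X where "X k i \<omega> = B (\<tau> k (Suc i)) \<omega> - B (\<tau> k i) \<omega>" for k i \<omega>
  have ind: "indep_vars (\<lambda>_. borel) (X k) {..<Suc k}" for k
    unfolding X_def[abs_def] by (rule indep_increments[OF inc])
  have diff: "\<tau> k (Suc i) - \<tau> k i = t / real (Suc k)" for k i
    by (simp add: \<tau>_def algebra_simps flip: diff_divide_distrib)
  have dist: "distributed M lborel (X k i) (normal_density 0 (sqrt (t / real (Suc k))))" if "i < Suc k" for k i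
    unfolding X_def diff[symmetric, of k i]
    using inc[of k] that unfolding increasing_times_def by (intro normal_increments) auto
  have r: "0 < t / real (Suc k)" for k using t by simp
  have sumX: "(\<Sum>i<Suc k. X k i \<omega>) = B t \<omega> - B 0 \<omega>" for k \<omega>
    unfolding X_def sum_lessThan_telescope[of "\<lambda>i. B (\<tau> k i) \<omega>"] by (simp add: \<tau>_def)
  have mr: "real (Suc k) * (t / real (Suc k)) = t" for k by simp
  let ?S = "\<lambda>k \<omega>. inj_sum n {..<Suc k} (\<lambda>i. X k i \<omega>)"
  let ?H = "\<lambda>\<omega>. hermite t n (B t \<omega> - B 0 \<omega>)"
  let ?c = "\<lambda>k. fact n * (fact n * real (Suc k choose n) * (t / real (Suc k)) ^ n)"
  note E = inj_sum_hermite_expectation[OF ind r dist, unfolded sumX mr]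
  have "L2_tendsto M ?S ?H"
    unfolding L2_tendsto_def
  proof (intro conjI allI)
    show "square_integrable M (?S k)" for k by (rule E(1))
    show "square_integrable M ?H" by (rule E(2))
    \<comment> \<open>The mixed moment equals the second moment of the step integral, so the error
      is \<open>fact n\<close> times the volume of ]0, t]^n not covered by off-diagonal
      boxes.\<close>
    have "(\<integral>\<omega>. (?S k \<omega> - ?H \<omega>)\<^sup>2 \<partial>M) = fact n * t ^ n - ?c k" for k
    proof -
      have "has_bochner_integral M (\<lambda>\<omega>. (?S k \<omega>)\<^sup>2 - 2 * (?S k \<omega> * ?H \<omega>) + (?H \<omega>)\<^sup>2)
          (?c k - 2 * ?c k + fact n * t ^ n)"
        by (intro has_bochner_integral_add has_bochner_integral_diff has_bochner_integral_mult_right E)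
      then have "has_bochner_integral M (\<lambda>\<omega>. (?S k \<omega> - ?H \<omega>)\<^sup>2) (fact n * t ^ n - ?c k)"
        by (simp add: power2_diff algebra_simps)
      then show ?thesis by (rule has_bochner_integral_integral_eq)
    qed
    moreover have "(\<lambda>k. fact n * t ^ n - ?c k) \<longlonglongrightarrow> fact n * t ^ n - fact n * t ^ n"
      by (intro tendsto_diff tendsto_const tendsto_mult_left tendsto_inj_count)
    ultimately show "(\<lambda>k. \<integral>\<omega>. (?S k \<omega> - ?H \<omega>)\<^sup>2 \<partial>M) \<longlonglongrightarrow> 0" by simp
  qed
  then have "L2_tendsto M ?S (\<lambda>\<omega>. hermite t n (B t \<omega>))"
  proof (rule L2_tendsto_cong_AE)
    show "(\<lambda>\<omega>. hermite t n (B t \<omega>)) \<in> borel_measurable M"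
      by (intro measurable_compose[OF _ measurable_hermite] measurable_B) (use t in auto)
    show "AE \<omega> in M. hermite t n (B t \<omega> - B 0 \<omega>) = hermite t n (B t \<omega>)"
      using start by eventually_elim simp
  qed
  then have "L2_tendsto M (\<lambda>k. step_integral B n (Suc k) (\<tau> k) (\<lambda>_. c)) (\<lambda>\<omega>. c * hermite t n (B t \<omega>))"
    unfolding step_integral_const[abs_def] X_def by (rule L2_tendsto_cmult)
  moreover have "L2_tendsto (cube T n) (\<lambda>k. step_kernel n (Suc k) (\<tau> k) (\<lambda>_. c)) (\<lambda>s. c * box_kernel n t s)"
    unfolding step_kernel_cmult[abs_def, of _ _ _ c] \<tau>_def by (intro L2_tendsto_cmult step_kernel_tendsto t)
  ultimately show ?thesis
    unfolding has_multiple_ito_integral_def using inc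
    by (intro exI[of _ Suc] exI[of _ \<tau>] exI[of _ "\<lambda>_ _. c"]) auto
qed

end

section \<open>Hermite coefficients of translates\<close>

text \<open>For bounded continuous \<open>F\<close> this is the n-th derivative at \<open>y\<close>
  of \<open>F\<close> averaged over a standard normal shift, with all derivatives moved onto the
  Gaussian density.\<close>

definition hermite_smooth :: "(real \<Rightarrow> real) \<Rightarrow> nat \<Rightarrow> real \<Rightarrow> real" where
  "hermite_smooth F n y = hermite_coeff (\<lambda>z. F (y + z)) n"

definition smooth_coeff :: "(real \<Rightarrow> real) \<Rightarrow> nat \<Rightarrow> real" where
  "smooth_coeff F n = hermite_coeff (hermite_smooth F 0) n"

context
  fixes F :: "real \<Rightarrow> real" and K :: real
  assumes F: "continuous_on UNIV F" "\<And>x. \<bar>F x\<bar> \<le> K"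
begin

lemma translate_continuous: "continuous_on UNIV (\<lambda>z. F (y + z))"
  by (intro continuous_on_compose2[OF F(1)] continuous_intros) auto

lemma translate_L2: "L2_normal (\<lambda>z. F (y + z))"
  by (intro exp_growth_square_integrable exp_growth_bounded[OF translate_continuous F(2)])

lemma translate_square_le: "(\<integral>z. (F (y + z))\<^sup>2 \<partial>std_normal_distribution) \<le> K\<^sup>2"
proof -
  have "(\<integral>z. (F (y + z))\<^sup>2 \<partial>std_normal_distribution) \<le> (\<integral>z. K\<^sup>2 \<partial>std_normal_distribution)"
  proof (rule integral_mono)
    show "integrable std_normal_distribution (\<lambda>z. (F (y + z))\<^sup>2)"
      using translate_L2 by (simp add: square_integrable_def)
    show "(F (y + z))\<^sup>2 \<le> K\<^sup>2" for z
      using abs_le_square_iff[of "F (y + z)" K] F(2)[of "y + z"] by simp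
  qed simp
  then show ?thesis using std_normal.prob_space by simp
qed

text \<open>The bound does not depend on \<open>y\<close>. It can therefore be integrated over
  \<open>y\<close> for the weighted norm, and it dominates the partial sums of the anti-Wick
  series.\<close>

lemma hermite_smooth_bessel: "(\<Sum>n\<le>N. (hermite_smooth F n y)\<^sup>2 / fact n) \<le> K\<^sup>2"
  unfolding hermite_smooth_def
  using hermite_bessel[OF translate_L2, where N=N] translate_square_le by (rule order_trans)

lemma hermite_smooth_bounded: "\<bar>hermite_smooth F n y\<bar> \<le> sqrt (K\<^sup>2 * fact n)"
proof -
  have "(hermite_smooth F n y)\<^sup>2 / fact n \<le> (\<Sum>m\<le>n. (hermite_smooth F m y)\<^sup>2 / fact m)"
    by (rule member_le_sum) auto
  then have "(hermite_smooth F n y)\<^sup>2 / fact n \<le> K\<^sup>2"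
    using hermite_smooth_bessel order_trans by blast
  then have "(hermite_smooth F n y)\<^sup>2 \<le> K\<^sup>2 * fact n"
    by (simp add: divide_le_eq)
  then show ?thesis
    using real_le_rsqrt real_sqrt_abs real_sqrt_le_iff by metis
qed

text \<open>Together with boundedness this lets the completeness theorem be applied to
  \<open>hermite_smooth F n\<close> itself, which gives the convergence of the derivative
  series.\<close>

lemma hermite_smooth_continuous: "continuous_on UNIV (hermite_smooth F n)"
proof -
  have "(hermite_smooth F n \<longlongrightarrow> hermite_smooth F n y) (at y)" for y
    unfolding tendsto_at_iff_sequentially
  proof (intro allI impI)
    fix s :: "nat \<Rightarrow> real" assume s: "\<forall>i. s i \<in> UNIV - {y}" "s \<longlonglongrightarrow> y"
    have "(\<lambda>i. \<integral>z. F (s i + z) * hermite 1 n z \<partial>std_normal_distribution)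
      \<longlonglongrightarrow> (\<integral>z. F (y + z) * hermite 1 n z \<partial>std_normal_distribution)"
    proof (rule integral_dominated_convergence)
      have gz: "exp_growth (\<lambda>z. F (x + z) * hermite 1 n z)" for x
        by (intro exp_growth_mult exp_growth_hermite exp_growth_bounded[OF translate_continuous F(2)])
      show "(\<lambda>z. F (y + z) * hermite 1 n z) \<in> borel_measurable std_normal_distribution"
        "(\<lambda>z. F (s i + z) * hermite 1 n z) \<in> borel_measurable std_normal_distribution" for i
        using exp_growth_measurable[OF gz] by auto
      show "integrable std_normal_distribution (\<lambda>z. K * \<bar>hermite 1 n z\<bar>)"
        by (intro integrable_mult_right integrable_abs exp_growth_integrable exp_growth_hermite)
      show "AE z in std_normal_distribution. norm (F (s i + z) * hermite 1 n z) \<le> K * \<bar>hermite 1 n z\<bar>" for i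
        using F(2) by (auto simp: abs_mult intro!: mult_right_mono)
      show "AE z in std_normal_distribution. (\<lambda>i. F (s i + z) * hermite 1 n z) \<longlonglongrightarrow> F (y + z) * hermite 1 n z"
      proof (intro always_eventually allI tendsto_mult tendsto_const)
        fix z
        have "isCont F (y + z)" using F(1) by (simp add: continuous_on_eq_continuous_at)
        then show "(\<lambda>i. F (s i + z)) \<longlonglongrightarrow> F (y + z)"
          by (rule isCont_tendsto_compose) (intro tendsto_add tendsto_const s)
      qed
    qed
    then show "(hermite_smooth F n \<circ> s) \<longlonglongrightarrow> hermite_smooth F n y"
      by (simp add: hermite_smooth_def hermite_coeff_def comp_def)
  qed
  then show ?thesis by (simp add: continuous_on_def)
qed

lemma hermite_smooth_L2: "L2_normal (hermite_smooth F n)"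
  by (intro exp_growth_square_integrable
      exp_growth_bounded[OF hermite_smooth_continuous hermite_smooth_bounded])

text \<open>Fubini turns the double expectation into an integral of \<open>F\<close> against a convolution, in which
  integration by parts moves a derivative of the Gaussian density from one factor to the other.\<close>

lemma hermite_coeff_smooth_convolution:
  "hermite_coeff (hermite_smooth F n) k =
    (\<integral>s. F s * (\<integral>y. hermite 1 n (s - y) * std_normal_density (s - y) * hermite 1 k y \<partial>std_normal_distribution) \<partial>lborel)"
proof -
  let ?\<phi> = std_normal_density
  have [measurable]: "F \<in> borel_measurable borel" using F(1) by (rule borel_measurable_continuous_onI)
  have gz: "exp_growth (\<lambda>z. F (y + z) * hermite 1 n z)" for y
    by (intro exp_growth_mult exp_growth_hermite exp_growth_bounded[OF translate_continuous F(2)])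
  let ?h = "\<lambda>y s. ?\<phi> y * hermite 1 k y * (F s * (hermite 1 n (s - y) * ?\<phi> (s - y)))"
  have shift: "integrable lborel (\<lambda>s. F s * (hermite 1 n (s - y) * ?\<phi> (s - y)))"
    "(\<integral>s. F s * (hermite 1 n (s - y) * ?\<phi> (s - y)) \<partial>lborel) = hermite_smooth F n y" for y
  proof -
    have i: "integrable lborel (\<lambda>z. F (y + 1 * z) * (hermite 1 n ((y + 1 * z) - y) * ?\<phi> ((y + 1 * z) - y)))"
      using exp_growth_integrable_lborel[OF gz[of y]] by (simp add: mult_ac)
    then show "integrable lborel (\<lambda>s. F s * (hermite 1 n (s - y) * ?\<phi> (s - y)))"
      by (subst (asm) lborel_integrable_real_affine_iff) auto
    have "(\<integral>s. F s * (hermite 1 n (s - y) * ?\<phi> (s - y)) \<partial>lborel)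
      = (\<integral>z. F (y + 1 * z) * (hermite 1 n ((y + 1 * z) - y) * ?\<phi> ((y + 1 * z) - y)) \<partial>lborel)"
      by (subst lborel_integral_real_affine[where t=y and c=1]) auto
    also have "\<dots> = hermite_smooth F n y"
      unfolding hermite_smooth_def hermite_coeff_def
      by (subst integral_std_normal) (auto intro: exp_growth_measurable[OF gz] simp: mult_ac)
    finally show "(\<integral>s. F s * (hermite 1 n (s - y) * ?\<phi> (s - y)) \<partial>lborel) = hermite_smooth F n y" .
  qed
  \<comment> \<open>The Gaussian L^1 norm of the Hermite polynomial: \<open>K * C\<close> bounds the
    inner integral uniformly in \<open>y\<close>, which makes the iterated integral finite.\<close>
  define C where "C = (\<integral>z. ?\<phi> z * \<bar>hermite 1 n z\<bar> \<partial>lborel)"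
  have C: "(\<integral>s. \<bar>F s * (hermite 1 n (s - y) * ?\<phi> (s - y))\<bar> \<partial>lborel) \<le> K * C" for y
  proof -
    have "(\<integral>s. \<bar>F s * (hermite 1 n (s - y) * ?\<phi> (s - y))\<bar> \<partial>lborel)
      = (\<integral>z. \<bar>F (y + 1 * z) * (hermite 1 n ((y + 1 * z) - y) * ?\<phi> ((y + 1 * z) - y))\<bar> \<partial>lborel)"
      by (subst lborel_integral_real_affine[where t=y and c=1]) auto
    also have "\<dots> \<le> (\<integral>z. K * (?\<phi> z * \<bar>hermite 1 n z\<bar>) \<partial>lborel)"
    proof (rule integral_mono)
      have "integrable lborel (\<lambda>z. \<bar>?\<phi> z * (F (y + z) * hermite 1 n z)\<bar>)"
        by (intro integrable_abs exp_growth_integrable_lborel gz)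
      then show "integrable lborel (\<lambda>z. \<bar>F (y + 1 * z) * (hermite 1 n ((y + 1 * z) - y) * ?\<phi> ((y + 1 * z) - y))\<bar>)"
        by (simp add: mult_ac)
      have "integrable lborel (\<lambda>z. \<bar>?\<phi> z * hermite 1 n z\<bar>)"
        by (intro integrable_abs exp_growth_integrable_lborel exp_growth_hermite)
      then show "integrable lborel (\<lambda>z. K * (?\<phi> z * \<bar>hermite 1 n z\<bar>))"
        by (intro integrable_mult_right) (simp add: abs_mult)
      show "\<bar>F (y + 1 * z) * (hermite 1 n ((y + 1 * z) - y) * ?\<phi> ((y + 1 * z) - y))\<bar> \<le> K * (?\<phi> z * \<bar>hermite 1 n z\<bar>)" for z
        using mult_right_mono[OF F(2)[of "y + z"], of "?\<phi> z * \<bar>hermite 1 n z\<bar>"]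
        by (simp add: abs_mult mult_ac)
    qed
    finally show ?thesis by (simp add: C_def)
  qed
  have meas: "case_prod ?h \<in> borel_measurable (lborel \<Otimes>\<^sub>M lborel)" by measurable
  have int: "integrable (lborel \<Otimes>\<^sub>M lborel) (case_prod ?h)"
  proof (rule lborel_pair.Fubini_integrable[OF meas])
    show "AE y in lborel. integrable lborel (\<lambda>s. case (y, s) of (y, s) \<Rightarrow> ?h y s)"
      using shift(1) by simp
    show "integrable lborel (\<lambda>y. \<integral>s. norm (case (y, s) of (y, s) \<Rightarrow> ?h y s) \<partial>lborel)"
    proof (rule Bochner_Integration.integrable_bound)
      show "integrable lborel (\<lambda>y. K * C * (?\<phi> y * hermite 1 k y))"
        by (intro integrable_mult_right exp_growth_integrable_lborel exp_growth_hermite)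
      show "(\<lambda>y. \<integral>s. norm (case (y, s) of (y, s) \<Rightarrow> ?h y s) \<partial>lborel) \<in> borel_measurable lborel"
        using meas by measurable
      show "AE y in lborel. norm (\<integral>s. norm (case (y, s) of (y, s) \<Rightarrow> ?h y s) \<partial>lborel) \<le> norm (K * C * (?\<phi> y * hermite 1 k y))"
      proof (intro always_eventually allI)
        fix y
        have "(\<integral>s. norm (case (y, s) of (y, s) \<Rightarrow> ?h y s) \<partial>lborel)
          = \<bar>?\<phi> y * hermite 1 k y\<bar> * (\<integral>s. \<bar>F s * (hermite 1 n (s - y) * ?\<phi> (s - y))\<bar> \<partial>lborel)"
          unfolding case_prod_conv real_norm_def abs_mult[of "?\<phi> y * hermite 1 k y"] by simp
        also have "\<dots> \<le> \<bar>?\<phi> y * hermite 1 k y\<bar> * (K * C)"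
          by (intro mult_left_mono C) simp
        also have "\<dots> \<le> norm (K * C * (?\<phi> y * hermite 1 k y))"
          unfolding real_norm_def abs_mult[of "K * C"]
          by (subst mult.commute) (intro mult_right_mono, auto)
        finally show "norm (\<integral>s. norm (case (y, s) of (y, s) \<Rightarrow> ?h y s) \<partial>lborel) \<le> norm (K * C * (?\<phi> y * hermite 1 k y))"
          by simp
      qed
    qed
  qed
  have "hermite_coeff (hermite_smooth F n) k = (\<integral>y. ?\<phi> y * (hermite_smooth F n y * hermite 1 k y) \<partial>lborel)"
    unfolding hermite_coeff_def
    by (intro integral_std_normal exp_growth_measurable exp_growth_mult exp_growth_hermite
        exp_growth_bounded[OF hermite_smooth_continuous hermite_smooth_bounded])
  also have "\<dots> = (\<integral>y. (\<integral>s. ?h y s \<partial>lborel) \<partial>lborel)"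
  proof (rule Bochner_Integration.integral_cong[OF refl])
    fix y
    have "(\<integral>s. ?h y s \<partial>lborel) = ?\<phi> y * hermite 1 k y * hermite_smooth F n y"
      unfolding integral_mult_right_zero shift(2) ..
    then show "?\<phi> y * (hermite_smooth F n y * hermite 1 k y) = (\<integral>s. ?h y s \<partial>lborel)"
      by (simp only: mult_ac)
  qed
  also have "\<dots> = (\<integral>s. (\<integral>y. ?h y s \<partial>lborel) \<partial>lborel)"
    by (rule lborel_pair.Fubini_integral[OF int, symmetric])
  also have "\<dots> = (\<integral>s. F s * (\<integral>y. hermite 1 n (s - y) * ?\<phi> (s - y) * hermite 1 k y \<partial>std_normal_distribution) \<partial>lborel)"
  proof (rule Bochner_Integration.integral_cong[OF refl])
    fix s
    have "(\<integral>y. ?h y s \<partial>lborel) = (\<integral>y. F s * (?\<phi> y * (hermite 1 n (s - y) * ?\<phi> (s - y) * hermite 1 k y)) \<partial>lborel)"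
      by (simp add: mult_ac)
    also have "\<dots> = F s * (\<integral>y. ?\<phi> y * (hermite 1 n (s - y) * ?\<phi> (s - y) * hermite 1 k y) \<partial>lborel)"
      by simp
    also have "(\<integral>y. ?\<phi> y * (hermite 1 n (s - y) * ?\<phi> (s - y) * hermite 1 k y) \<partial>lborel)
       = (\<integral>y. hermite 1 n (s - y) * ?\<phi> (s - y) * hermite 1 k y \<partial>std_normal_distribution)"
      by (rule integral_std_normal[symmetric]) measurable
    finally show "(\<integral>y. ?h y s \<partial>lborel) = F s * (\<integral>y. hermite 1 n (s - y) * ?\<phi> (s - y) * hermite 1 k y \<partial>std_normal_distribution)" .
  qed
  finally show ?thesis .
qed

text \<open>The derivative of the Hermite polynomial times the density raises the index with a minus
  sign, which the inner derivative of s - y cancels. Stein's identity in \<open>y\<close> thus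
  exchanges a raised index at s - y for a raised index at y, for every \<open>s\<close>.\<close>

lemma hermite_coeff_smooth_Suc:
  "hermite_coeff (hermite_smooth F (Suc n)) k = hermite_coeff (hermite_smooth F n) (Suc k)"
proof -
  let ?\<phi> = std_normal_density
  have d: "((\<lambda>x. hermite 1 n x * ?\<phi> x) has_real_derivative - (hermite 1 (Suc n) x * ?\<phi> x)) (at x)" for x
  proof -
    have "((\<lambda>x. hermite 1 n x * ?\<phi> x) has_real_derivative
        real n * hermite 1 (n - 1) x * ?\<phi> x + (- x * ?\<phi> x) * hermite 1 n x) (at x)"
      by (intro DERIV_mult hermite_deriv std_normal_density_deriv)
    moreover have "real n * hermite 1 (n - 1) x * ?\<phi> x + (- x * ?\<phi> x) * hermite 1 n x
        = - (hermite 1 (Suc n) x * ?\<phi> x)"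
    proof -
      have "(x * hermite 1 n x) * ?\<phi> x = (hermite 1 (Suc n) x + 1 * real n * hermite 1 (n - 1) x) * ?\<phi> x"
        by (simp only: hermite_mult_x)
      then show ?thesis by (simp only: algebra_simps mult_1_left)
    qed
    ultimately show ?thesis by simp
  qed
  have g\<phi>: "exp_growth ?\<phi>"
  proof (rule exp_growth_bounded[where K=1])
    show "continuous_on UNIV ?\<phi>"
      unfolding std_normal_density_def by (intro continuous_intros) auto
    have "1 \<le> sqrt (2 * pi)" using pi_gt3 by simp
    then show "\<bar>?\<phi> x\<bar> \<le> 1" for x
      unfolding std_normal_density_def abs_mult by (intro mult_le_one) auto
  qed
  have g: "exp_growth (\<lambda>y. hermite 1 m (s - y) * ?\<phi> (s - y))" for m s
    using exp_growth_affine[OF exp_growth_mult[OF exp_growth_hermite g\<phi>], of 1 m s "-1"] by simp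
  have "(\<integral>y. hermite 1 (Suc n) (s - y) * ?\<phi> (s - y) * hermite 1 k y \<partial>std_normal_distribution)
    = (\<integral>y. hermite 1 n (s - y) * ?\<phi> (s - y) * hermite 1 (Suc k) y \<partial>std_normal_distribution)" for s
  proof (rule std_normal_stein[symmetric, OF g g])
    fix y
    have "((\<lambda>y. (\<lambda>x. hermite 1 n x * ?\<phi> x) (s - y)) has_real_derivative
        - (hermite 1 (Suc n) (s - y) * ?\<phi> (s - y)) * (- 1)) (at y)"
      by (rule DERIV_chain2[OF d]) (auto intro!: derivative_eq_intros)
    then show "((\<lambda>y. hermite 1 n (s - y) * ?\<phi> (s - y)) has_real_derivative
        hermite 1 (Suc n) (s - y) * ?\<phi> (s - y)) (at y)"
      by (simp del: hermite.simps)
  qed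
  then show ?thesis unfolding hermite_coeff_smooth_convolution by (simp only:)
qed

text \<open>Only the total order matters; so the chaos coefficients from order n on are, up to
  factorials and scaling, the Hermite coefficients of the n-th derivative.\<close>

lemma hermite_coeff_smooth: "hermite_coeff (hermite_smooth F n) k = smooth_coeff F (n + k)"
proof (induction n arbitrary: k)
  case (Suc n)
  then show ?case by (simp only: hermite_coeff_smooth_Suc add_Suc add_Suc_right)
qed (simp add: smooth_coeff_def)

text \<open>Bessel's inequality in both variables; the factor \<open>2\<^sup>m\<close> is the sum of the binomial
  coefficients over the pairs with \<open>n + k = m\<close>.\<close>

lemma smooth_coeff_summable: "summable (\<lambda>m. 2 ^ m * (smooth_coeff F m)\<^sup>2 / fact m)"
proof (rule summableI_nonneg_bounded)
  fix N
  let ?A = "\<lambda>n k. (smooth_coeff F (n + k))\<^sup>2 / (fact n * fact k)"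
  have "2 ^ m * (smooth_coeff F m)\<^sup>2 / fact m = (\<Sum>n\<le>m. ?A n (m - n))" for m
  proof -
    have "(2::real) ^ m = (\<Sum>n\<le>m. real (m choose n))"
      using choose_row_sum[of m] by (metis of_nat_numeral of_nat_power of_nat_sum)
    also have "\<dots> = (\<Sum>n\<le>m. fact m / (fact n * fact (m - n)))"
      by (intro sum.cong) (auto simp: binomial_fact)
    finally have "2 ^ m * ((smooth_coeff F m)\<^sup>2 / fact m)
      = (\<Sum>n\<le>m. fact m / (fact n * fact (m - n)) * ((smooth_coeff F m)\<^sup>2 / fact m))"
      by (simp only: sum_distrib_right)
    also have "\<dots> = (\<Sum>n\<le>m. ?A n (m - n))"
      by (intro sum.cong) auto
    finally show ?thesis by simp
  qed
  then have "(\<Sum>m\<le>N. 2 ^ m * (smooth_coeff F m)\<^sup>2 / fact m) = (\<Sum>(n, k)\<in>{(n, k). n + k \<le> N}. ?A n k)"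
    by (simp add: sum.triangle_reindex_eq)
  \<comment> \<open>The triangle is enlarged to a square so that Bessel's inequality can be applied
    first in k for fixed n, and afterwards, under the integral over y, in n.\<close>
  also have "\<dots> \<le> (\<Sum>(n, k)\<in>{..N} \<times> {..N}. ?A n k)"
    by (intro sum_mono2) auto
  also have "\<dots> = (\<Sum>n\<le>N. (\<Sum>k\<le>N. (hermite_coeff (hermite_smooth F n) k)\<^sup>2 / fact k) / fact n)"
    unfolding hermite_coeff_smooth sum.cartesian_product[symmetric]
    by (simp add: sum_divide_distrib mult.commute)
  also have "\<dots> \<le> (\<Sum>n\<le>N. (\<integral>y. (hermite_smooth F n y)\<^sup>2 \<partial>std_normal_distribution) / fact n)"
    by (intro sum_mono divide_right_mono hermite_bessel hermite_smooth_L2) auto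
  also have "\<dots> = (\<integral>y. (\<Sum>n\<le>N. (hermite_smooth F n y)\<^sup>2 / fact n) \<partial>std_normal_distribution)"
    using hermite_smooth_L2
    by (subst Bochner_Integration.integral_sum) (auto simp: square_integrable_def)
  also have "\<dots> \<le> (\<integral>y. K\<^sup>2 \<partial>std_normal_distribution)"
    using hermite_smooth_L2 hermite_smooth_bessel
    by (intro integral_mono Bochner_Integration.integrable_sum)
       (auto simp: square_integrable_def)
  also have "\<dots> = K\<^sup>2" using std_normal.prob_space by simp
  finally have le: "(\<Sum>m\<le>N. 2 ^ m * (smooth_coeff F m)\<^sup>2 / fact m) \<le> K\<^sup>2" .
  have "(\<Sum>m<N. 2 ^ m * (smooth_coeff F m)\<^sup>2 / fact m) \<le> (\<Sum>m\<le>N. 2 ^ m * (smooth_coeff F m)\<^sup>2 / fact m)"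
    by (intro sum_mono2) auto
  then show "(\<Sum>m<N. 2 ^ m * (smooth_coeff F m)\<^sup>2 / fact m) \<le> K\<^sup>2"
    using le by (rule order_trans)
qed simp

end

section \<open>Chaos expansion of functions of Brownian motion\<close>

lemma heat_flow_smooth:
  "0 \<le> t \<Longrightarrow> heat_flow t f (sqrt t * y) = hermite_smooth (\<lambda>s. f (sqrt t * s)) 0 y"
  by (simp add: heat_flow_def hermite_smooth_def hermite_coeff_def distrib_left)

lemma prod_lessThan_add:
  fixes a b :: nat
  shows "(\<Prod>j<a + b. g j) = (\<Prod>j<a. g j) * (\<Prod>j<b. g (a + j) :: real)"
  by (induction b) (simp_all add: mult.assoc)

text \<open>Box kernels are products over the coordinates, so freezing the last k of them leaves a
  constant times a box kernel of lower order, whose multiple integral is known.\<close>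

lemma kernel_slice_box:
  assumes "k \<le> n"
  shows "kernel_slice n k (\<lambda>s. c * box_kernel n t s) s s' = (c * box_kernel k t s) * box_kernel (n - k) t s'"
proof -
  have "box_kernel n t (\<lambda>i\<in>{..<n}. if i < n - k then s' i else s (i - (n - k)))
    = (\<Prod>j<(n - k) + k. indicator {0<..t} (if j < n - k then s' j else s (j - (n - k))))"
    unfolding box_kernel_def using assms by (intro prod.cong) auto
  also have "\<dots> = box_kernel (n - k) t s' * box_kernel k t s"
    unfolding prod_lessThan_add box_kernel_def by simp
  finally show ?thesis by (simp add: kernel_slice_def)
qed

lemma box_kernel_symmetric: "symmetric_kernel T n (\<lambda>s. c * box_kernel n t s)"
  unfolding symmetric_kernel_def
proof (intro allI impI always_eventually)
  fix p s assume "p permutes {..<n}"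
  then show "c * box_kernel n t (s \<circ> p) = c * box_kernel n t s"
    using prod.permute[of p "{..<n}" "\<lambda>j. indicator {0<..t} (s j) :: real"]
    by (simp add: box_kernel_def comp_def)
qed

lemma falling_factorial: "(\<Prod>i<k. real (k + l - i)) = fact (k + l) / fact l"
proof (induction k)
  case (Suc k)
  have "(\<Prod>i<Suc k. real (Suc k + l - i)) = real (Suc k + l) * (\<Prod>i<k. real (k + l - i))"
    by (subst prod.lessThan_Suc_shift) simp
  then show ?case unfolding Suc by simp
qed simp

context brownian_space
begin

lemma has_chaos_expansion_cong_AE:
  assumes "has_chaos_expansion M T B X h" "Y \<in> borel_measurable M" "AE \<omega> in M. X \<omega> = Y \<omega>"
  shows "has_chaos_expansion M T B Y h"
  using assms L2_tendsto_cong_AE unfolding has_chaos_expansion_def by blast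

lemma L2_tendsto_B:
  assumes t: "0 < t" "t \<le> T"
    and p: "\<And>N. p N \<in> borel_measurable borel" "q \<in> borel_measurable borel"
    and L: "\<And>N. L2_normal (\<lambda>y. p N (sqrt t * y))" "L2_normal (\<lambda>y. q (sqrt t * y))"
    and lim: "(\<lambda>N. \<integral>y. (p N (sqrt t * y) - q (sqrt t * y))\<^sup>2 \<partial>std_normal_distribution) \<longlonglongrightarrow> 0"
  shows "L2_tendsto M (\<lambda>N \<omega>. p N (B t \<omega>)) (\<lambda>\<omega>. q (B t \<omega>))"
proof -
  have B: "B t \<in> borel_measurable M" using t by (intro measurable_B) auto
  have sq: "square_integrable M (\<lambda>\<omega>. g (B t \<omega>))"
    "(\<integral>\<omega>. (g (B t \<omega>))\<^sup>2 \<partial>M) = (\<integral>y. (g (sqrt t * y))\<^sup>2 \<partial>std_normal_distribution)"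
    if g: "g \<in> borel_measurable borel" "L2_normal (\<lambda>y. g (sqrt t * y))" for g
  proof -
    have "has_bochner_integral M (\<lambda>\<omega>. (g (B t \<omega>))\<^sup>2) (\<integral>y. (g (sqrt t * y))\<^sup>2 \<partial>std_normal_distribution)"
      by (rule expectation_B[OF t, where p="\<lambda>x. (g x)\<^sup>2"])
         (use g in \<open>auto simp: square_integrable_def has_bochner_integral_iff\<close>)
    then show "square_integrable M (\<lambda>\<omega>. g (B t \<omega>))"
      "(\<integral>\<omega>. (g (B t \<omega>))\<^sup>2 \<partial>M) = (\<integral>y. (g (sqrt t * y))\<^sup>2 \<partial>std_normal_distribution)"
      using measurable_compose[OF B g(1)] by (auto simp: square_integrable_def has_bochner_integral_iff)
  qed
  have "(\<integral>\<omega>. (p N (B t \<omega>) - q (B t \<omega>))\<^sup>2 \<partial>M)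
      = (\<integral>y. (p N (sqrt t * y) - q (sqrt t * y))\<^sup>2 \<partial>std_normal_distribution)" for N
    by (rule sq(2)[of "\<lambda>x. p N x - q x"])
       (use p L in \<open>auto intro: square_integrable_diff borel_measurable_diff\<close>)
  then show ?thesis
    unfolding L2_tendsto_def using sq(1) p L lim by simp
qed

text \<open>\<open>hermite_smooth F k (x / sqrt t) / sqrt t ^ k\<close> is the \<open>k\<close>-th derivative of the heat flow of
  \<open>f\<close> at \<open>x\<close>, and \<open>smooth_coeff F n / (n! sqrt t ^ n)\<close> the constant value of the \<open>n\<close>-th chaos kernel
  on \<open>]0, t]\<^sup>n\<close>.\<close>

context
  fixes t :: real and f :: "real \<Rightarrow> real" and K :: real and F :: "real \<Rightarrow> real"
    and kern :: "nat \<Rightarrow> (nat \<Rightarrow> real) \<Rightarrow> real"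
  assumes t: "0 < t" "t \<le> T"
    and f: "continuous_on UNIV f" "\<And>x. \<bar>f x\<bar> \<le> K"
  defines "F \<equiv> \<lambda>s. f (sqrt t * s)"
    and "kern \<equiv> \<lambda>n s. smooth_coeff F n / (fact n * sqrt t ^ n) * box_kernel n t s"
begin

lemma F_bounded_continuous: "continuous_on UNIV F" "\<bar>F x\<bar> \<le> K"
  unfolding F_def using f(2) by (auto intro!: continuous_on_compose2[OF f(1)] continuous_intros)

lemma derivative_series_tendsto:
  "L2_tendsto M
     (\<lambda>N \<omega>. \<Sum>n=k..N. (\<Prod>i<k. real (n - i)) *
        (smooth_coeff F n / (fact n * sqrt t ^ n) * c * hermite t (n - k) (B t \<omega>)))
     (\<lambda>\<omega>. c * (hermite_smooth F k (B t \<omega> / sqrt t) / sqrt t ^ k))"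
proof (rule L2_tendsto_B[OF t])
  let ?p = "\<lambda>N x. \<Sum>n=k..N. (\<Prod>i<k. real (n - i)) *
        (smooth_coeff F n / (fact n * sqrt t ^ n) * c * hermite t (n - k) x)"
  let ?q = "\<lambda>x. c * (hermite_smooth F k (x / sqrt t) / sqrt t ^ k)"
  note cont = hermite_smooth_continuous[OF F_bounded_continuous, of k]
  have st: "sqrt t \<noteq> 0" "0 \<le> t" using t by auto
  have q: "?q (sqrt t * y) = c / sqrt t ^ k * hermite_smooth F k y" for y
    using st by simp
  show "?p N \<in> borel_measurable borel" for N by measurable
  show "?q \<in> borel_measurable borel"
    using st by (intro borel_measurable_continuous_onI continuous_intros continuous_on_compose2[OF cont]) auto
  show "L2_normal (\<lambda>y. ?q (sqrt t * y))"
    unfolding q by (intro square_integrable_cmult hermite_smooth_L2[OF F_bounded_continuous])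
  show "L2_normal (\<lambda>y. ?p N (sqrt t * y))" for N
    using exp_growth_affine[OF exp_growth_hermite, of _ _ 0 "sqrt t"]
    by (intro square_integrable_sum square_integrable_cmult exp_growth_square_integrable) simp
  \<comment> \<open>The series begins at n = k, so its partial sum up to N + k is the Hermite sum of
    order N; the offset is removed at the end.\<close>
  have p: "?p (N + k) (sqrt t * y) = c / sqrt t ^ k * hermite_sum (hermite_smooth F k) N y" for N y
  proof -
    have "?p (N + k) (sqrt t * y) = (\<Sum>l\<le>N. (\<Prod>i<k. real (k + l - i)) *
        (smooth_coeff F (k + l) / (fact (k + l) * sqrt t ^ (k + l)) * c * hermite t l (sqrt t * y)))"
    proof (rule sum.reindex_bij_witness[of _ "\<lambda>l. k + l" "\<lambda>n. n - k"])
    qed auto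
    also have "\<dots> = (\<Sum>l\<le>N. c / sqrt t ^ k * (hermite_coeff (hermite_smooth F k) l / fact l * hermite 1 l y))"
    proof (rule sum.cong[OF refl])
      fix l
      show "(\<Prod>i<k. real (k + l - i)) *
        (smooth_coeff F (k + l) / (fact (k + l) * sqrt t ^ (k + l)) * c * hermite t l (sqrt t * y))
        = c / sqrt t ^ k * (hermite_coeff (hermite_smooth F k) l / fact l * hermite 1 l y)"
        unfolding falling_factorial hermite_scale_sqrt[OF st(2)]
          hermite_coeff_smooth[OF F_bounded_continuous]
        using st(1) by (simp add: power_add mult_ac)
    qed
    finally show ?thesis by (simp add: hermite_sum_def sum_distrib_left)
  qed
  have "(c / sqrt t ^ k * a - c / sqrt t ^ k * b)\<^sup>2 = (c / sqrt t ^ k)\<^sup>2 * (b - a)\<^sup>2" for a b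
    unfolding right_diff_distrib[symmetric] power_mult_distrib by (simp add: power2_commute)
  then have "(\<integral>y. (?p (N + k) (sqrt t * y) - ?q (sqrt t * y))\<^sup>2 \<partial>std_normal_distribution)
     = (c / sqrt t ^ k)\<^sup>2 * (\<integral>y. (hermite_smooth F k y - hermite_sum (hermite_smooth F k) N y)\<^sup>2 \<partial>std_normal_distribution)" for N
    unfolding p q by simp
  moreover have "(\<lambda>N. (c / sqrt t ^ k)\<^sup>2 *
      (\<integral>y. (hermite_smooth F k y - hermite_sum (hermite_smooth F k) N y)\<^sup>2 \<partial>std_normal_distribution)) \<longlonglongrightarrow> 0"
    using hermite_complete_bounded_continuous[OF cont hermite_smooth_bounded[OF F_bounded_continuous]]
    unfolding hermite_complete_def by (rule tendsto_mult_right_zero)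
  ultimately have "(\<lambda>N. \<integral>y. (?p (N + k) (sqrt t * y) - ?q (sqrt t * y))\<^sup>2 \<partial>std_normal_distribution) \<longlonglongrightarrow> 0"
    by (simp only:)
  then show "(\<lambda>N. \<integral>y. (?p N (sqrt t * y) - ?q (sqrt t * y))\<^sup>2 \<partial>std_normal_distribution) \<longlonglongrightarrow> 0"
    by (rule LIMSEQ_offset)
qed

lemma heat_flow_B: "heat_flow t f (B t \<omega>) = hermite_smooth F 0 (B t \<omega> / sqrt t)"
  using heat_flow_smooth[of t f "B t \<omega> / sqrt t"] t by (simp add: F_def)

lemma heat_flow_chaos: "has_chaos_expansion M T B (\<lambda>\<omega>. heat_flow t f (B t \<omega>)) kern"
proof -
  have "L2_tendsto M (\<lambda>N \<omega>. \<Sum>n\<le>N. smooth_coeff F n / (fact n * sqrt t ^ n) * hermite t n (B t \<omega>))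
     (\<lambda>\<omega>. heat_flow t f (B t \<omega>))"
    using derivative_series_tendsto[of 0 1] by (simp add: heat_flow_B atLeast0AtMost)
  then show ?thesis
    unfolding has_chaos_expansion_def kern_def
    using t by (intro conjI allI
        exI[of _ "\<lambda>n \<omega>. smooth_coeff F n / (fact n * sqrt t ^ n) * hermite t n (B t \<omega>)"]
        square_integrable_cmult box_kernel_square_integrable box_kernel_symmetric
        multiple_integral_box_kernel) auto
qed

text \<open>The volume t^n of the box cancels the square of \<open>sqrt t ^ n\<close>, so the
  weighted norms are the terms of \<open>smooth_coeff_summable\<close>.\<close>

lemma heat_flow_kernel_summable:
  "summable (\<lambda>n. fact n * 2 ^ n * (\<integral>s. (kern n s)\<^sup>2 \<partial>cube T n))"
proof -
  have "fact n * 2 ^ n * (\<integral>s. (kern n s)\<^sup>2 \<partial>cube T n) = 2 ^ n * (smooth_coeff F n)\<^sup>2 / fact n" for n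
  proof -
    have "(\<integral>s. (kern n s)\<^sup>2 \<partial>cube T n) = (smooth_coeff F n / (fact n * sqrt t ^ n))\<^sup>2 * t ^ n"
      unfolding kern_def power_mult_distrib box_kernel_idem integral_mult_right_zero
      using has_bochner_integral_integral_eq[OF box_kernel_integral[of t T n]] t by simp
    also have "\<dots> = (smooth_coeff F n)\<^sup>2 / (fact n)\<^sup>2"
    proof -
      have "(sqrt t ^ n)\<^sup>2 = t ^ n" using t by (simp add: power2_eq_square flip: power_mult_distrib)
      then show ?thesis using t by (simp add: power_divide power_mult_distrib)
    qed
    finally show ?thesis by (simp add: power2_eq_square)
  qed
  then show ?thesis using smooth_coeff_summable[OF F_bounded_continuous] by simp
qed

text \<open>Any version \<open>X\<close> is allowed, because at time 0 the variable is only almost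
  surely of this form. The case distinction reflects that the derivative of order 0 has to be
  \<open>X\<close> itself, not a version of it.\<close>

lemma heat_flow_derivative:
  assumes X: "X \<in> borel_measurable M" "AE \<omega> in M. X \<omega> = heat_flow t f (B t \<omega>)"
  shows "X \<in> G_sqrt2 M T B"
    and "has_hida_malliavin_derivative M T B k X
      (if k = 0 then (\<lambda>_. X) else (\<lambda>s \<omega>. box_kernel k t s * (hermite_smooth F k (B t \<omega> / sqrt t) / sqrt t ^ k)))"
proof -
  have X': "AE \<omega> in M. heat_flow t f (B t \<omega>) = X \<omega>" using X(2) by eventually_elim simp
  note chaos = has_chaos_expansion_cong_AE[OF heat_flow_chaos X(1) X']
  show "X \<in> G_sqrt2 M T B"
    unfolding G_sqrt2_def using chaos heat_flow_kernel_summable by blast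
  let ?D = "\<lambda>s \<omega>. box_kernel k t s * (hermite_smooth F k (B t \<omega> / sqrt t) / sqrt t ^ k)"
  have "has_hida_malliavin_derivative M T B k X ?D" if "k \<noteq> 0"
  proof -
    have B: "B t \<in> borel_measurable M" using t by (intro measurable_B) auto
    have [measurable]: "box_kernel k t \<in> borel_measurable (cube T k)" by (rule box_kernel_measurable)
    have [measurable]: "(\<lambda>\<omega>. hermite_smooth F k (B t \<omega> / sqrt t) / sqrt t ^ k) \<in> borel_measurable M"
      using borel_measurable_continuous_onI[OF hermite_smooth_continuous[OF F_bounded_continuous]] B
      by measurable
    have "(\<lambda>(s, \<omega>). ?D s \<omega>) \<in> borel_measurable (cube T k \<Otimes>\<^sub>M M)" by measurable
    moreover have "\<exists>J. (\<forall>n\<ge>k. has_multiple_ito_integral M T B (n - k) (kernel_slice n k (kern n) s) (J n)) \<and>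
        L2_tendsto M (\<lambda>N \<omega>. \<Sum>n=k..N. (\<Prod>i<k. real (n - i)) * J n \<omega>) (?D s)" for s
    proof (intro exI[of _ "\<lambda>n \<omega>. smooth_coeff F n / (fact n * sqrt t ^ n) * box_kernel k t s * hermite t (n - k) (B t \<omega>)"] conjI allI impI)
      fix n assume "k \<le> n"
      then show "has_multiple_ito_integral M T B (n - k) (kernel_slice n k (kern n) s)
        (\<lambda>\<omega>. smooth_coeff F n / (fact n * sqrt t ^ n) * box_kernel k t s * hermite t (n - k) (B t \<omega>))"
        unfolding kern_def kernel_slice_box[OF \<open>k \<le> n\<close>, abs_def] by (intro multiple_integral_box_kernel t)
    qed (rule derivative_series_tendsto)
    ultimately show ?thesis
      unfolding has_hida_malliavin_derivative_def using that chaos by auto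
  qed
  then show "has_hida_malliavin_derivative M T B k X
      (if k = 0 then (\<lambda>_. X) else (\<lambda>s \<omega>. box_kernel k t s * (hermite_smooth F k (B t \<omega> / sqrt t) / sqrt t ^ k)))"
    by (simp add: has_hida_malliavin_derivative_def)
qed

end

text \<open>In the integral over the cube the mass t^n of the squared box kernel cancels the two
  factors \<open>sqrt t ^ n\<close>. What remains is, at each sample point, Parseval's series for
  two translates, bounded by a constant; dominated convergence turns pointwise convergence into
  convergence in L^1.\<close>

lemma anti_wick_heat_flow:
  assumes t: "0 < t" "t \<le> T"
    and f: "continuous_on UNIV f" "\<And>x. \<bar>f x\<bar> \<le> K"
    and g: "continuous_on UNIV g" "\<And>x. \<bar>g x\<bar> \<le> L"
    and X: "X \<in> borel_measurable M" "AE \<omega> in M. X \<omega> = heat_flow t f (B t \<omega>)"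
    and Y: "Y \<in> borel_measurable M" "AE \<omega> in M. Y \<omega> = heat_flow t g (B t \<omega>)"
    and Z: "Z \<in> borel_measurable M" "AE \<omega> in M. Z \<omega> = heat_flow t (\<lambda>x. f x * g x) (B t \<omega>)"
  shows "X \<in> G_sqrt2 M T B \<and> Y \<in> G_sqrt2 M T B \<and> has_anti_wick_product M T B X Y Z"
proof -
  define F where "F s = f (sqrt t * s)" for s
  define G where "G s = g (sqrt t * s)" for s
  have F: "continuous_on UNIV F" "\<And>x. \<bar>F x\<bar> \<le> K" and G: "continuous_on UNIV G" "\<And>x. \<bar>G x\<bar> \<le> L"
    unfolding F_def G_def using f(2) g(2)
    by (auto intro!: continuous_on_compose2[OF f(1)] continuous_on_compose2[OF g(1)] continuous_intros)
  let ?\<Phi> = "\<lambda>n \<omega>. hermite_smooth F n (B t \<omega> / sqrt t)"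
  let ?\<Psi> = "\<lambda>n \<omega>. hermite_smooth G n (B t \<omega> / sqrt t)"
  define DX where "DX n = (if n = 0 then (\<lambda>_. X) else (\<lambda>s \<omega>. box_kernel n t s * (?\<Phi> n \<omega> / sqrt t ^ n)))" for n
  define DY where "DY n = (if n = 0 then (\<lambda>_. Y) else (\<lambda>s \<omega>. box_kernel n t s * (?\<Psi> n \<omega> / sqrt t ^ n)))" for n
  note Xd = heat_flow_derivative[OF t f X, folded F_def] and Yd = heat_flow_derivative[OF t g Y, folded G_def]
  have B [measurable]: "B t \<in> borel_measurable M" using t by (intro measurable_B) auto
  have [measurable]: "X \<in> borel_measurable M" "Y \<in> borel_measurable M" "Z \<in> borel_measurable M"
    using X Y Z by auto
  have [measurable]: "hermite_smooth F n \<in> borel_measurable borel" "hermite_smooth G n \<in> borel_measurable borel" for n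
    by (intro borel_measurable_continuous_onI hermite_smooth_continuous[OF F] hermite_smooth_continuous[OF G])+
  define E where "E N \<omega> = (\<Sum>n\<le>N. 1 / fact n * (\<integral>s. DX n s \<omega> * DY n s \<omega> \<partial>cube T n))" for N \<omega>
  define e where "e N \<omega> = (\<Sum>n\<le>N. ?\<Phi> n \<omega> * ?\<Psi> n \<omega> / fact n)" for N \<omega>
  have int: "(\<integral>s. DX n s \<omega> * DY n s \<omega> \<partial>cube T n) = (if n = 0 then X \<omega> * Y \<omega> else ?\<Phi> n \<omega> * ?\<Psi> n \<omega>)" for n \<omega>
  proof (cases "n = 0")
    case True
    \<comment> \<open>The mass 1 of the zero-dimensional cube is read off from the integral t^0 of
      its box kernel.\<close>
    have "box_kernel 0 t = (\<lambda>_. 1)" by (simp add: fun_eq_iff box_kernel_def)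
    then have "measure (cube T 0) (space (cube T 0)) = 1"
      using has_bochner_integral_integral_eq[OF box_kernel_integral[of t T 0]] t by simp
    then show ?thesis using True by (simp add: DX_def DY_def)
  next
    case False
    have "sqrt t ^ n * sqrt t ^ n = t ^ n" using t by (simp flip: power_mult_distrib)
    then have "DX n s \<omega> * DY n s \<omega> = (?\<Phi> n \<omega> * ?\<Psi> n \<omega> / t ^ n) * (box_kernel n t s)\<^sup>2" for s
      using False by (simp add: DX_def DY_def power2_eq_square mult_ac)
    then have "(\<integral>s. DX n s \<omega> * DY n s \<omega> \<partial>cube T n) = (?\<Phi> n \<omega> * ?\<Psi> n \<omega> / t ^ n) * t ^ n"
      using has_bochner_integral_integral_eq[OF box_kernel_integral[of t T n]] t
      by (simp add: box_kernel_idem)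
    then show ?thesis using t False by simp
  qed
  have Emeas [measurable]: "E N \<in> borel_measurable M" for N
    unfolding E_def[abs_def] int by measurable
  have "AE \<omega> in M. X \<omega> = ?\<Phi> 0 \<omega>" "AE \<omega> in M. Y \<omega> = ?\<Psi> 0 \<omega>"
    using X(2) Y(2) unfolding heat_flow_B[OF t f] heat_flow_B[OF t g] F_def G_def by auto
  \<comment> \<open>Only the term of order 0 is known up to a null set, so one null set serves all
    partial sums.\<close>
  then have Ee: "AE \<omega> in M. \<forall>N. E N \<omega> = e N \<omega>"
  proof eventually_elim
    case (elim \<omega>)
    then have "1 / fact n * (\<integral>s. DX n s \<omega> * DY n s \<omega> \<partial>cube T n) = ?\<Phi> n \<omega> * ?\<Psi> n \<omega> / fact n" for n
      unfolding int by (cases n) auto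
    then show ?case unfolding E_def e_def by simp
  qed
  \<comment> \<open>The inequality |a b| <= (a^2 + b^2) / 2 reduces the mixed sum to the two Bessel
    sums at the same point.\<close>
  have e_le: "\<bar>e N \<omega>\<bar> \<le> (K\<^sup>2 + L\<^sup>2) / 2" for N \<omega>
  proof -
    have ab: "\<bar>a * b\<bar> \<le> (a\<^sup>2 + b\<^sup>2) / 2" for a b :: real
      using sum_squares_bound[of "\<bar>a\<bar>" "\<bar>b\<bar>"] by (simp add: abs_mult)
    have "\<bar>e N \<omega>\<bar> \<le> (\<Sum>n\<le>N. \<bar>?\<Phi> n \<omega> * ?\<Psi> n \<omega> / fact n\<bar>)"
      unfolding e_def by (rule sum_abs)
    also have "\<dots> \<le> (\<Sum>n\<le>N. (((?\<Phi> n \<omega>)\<^sup>2 + (?\<Psi> n \<omega>)\<^sup>2) / 2) / fact n)"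
      unfolding abs_divide abs_of_nonneg[OF fact_ge_zero] by (intro sum_mono divide_right_mono ab) simp
    also have "\<dots> = ((\<Sum>n\<le>N. (?\<Phi> n \<omega>)\<^sup>2 / fact n) + (\<Sum>n\<le>N. (?\<Psi> n \<omega>)\<^sup>2 / fact n)) / 2"
      unfolding sum.distrib[symmetric] sum_divide_distrib
      by (intro sum.cong) (auto simp: add_divide_distrib)
    also have "\<dots> \<le> (K\<^sup>2 + L\<^sup>2) / 2"
      using hermite_smooth_bessel[OF F, of "B t \<omega> / sqrt t" N]
        hermite_smooth_bessel[OF G, of "B t \<omega> / sqrt t" N] by simp
    finally show ?thesis .
  qed
  have e_lim: "(\<lambda>N. e N \<omega>) \<longlonglongrightarrow> heat_flow t (\<lambda>x. f x * g x) (B t \<omega>)" for \<omega>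
  proof -
    let ?y = "B t \<omega> / sqrt t"
    have "(\<lambda>n. ?\<Phi> n \<omega> * ?\<Psi> n \<omega> / fact n) sums (\<integral>z. F (?y + z) * G (?y + z) \<partial>std_normal_distribution)"
      unfolding hermite_smooth_def
      by (rule hermite_parseval_mult[OF translate_continuous[OF F] F(2) translate_continuous[OF G] G(2)])
    moreover have "(\<integral>z. F (?y + z) * G (?y + z) \<partial>std_normal_distribution) = heat_flow t (\<lambda>x. f x * g x) (B t \<omega>)"
      using t by (simp add: heat_flow_def F_def G_def distrib_left)
    ultimately show ?thesis by (simp add: e_def sums_def_le)
  qed
  have Elim: "AE \<omega> in M. (\<lambda>N. E N \<omega>) \<longlonglongrightarrow> Z \<omega>"
    using Ee Z(2) by eventually_elim (use e_lim in simp)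
  have E_le: "AE \<omega> in M. \<bar>E N \<omega>\<bar> \<le> (K\<^sup>2 + L\<^sup>2) / 2" for N
    using Ee by eventually_elim (use e_le in simp)
  have Z_le: "AE \<omega> in M. \<bar>Z \<omega>\<bar> \<le> (K\<^sup>2 + L\<^sup>2) / 2"
    using Z(2)
  proof eventually_elim
    case (elim \<omega>)
    then show ?case
      using LIMSEQ_le_const2[OF tendsto_rabs[OF e_lim[of \<omega>]], of "(K\<^sup>2 + L\<^sup>2) / 2"] e_le by simp
  qed
  have "L1_tendsto M E Z"
    unfolding L1_tendsto_def
  proof (intro conjI allI)
    show "integrable M (E N)" for N
      using E_le by (intro integrable_const_bound[where B="(K\<^sup>2 + L\<^sup>2) / 2"]) auto
    show "integrable M Z"
      using Z_le by (intro integrable_const_bound[where B="(K\<^sup>2 + L\<^sup>2) / 2"]) auto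
    have "(\<lambda>N. \<integral>\<omega>. \<bar>E N \<omega> - Z \<omega>\<bar> \<partial>M) \<longlonglongrightarrow> (\<integral>\<omega>. 0 \<partial>M)"
    proof (rule integral_dominated_convergence)
      show "integrable M (\<lambda>\<omega>. K\<^sup>2 + L\<^sup>2)" by simp
      show "AE \<omega> in M. (\<lambda>N. \<bar>E N \<omega> - Z \<omega>\<bar>) \<longlonglongrightarrow> 0"
        using Elim
      proof eventually_elim
        case (elim \<omega>)
        then have "(\<lambda>N. \<bar>E N \<omega> - Z \<omega>\<bar>) \<longlonglongrightarrow> \<bar>Z \<omega> - Z \<omega>\<bar>" by (intro tendsto_intros)
        then show ?case by simp
      qed
      show "AE \<omega> in M. norm \<bar>E N \<omega> - Z \<omega>\<bar> \<le> K\<^sup>2 + L\<^sup>2" for N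
        using E_le[of N] Z_le
      proof eventually_elim
        case (elim \<omega>)
        have "\<bar>E N \<omega> - Z \<omega>\<bar> \<le> \<bar>E N \<omega>\<bar> + \<bar>Z \<omega>\<bar>" by (rule abs_triangle_ineq4)
        also have "\<dots> \<le> (K\<^sup>2 + L\<^sup>2) / 2 + (K\<^sup>2 + L\<^sup>2) / 2" using elim by (rule add_mono)
        finally show ?case by (simp only: real_norm_def abs_idempotent field_sum_of_halves)
      qed
    qed measurable
    then show "(\<lambda>N. \<integral>\<omega>. \<bar>E N \<omega> - Z \<omega>\<bar> \<partial>M) \<longlonglongrightarrow> 0" by simp
  qed
  moreover have "has_hida_malliavin_derivative M T B n X (DX n)" "has_hida_malliavin_derivative M T B n Y (DY n)" for n
    unfolding DX_def DY_def using Xd(2)[of n] Yd(2)[of n] by simp_all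
  ultimately show ?thesis
    unfolding has_anti_wick_product_def E_def[abs_def] using Xd(1) Yd(1) by blast
qed

end

theorem theorem4p3:
  fixes M :: "'a measure" and T :: real and B :: "real \<Rightarrow> 'a \<Rightarrow> real"
    and f g :: "real \<Rightarrow> real" and u v w :: "real \<Rightarrow> real \<Rightarrow> real"
  assumes "brownian_space M T B"
    and "continuous_on UNIV f" and "bounded (range f)"
    and "continuous_on UNIV g" and "bounded (range g)"
    and "heat_solution T f u" and "gaussian_growth T u"
    and "heat_solution T g v" and "gaussian_growth T v"
    and "heat_solution T (\<lambda>x. f x * g x) w" and "gaussian_growth T w"
  shows "\<forall>t\<in>{0..T}.
           (\<lambda>\<omega>. u t (B t \<omega>)) \<in> G_sqrt2 M T B \<and>
           (\<lambda>\<omega>. v t (B t \<omega>)) \<in> G_sqrt2 M T B \<and>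
           has_anti_wick_product M T B
             (\<lambda>\<omega>. u t (B t \<omega>)) (\<lambda>\<omega>. v t (B t \<omega>)) (\<lambda>\<omega>. w t (B t \<omega>))"
proof
  fix t assume t: "t \<in> {0..T}"
  interpret brownian_space M T B by fact
  obtain K where f: "\<And>x. \<bar>f x\<bar> \<le> K"
    using assms(3) unfolding bounded_iff by auto
  obtain L where g: "\<And>x. \<bar>g x\<bar> \<le> L"
    using assms(5) unfolding bounded_iff by auto
  have fg: "continuous_on UNIV (\<lambda>x. f x * g x)" "\<bar>f x * g x\<bar> \<le> K * L" for x
    using assms(2,4) f[of x] g[of x] by (auto intro!: continuous_intros mult_mono simp: abs_mult)
  \<comment> \<open>Measurability comes from the continuity of the solution, since almost sure
    equality with a value of the flow would not give it by itself.\<close>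
  have meas: "(\<lambda>\<omega>. z t (B t \<omega>)) \<in> borel_measurable M" if "heat_solution T k z" for k z
  proof -
    have "continuous_on ({0..T} \<times> UNIV) (\<lambda>(t, x). z t x)"
      using that by (simp add: heat_solution_def)
    then have "continuous_on UNIV (\<lambda>x. (\<lambda>(t, x). z t x) (t, x))"
      by (rule continuous_on_compose2) (use t in \<open>auto intro!: continuous_intros\<close>)
    then have "(\<lambda>x. z t x) \<in> borel_measurable borel"
      by (simp add: borel_measurable_continuous_onI)
    then show ?thesis using measurable_B[OF t] by (rule measurable_compose[rotated])
  qed
  note u = heat_solution_unique[OF assms(6,7,2) f t] and v = heat_solution_unique[OF assms(8,9,4) g t]
    and w = heat_solution_unique[OF assms(10,11) fg t]
  show "(\<lambda>\<omega>. u t (B t \<omega>)) \<in> G_sqrt2 M T B \<and>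
           (\<lambda>\<omega>. v t (B t \<omega>)) \<in> G_sqrt2 M T B \<and>
           has_anti_wick_product M T B
             (\<lambda>\<omega>. u t (B t \<omega>)) (\<lambda>\<omega>. v t (B t \<omega>)) (\<lambda>\<omega>. w t (B t \<omega>))"
  proof (cases "t = 0")
    case False
    then show ?thesis
      using t u v w assms(2,4) f g meas[OF assms(6)] meas[OF assms(8)] meas[OF assms(10)]
      by (intro anti_wick_heat_flow[of t f K g L]) auto
  next
    \<comment> \<open>At time 0 the variables are constants, hence also values at time \<open>T\<close> of constant solutions.\<close>
    case True
    have const: "heat_flow T (\<lambda>_. c) x = c" for c x
      using std_normal.prob_space by (simp add: heat_flow_def)
    have z0: "AE \<omega> in M. z t (B t \<omega>) = heat_flow T (\<lambda>_. k 0) (B T \<omega>)" if "heat_solution T k z" for k z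
    proof -
      have "z 0 x = k x" for x using that by (simp add: heat_solution_def)
      then show ?thesis unfolding const True using start by (auto elim: eventually_mono)
    qed
    show ?thesis
      using horizon_pos f g z0[OF assms(6)] z0[OF assms(8)] z0[OF assms(10)]
        meas[OF assms(6)] meas[OF assms(8)] meas[OF assms(10)]
      by (intro anti_wick_heat_flow[of T "\<lambda>_. f 0" K "\<lambda>_. g 0" L]) auto
  qed
qed

end
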